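(* Let $\Bbbk$ be a field. The map of non-symmetric dg operads $\mathcal{O}\to\mathcal{A}ssoc_+$ sending $m$ to $m$, $j$ to $1$, and all $p_{n;i_1,\dots,i_k}$ with $n\ge 2$ to $0$, is a quasi-isomorphism. In particular, the dg operad $\mathcal{O}$ is quasi-isomorphic to the operad $\mathcal{A}ssoc_+$ of strictly unital associative algebras.
   Context: $\mathcal{A}ssoc_+$ is the non-symmetric $\Bbbk$-linear operad of unital associative algebras: $\mathcal{A}ssoc_+(N)=\Bbbk$ (in degree 0) for all $N\ge0$, with standard compositions; $m\in \mathcal{A}ssoc_+(2)$ is the product and $1\in\mathcal{A}ssoc_+(0)$ the unit. $\mathcal{O}$ is the non-symmetric dg operad over $\Bbbk$ (cohomological grading) which encodes the structure of a weakly unital dg category in the sense of Kontsevich–Soibelman. It is the quotient of the free graded operad on the generators (a) $m\in\mathcal{O}(2)^0$; (b) $p_{n;i_1,\dots,i_k}\in\mathcal{O}(n-k)^{-n+1}$ for $n\ge1$, $0\le k\le n$, $1\le i_1<\dots<i_k\le n$; (c) $j\in\mathcal{O}(0)^0$, by the relations (i) $m$ is associative, and $dm=0$; (ii) $m\circ(j,j)=j$, and $dj=0$; (iii) $p_{n;i_1,\dots,i_k}=0$ if $n\ge2$ and ($k=0$ or $k=n$); (iv) $p_{1;1}=j$, and $p_{1;-}=\mathrm{id}$ (the case $n=1$, $k=0$); with the differential on the $p$'s given as follows. Think of $p_{n;i_1,\dots,i_k}$ as the operation $(f_1,\dots,f_{n-k})\mapsto p_n(\dots)$, where the symbol $1$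 is placed in the positions $i_1,\dots,i_k$ and $f_1,\dots,f_{n-k}$ (in order) in the remaining positions. The differential expresses that the $p_n$ are the components of an $A_\infty$ functor from the algebra with strict unit $1$ formally adjoined: for a set $T=\{i_1<\dots<i_k\}\subset\{1,\dots,n\}$, $$d\,p_{n;T}=\sum_{r=1}^{n-1}(-1)^{r-1}\,q_{r}+\sum_{\ell=1}^{n-1}(-1)^{\ell}\,m\circ\big(p_{\ell;\,T\cap[1,\ell]},\ p_{n-\ell;\,(T\cap[\ell+1,n])-\ell}\big),$$ where $q_r$ is $p_{n-1}$ with the $r$-th and $(r+1)$-st arguments multiplied, using $1\cdot1=1$, $1\cdot f=f\cdot 1=f$. Explicitly, with $T'=\{i\in T:i<r\}\cup\{i-1: i\in T, i>r+1\}$: if $r,r+1\notin T$, then $q_r=p_{n-1;T'}\circ_s m$ with $s=r-\#\{i\in T:i<r\}$; if exactly one of $r,r+1$ is in $T$, then $q_r=p_{n-1;T'}$; if both are in $T$, then $q_r=p_{n-1;T'\cup\{r\}}$. *)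

theory Defs
  imports Complex_Main "HOL-Library.Poly_Mapping"
begin

section \<open>Non-symmetric dg operads\<close>

text \<open>
  All homogeneous pieces \<open>piece A N p\<close> (arity \<open>N\<close>, cohomological degree \<open>p\<close>) are subspaces of one
  ambient vector space; they need not be independent there, so that maps out of an operad are
  indexed by arity and degree.  Composition is given by the partial compositions
  \<open>pcomp A i a b\<close>, i.e. \<open>a \<circ>\<^sub>i b\<close> with \<open>i\<close> counted from 1.
\<close>

record ('k, 'a) operad_data =
  scl   :: "'k \<Rightarrow> 'a \<Rightarrow> 'a"
  piece :: "nat \<Rightarrow> int \<Rightarrow> 'a set"
  pcomp :: "nat \<Rightarrow> 'a \<Rightarrow> 'a \<Rightarrow> 'a"
  opid  :: "'a"
  dif   :: "'a \<Rightarrow> 'a"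

locale dg_operad = vector_space "scl A"
  for A :: "('k::field, 'a::ab_group_add) operad_data" +
  assumes piece_subspace: "subspace (piece A N p)"
    and opid_piece: "opid A \<in> piece A 1 0"
    and pcomp_piece:
      "\<lbrakk>a \<in> piece A M p; b \<in> piece A N q; 1 \<le> i; i \<le> M\<rbrakk>
        \<Longrightarrow> pcomp A i a b \<in> piece A (M + N - 1) (p + q)"
    and pcomp_add_left:
      "\<lbrakk>a \<in> piece A M p; a' \<in> piece A M p; b \<in> piece A N q; 1 \<le> i; i \<le> M\<rbrakk>
        \<Longrightarrow> pcomp A i (a + a') b = pcomp A i a b + pcomp A i a' b"
    and pcomp_add_right:
      "\<lbrakk>a \<in> piece A M p; b \<in> piece A N q; b' \<in> piece A N q; 1 \<le> i; i \<le> M\<rbrakk>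
        \<Longrightarrow> pcomp A i a (b + b') = pcomp A i a b + pcomp A i a b'"
    and pcomp_scl_left:
      "\<lbrakk>a \<in> piece A M p; b \<in> piece A N q; 1 \<le> i; i \<le> M\<rbrakk>
        \<Longrightarrow> pcomp A i (scl A u a) b = scl A u (pcomp A i a b)"
    and pcomp_scl_right:
      "\<lbrakk>a \<in> piece A M p; b \<in> piece A N q; 1 \<le> i; i \<le> M\<rbrakk>
        \<Longrightarrow> pcomp A i a (scl A u b) = scl A u (pcomp A i a b)"
    and pcomp_opid_left: "a \<in> piece A N p \<Longrightarrow> pcomp A 1 (opid A) a = a"
    and pcomp_opid_right:
      "\<lbrakk>a \<in> piece A N p; 1 \<le> i; i \<le> N\<rbrakk> \<Longrightarrow> pcomp A i a (opid A) = a"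
    and pcomp_sequential:
      "\<lbrakk>a \<in> piece A L p; b \<in> piece A M q; c \<in> piece A N r; 1 \<le> i; i \<le> L; 1 \<le> j; j \<le> M\<rbrakk>
        \<Longrightarrow> pcomp A (i - 1 + j) (pcomp A i a b) c = pcomp A i a (pcomp A j b c)"
    and pcomp_parallel:
      "\<lbrakk>a \<in> piece A L p; b \<in> piece A M q; c \<in> piece A N r; 1 \<le> i; i < k; k \<le> L\<rbrakk>
        \<Longrightarrow> pcomp A (k + M - 1) (pcomp A i a b) c
            = scl A ((-1) powi (q * r)) (pcomp A i (pcomp A k a c) b)"
    and dif_piece: "a \<in> piece A N p \<Longrightarrow> dif A a \<in> piece A N (p + 1)"
    and dif_add:
      "\<lbrakk>a \<in> piece A N p; a' \<in> piece A N p\<rbrakk> \<Longrightarrow> dif A (a + a') = dif A a + dif A a'"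
    and dif_scl: "a \<in> piece A N p \<Longrightarrow> dif A (scl A u a) = scl A u (dif A a)"
    and dif_dif: "a \<in> piece A N p \<Longrightarrow> dif A (dif A a) = 0"
    and dif_pcomp:
      "\<lbrakk>a \<in> piece A M p; b \<in> piece A N q; 1 \<le> i; i \<le> M\<rbrakk>
        \<Longrightarrow> dif A (pcomp A i a b)
            = pcomp A i (dif A a) b + scl A ((-1) powi p) (pcomp A i a (dif A b))"

locale dg_operad_hom = A: dg_operad A + B: dg_operad B
  for A :: "('k::field, 'a::ab_group_add) operad_data"
    and B :: "('k, 'b::ab_group_add) operad_data"
    and \<phi> :: "nat \<Rightarrow> int \<Rightarrow> 'a \<Rightarrow> 'b" +
  assumes hom_piece: "a \<in> piece A N p \<Longrightarrow> \<phi> N p a \<in> piece B N p"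
    and hom_add:
      "\<lbrakk>a \<in> piece A N p; a' \<in> piece A N p\<rbrakk> \<Longrightarrow> \<phi> N p (a + a') = \<phi> N p a + \<phi> N p a'"
    and hom_scl: "a \<in> piece A N p \<Longrightarrow> \<phi> N p (scl A u a) = scl B u (\<phi> N p a)"
    and hom_opid: "\<phi> 1 0 (opid A) = opid B"
    and hom_pcomp:
      "\<lbrakk>a \<in> piece A M p; b \<in> piece A N q; 1 \<le> i; i \<le> M\<rbrakk>
        \<Longrightarrow> \<phi> (M + N - 1) (p + q) (pcomp A i a b) = pcomp B i (\<phi> M p a) (\<phi> N q b)"
    and hom_dif: "a \<in> piece A N p \<Longrightarrow> \<phi> N (p + 1) (dif A a) = dif B (\<phi> N p a)"

definition cocycles :: "('k, 'a::ab_group_add) operad_data \<Rightarrow> nat \<Rightarrow> int \<Rightarrow> 'a set" where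
  "cocycles A N p = {a \<in> piece A N p. dif A a = 0}"

definition coboundaries :: "('k, 'a::ab_group_add) operad_data \<Rightarrow> nat \<Rightarrow> int \<Rightarrow> 'a set" where
  "coboundaries A N p = dif A ` piece A N (p - 1)"

definition cohomology :: "('k, 'a::ab_group_add) operad_data \<Rightarrow> nat \<Rightarrow> int \<Rightarrow> 'a set set" where
  "cohomology A N p =
    cocycles A N p // {(a, b). a \<in> cocycles A N p \<and> b \<in> cocycles A N p \<and> a - b \<in> coboundaries A N p}"

definition cohomology_map ::
  "('k, 'b::ab_group_add) operad_data \<Rightarrow> (nat \<Rightarrow> int \<Rightarrow> 'a \<Rightarrow> 'b) \<Rightarrow> nat \<Rightarrow> int \<Rightarrow> 'a set \<Rightarrow> 'b set"
where
  "cohomology_map B \<phi> N p C =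
    {b \<in> cocycles B N p. \<exists>a\<in>C. b - \<phi> N p a \<in> coboundaries B N p}"

definition quasi_iso ::
  "('k::field, 'a::ab_group_add) operad_data \<Rightarrow> ('k, 'b::ab_group_add) operad_data
    \<Rightarrow> (nat \<Rightarrow> int \<Rightarrow> 'a \<Rightarrow> 'b) \<Rightarrow> bool" where
  "quasi_iso A B \<phi> \<longleftrightarrow> dg_operad_hom A B \<phi> \<and>
    (\<forall>N p. bij_betw (cohomology_map B \<phi> N p) (cohomology A N p) (cohomology B N p))"

text \<open>
  Two operads are quasi-isomorphic if a zigzag of quasi-isomorphisms connects them.  Since a
  relation in HOL has a fixed type, all intermediate operads live on the element type of the
  first one.
\<close>

definition quasi_isomorphic ::
  "('k::field, 'a::ab_group_add) operad_data \<Rightarrow> ('k, 'b::ab_group_add) operad_data \<Rightarrow> bool" where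
  "quasi_isomorphic A B \<longleftrightarrow>
    (\<exists>C :: ('k, 'a) operad_data.
       (\<lambda>X Y. (\<exists>\<phi>. quasi_iso X Y \<phi>) \<or> (\<exists>\<phi>. quasi_iso Y X \<phi>))\<^sup>*\<^sup>* A C \<and>
       ((\<exists>\<phi>. quasi_iso C B \<phi>) \<or> (\<exists>\<phi>. quasi_iso B C \<phi>)))"


section \<open>The operad of unital associative algebras\<close>

definition assoc_operad :: "('k::field, 'k) operad_data" where
  "assoc_operad =
    \<lparr> scl = (*),
      piece = (\<lambda>N p. if p = 0 then UNIV else {0}),
      pcomp = (\<lambda>i a b. a * b),
      opid = 1,
      dif = (\<lambda>a. 0) \<rparr>"


section \<open>Free graded operads\<close>

text \<open>
  A basis of the free graded operad on generators \<open>g \<in> G\<close> of arity \<open>ar g\<close> and degree \<open>dg g\<close> is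
  given by the planar trees whose vertices are labelled by generators.  A tree stands for
  the composite of its vertices in preorder: with the Koszul sign rule,
  \<open>Node g [t\<^sub>1, \<dots>, t\<^sub>n]\<close> is \<open>g \<circ> (t\<^sub>1 \<otimes> \<dots> \<otimes> t\<^sub>n)\<close>, obtained without signs by
  inserting first \<open>t\<^sub>1\<close>, then \<open>t\<^sub>2\<close>, and so on.  Hence inserting \<open>s\<close> at a leaf of \<open>t\<close> moves \<open>s\<close>
  past the vertices of \<open>t\<close> that follow this leaf in preorder.
\<close>

datatype 'g tree = Leaf | Node 'g "'g tree list"

primrec leaves :: "'g tree \<Rightarrow> nat" where
  "leaves Leaf = 1"
| "leaves (Node g ts) = sum_list (map leaves ts)"

primrec tdeg :: "('g \<Rightarrow> int) \<Rightarrow> 'g tree \<Rightarrow> int" where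
  "tdeg dg Leaf = 0"
| "tdeg dg (Node g ts) = dg g + sum_list (map (tdeg dg) ts)"

fun wf_tree :: "'g set \<Rightarrow> ('g \<Rightarrow> nat) \<Rightarrow> 'g tree \<Rightarrow> bool" where
  "wf_tree G ar Leaf = True"
| "wf_tree G ar (Node g ts) = (g \<in> G \<and> length ts = ar g \<and> (\<forall>t\<in>set ts. wf_tree G ar t))"

fun graft :: "nat \<Rightarrow> 'g tree \<Rightarrow> 'g tree \<Rightarrow> 'g tree"
and graft_list :: "nat \<Rightarrow> 'g tree list \<Rightarrow> 'g tree \<Rightarrow> 'g tree list" where
  "graft i Leaf s = s"
| "graft i (Node g ts) s = Node g (graft_list i ts s)"
| "graft_list i [] s = []"
| "graft_list i (t # ts) s =
    (if i \<le> leaves t then graft i t s # ts else t # graft_list (i - leaves t) ts s)"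

text \<open>\<open>deg_after dg i t\<close> is the total degree of the vertices of \<open>t\<close> after its \<open>i\<close>-th leaf.\<close>

fun deg_after :: "('g \<Rightarrow> int) \<Rightarrow> nat \<Rightarrow> 'g tree \<Rightarrow> int"
and deg_after_list :: "('g \<Rightarrow> int) \<Rightarrow> nat \<Rightarrow> 'g tree list \<Rightarrow> int" where
  "deg_after dg i Leaf = 0"
| "deg_after dg i (Node g ts) = deg_after_list dg i ts"
| "deg_after_list dg i [] = 0"
| "deg_after_list dg i (t # ts) =
    (if i \<le> leaves t then deg_after dg i t + sum_list (map (tdeg dg) ts)
     else deg_after_list dg (i - leaves t) ts)"

type_synonym ('g, 'k) free = "'g tree \<Rightarrow>\<^sub>0 'k"

abbreviation mono :: "'g tree \<Rightarrow> ('g, 'k::field) free" where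
  "mono t \<equiv> Poly_Mapping.single t 1"

definition free_scl :: "'k::field \<Rightarrow> ('g, 'k) free \<Rightarrow> ('g, 'k) free" where
  "free_scl c f = Poly_Mapping.map ((*) c) f"

definition lin_ext :: "('g tree \<Rightarrow> ('g, 'k::field) free) \<Rightarrow> ('g, 'k) free \<Rightarrow> ('g, 'k) free" where
  "lin_ext h f = (\<Sum>t\<in>Poly_Mapping.keys f. free_scl (Poly_Mapping.lookup f t) (h t))"

text \<open>Trees without an \<open>i\<close>-th leaf contribute nothing to \<open>f \<circ>\<^sub>i g\<close>.\<close>

definition tree_comp :: "('g \<Rightarrow> int) \<Rightarrow> nat \<Rightarrow> 'g tree \<Rightarrow> 'g tree \<Rightarrow> ('g, 'k::field) free" where
  "tree_comp dg i t s =
    (if 1 \<le> i \<and> i \<le> leaves t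
     then free_scl ((-1) powi (tdeg dg s * deg_after dg i t)) (mono (graft i t s)) else 0)"

definition free_comp ::
  "('g \<Rightarrow> int) \<Rightarrow> nat \<Rightarrow> ('g, 'k::field) free \<Rightarrow> ('g, 'k) free \<Rightarrow> ('g, 'k) free" where
  "free_comp dg i f g = lin_ext (\<lambda>t. lin_ext (\<lambda>s. tree_comp dg i t s) g) f"

text \<open>
  \<open>free_dif dg \<delta>\<close> is the derivation of degree 1 of the free operad that extends \<open>\<delta>\<close> on generators:
  \<open>d (g \<circ> (t\<^sub>1 \<otimes> \<dots> \<otimes> t\<^sub>n)) = \<delta> g \<circ> (t\<^sub>1 \<otimes> \<dots> \<otimes> t\<^sub>n) +
     \<Sum>\<^sub>i (-1)\<^bsup>|g| + |t\<^sub>1| + \<dots> + |t\<^sub>i\<^sub>-\<^sub>1|\<^esup> g \<circ> (t\<^sub>1 \<otimes> \<dots> \<otimes> d t\<^sub>i \<otimes> \<dots> \<otimes> t\<^sub>n)\<close>.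
\<close>

fun plug :: "('g \<Rightarrow> int) \<Rightarrow> nat \<Rightarrow> ('g, 'k::field) free \<Rightarrow> 'g tree list \<Rightarrow> ('g, 'k) free" where
  "plug dg i f [] = f"
| "plug dg i f (t # ts) = plug dg (i + leaves t) (free_comp dg i f (mono t)) ts"

primrec tree_dif ::
  "('g \<Rightarrow> int) \<Rightarrow> ('g \<Rightarrow> ('g, 'k::field) free) \<Rightarrow> 'g tree \<Rightarrow> ('g, 'k) free" where
  "tree_dif dg \<delta> Leaf = 0"
| "tree_dif dg \<delta> (Node g ts) =
    plug dg 1 (\<delta> g) ts +
    (\<Sum>i<length ts.
       free_scl ((-1) powi (dg g + sum_list (map (tdeg dg) (take i ts))))
         (lin_ext (\<lambda>s. mono (Node g (ts[i := s]))) (map (tree_dif dg \<delta>) ts ! i)))"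

definition free_dif ::
  "('g \<Rightarrow> int) \<Rightarrow> ('g \<Rightarrow> ('g, 'k::field) free) \<Rightarrow> ('g, 'k) free \<Rightarrow> ('g, 'k) free" where
  "free_dif dg \<delta> = lin_ext (tree_dif dg \<delta>)"

definition free_operad ::
  "'g set \<Rightarrow> ('g \<Rightarrow> nat) \<Rightarrow> ('g \<Rightarrow> int) \<Rightarrow> ('g \<Rightarrow> ('g, 'k::field) free)
    \<Rightarrow> ('k, ('g, 'k) free) operad_data" where
  "free_operad G ar dg \<delta> =
    \<lparr> scl = free_scl,
      piece = (\<lambda>N p. {f. \<forall>t\<in>Poly_Mapping.keys f. wf_tree G ar t \<and> leaves t = N \<and> tdeg dg t = p}),
      pcomp = free_comp dg,
      opid = mono Leaf,
      dif = free_dif dg \<delta> \<rparr>"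

inductive_set operad_ideal ::
  "('k::field, 'a::ab_group_add) operad_data \<Rightarrow> 'a set \<Rightarrow> 'a set"
  for A :: "('k, 'a) operad_data" and R :: "'a set" where
  gen: "x \<in> R \<Longrightarrow> x \<in> operad_ideal A R"
| zero: "0 \<in> operad_ideal A R"
| add: "x \<in> operad_ideal A R \<Longrightarrow> y \<in> operad_ideal A R \<Longrightarrow> x + y \<in> operad_ideal A R"
| scl: "x \<in> operad_ideal A R \<Longrightarrow> scl A c x \<in> operad_ideal A R"
| comp_left: "\<lbrakk>x \<in> operad_ideal A R; x \<in> piece A M p; y \<in> piece A N q; 1 \<le> i; i \<le> M\<rbrakk>
    \<Longrightarrow> pcomp A i x y \<in> operad_ideal A R"
| comp_right: "\<lbrakk>x \<in> operad_ideal A R; x \<in> piece A N q; y \<in> piece A M p; 1 \<le> i; i \<le> M\<rbrakk>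
    \<Longrightarrow> pcomp A i y x \<in> operad_ideal A R"


section \<open>The operad of weakly unital dg categories\<close>

text \<open>\<open>GenP n T\<close> is the generator \<open>p\<^bsub>n;T\<^esub>\<close>; only \<open>n \<ge> 1\<close>, \<open>T \<subseteq> {1..n}\<close> belong to \<open>gens\<close>.\<close>

datatype gen = GenM | GenP nat "nat set" | GenJ

definition gens :: "gen set" where
  "gens = {GenM, GenJ} \<union> {GenP n T | n T. 1 \<le> n \<and> T \<subseteq> {1..n}}"

primrec gar :: "gen \<Rightarrow> nat" where
  "gar GenM = 2"
| "gar (GenP n T) = n - card T"
| "gar GenJ = 0"

primrec gdeg :: "gen \<Rightarrow> int" where
  "gdeg GenM = 0"
| "gdeg (GenP n T) = 1 - int n"
| "gdeg GenJ = 0"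

definition corolla :: "gen \<Rightarrow> gen tree" where
  "corolla g = Node g (replicate (gar g) Leaf)"

text \<open>\<open>q_term n T r\<close> is \<open>p\<^bsub>n-1\<^esub>\<close> with the arguments in positions \<open>r\<close> and \<open>r + 1\<close> multiplied.\<close>

definition q_term :: "nat \<Rightarrow> nat set \<Rightarrow> nat \<Rightarrow> (gen, 'k::field) free" where
  "q_term n T r =
    (let T' = {i \<in> T. i < r} \<union> (\<lambda>i. i - 1) ` {i \<in> T. i > r + 1} in
     if r \<notin> T \<and> r + 1 \<notin> T then
       free_comp gdeg (r - card {i \<in> T. i < r}) (mono (corolla (GenP (n - 1) T'))) (mono (corolla GenM))
     else if r \<in> T \<and> r + 1 \<in> T then mono (corolla (GenP (n - 1) (insert r T')))
     else mono (corolla (GenP (n - 1) T')))"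

definition m_term :: "nat \<Rightarrow> nat set \<Rightarrow> nat \<Rightarrow> (gen, 'k::field) free" where
  "m_term n T l =
    mono (Node GenM [corolla (GenP l (T \<inter> {1..l})),
                  corolla (GenP (n - l) ((\<lambda>i. i - l) ` (T \<inter> {l + 1..n})))])"

primrec gen_dif :: "gen \<Rightarrow> (gen, 'k::field) free" where
  "gen_dif GenM = 0"
| "gen_dif (GenP n T) =
    (\<Sum>r\<in>{1..n - 1}. free_scl ((-1) ^ (r - 1)) (q_term n T r)) +
    (\<Sum>l\<in>{1..n - 1}. free_scl ((-1) ^ l) (m_term n T l))"
| "gen_dif GenJ = 0"

definition wu_free :: "('k::field, (gen, 'k) free) operad_data" where
  "wu_free = free_operad gens gar gdeg gen_dif"

definition wu_relations :: "(gen, 'k::field) free set" where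
  "wu_relations =
    {mono (Node GenM [corolla GenM, Leaf]) - mono (Node GenM [Leaf, corolla GenM]),
     mono (Node GenM [corolla GenJ, corolla GenJ]) - mono (corolla GenJ),
     mono (corolla (GenP 1 {1})) - mono (corolla GenJ),
     mono (corolla (GenP 1 {})) - mono Leaf}
    \<union> {mono (corolla (GenP n T)) | n T. 2 \<le> n \<and> (T = {} \<or> T = {1..n})}"

definition wu_ideal :: "(gen, 'k::field) free set" where
  "wu_ideal = operad_ideal wu_free wu_relations"

definition wu_rel :: "(gen, 'k::field) free \<Rightarrow> (gen, 'k) free \<Rightarrow> bool" where
  "wu_rel x y \<longleftrightarrow> x - y \<in> wu_ideal"

lemma scl_wu_free [simp]: "scl wu_free = free_scl"
  by (simp add: wu_free_def free_operad_def)

lemma lookup_free_scl: "Poly_Mapping.lookup (free_scl c f) t = c * Poly_Mapping.lookup f t"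
  by (simp add: free_scl_def Poly_Mapping.map.rep_eq when_def)

lemma free_scl_add: "free_scl c (f + g) = free_scl c f + free_scl c g"
  by (rule poly_mapping_eqI) (simp add: lookup_free_scl lookup_add algebra_simps)

lemma free_scl_diff: "free_scl c (f - g) = free_scl c f - free_scl c g"
  by (rule poly_mapping_eqI) (simp add: lookup_free_scl lookup_minus algebra_simps)

lemma free_scl_minus_one: "free_scl (-1) f = - f"
  by (rule poly_mapping_eqI) (simp add: lookup_free_scl)

lemma wu_ideal_zero: "0 \<in> wu_ideal"
  unfolding wu_ideal_def by (rule operad_ideal.zero)

lemma wu_ideal_add: "x \<in> wu_ideal \<Longrightarrow> y \<in> wu_ideal \<Longrightarrow> x + y \<in> wu_ideal"
  unfolding wu_ideal_def by (rule operad_ideal.add)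

lemma wu_ideal_scl: "x \<in> wu_ideal \<Longrightarrow> free_scl c x \<in> wu_ideal"
  using operad_ideal.scl[of x wu_free wu_relations c] by (simp add: wu_ideal_def)

lemma wu_ideal_uminus: "x \<in> wu_ideal \<Longrightarrow> - x \<in> wu_ideal"
  using wu_ideal_scl[of x "-1"] by (simp add: free_scl_minus_one)

lemma equivp_wu_rel: "equivp (wu_rel :: (gen, 'k::field) free \<Rightarrow> _)"
proof (rule equivpI)
  show "reflp wu_rel" by (simp add: reflp_def wu_rel_def wu_ideal_zero)
  show "symp wu_rel"
    unfolding symp_def wu_rel_def by (metis minus_diff_eq wu_ideal_uminus)
  show "transp (wu_rel :: (gen, 'k) free \<Rightarrow> _)"
  proof (rule transpI)
    fix x y z :: "(gen, 'k) free"
    assume "wu_rel x y" "wu_rel y z"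
    then have "(x - y) + (y - z) \<in> wu_ideal" unfolding wu_rel_def by (rule wu_ideal_add)
    then show "wu_rel x z" by (simp add: wu_rel_def)
  qed
qed

quotient_type (overloaded) 'k wu = "(gen, 'k::field) free" / wu_rel
  by (rule equivp_wu_rel)

instantiation wu :: (field) ab_group_add
begin

lift_definition zero_wu :: "'a wu" is 0 .

lift_definition plus_wu :: "'a wu \<Rightarrow> 'a wu \<Rightarrow> 'a wu" is "(+)"
proof -
  fix a b c d :: "(gen, 'a) free"
  assume "wu_rel a b" "wu_rel c d"
  then have "(a - b) + (c - d) \<in> wu_ideal" unfolding wu_rel_def by (rule wu_ideal_add)
  then show "wu_rel (a + c) (b + d)" by (simp add: wu_rel_def algebra_simps)
qed

lift_definition uminus_wu :: "'a wu \<Rightarrow> 'a wu" is uminus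
proof -
  fix a b :: "(gen, 'a) free"
  assume "wu_rel a b"
  then have "- (a - b) \<in> wu_ideal" unfolding wu_rel_def by (rule wu_ideal_uminus)
  then show "wu_rel (- a) (- b)" by (simp add: wu_rel_def)
qed

definition minus_wu :: "'a wu \<Rightarrow> 'a wu \<Rightarrow> 'a wu" where
  "minus_wu x y = x + - y"

instance
proof
  fix a b c :: "'a wu"
  have refl: "wu_rel x x" for x :: "(gen, 'a) free"
    by (simp add: wu_rel_def wu_ideal_zero)
  show "a + b + c = a + (b + c)" by transfer (simp add: refl add.assoc)
  show "a + b = b + a" by transfer (simp add: refl add.commute)
  show "0 + a = a" by transfer (simp add: refl)
  show "- a + a = 0" by transfer (simp add: refl)
  show "a - b = a + - b" by (rule minus_wu_def)
qed

end

lift_definition wu_scl :: "'k::field \<Rightarrow> 'k wu \<Rightarrow> 'k wu" is free_scl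
  unfolding wu_rel_def by (simp add: free_scl_diff [symmetric] wu_ideal_scl)

text \<open>
  The operations of the quotient are computed on representatives; the relations generate a
  differential ideal, so the choice does not matter.
\<close>

definition wu_operad :: "('k::field, 'k wu) operad_data" where
  "wu_operad =
    \<lparr> scl = wu_scl,
      piece = (\<lambda>N p. abs_wu ` piece wu_free N p),
      pcomp = (\<lambda>i x y. abs_wu (pcomp wu_free i (rep_wu x) (rep_wu y))),
      opid = abs_wu (opid wu_free),
      dif = (\<lambda>x. abs_wu (dif wu_free (rep_wu x))) \<rparr>"

definition wu_gen :: "gen \<Rightarrow> 'k::field wu" where
  "wu_gen g = abs_wu (mono (corolla g))"

definition canonical_map :: "(nat \<Rightarrow> int \<Rightarrow> 'k::field wu \<Rightarrow> 'k) \<Rightarrow> bool" where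
  "canonical_map \<phi> \<longleftrightarrow>
    dg_operad_hom wu_operad assoc_operad \<phi> \<and>
    \<phi> 2 0 (wu_gen GenM) = 1 \<and>
    \<phi> 0 0 (wu_gen GenJ) = 1 \<and>
    (\<forall>n T. 2 \<le> n \<and> T \<subseteq> {1..n} \<longrightarrow> \<phi> (n - card T) (1 - int n) (wu_gen (GenP n T)) = 0)"

end

theory Submission
  imports Defs
begin

text \<open>
  The relations can be read as rewriting rules: every tree either vanishes or has a normal form, an
  alternating word in the idempotent \<open>j\<close> and in letters, where a letter is an input or a bracket
  \<open>p\<^sub>n(a\<^sub>1, \<dots>, a\<^sub>n)\<close> whose entries are words or symbols \<open>1\<close>, not all of the same kind.  So \<open>\<O>\<close> is,
  arity by arity, the complex spanned by words.  It is augmented by killing all brackets, and the point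
  is that a cocycle \<open>x\<close> of augmentation 0 is a coboundary.

  Let \<open>u = 1 - j\<close>.  The brackets \<open>p\<^sub>2(1, -)\<close> and \<open>p\<^sub>2(-, 1)\<close> are homotopies that contract left and right
  multiplication by \<open>u\<close>.  Modulo the ideal generated by \<open>u\<close>, every gap between letters
  contains \<open>j\<close>, and the leading part of the differential, for the filtration by the number of symbols
  \<open>1\<close>, drops one symbol \<open>1\<close> inside a bracket; it is contractible on words with a bracket.
  The number of symbols \<open>1\<close> is bounded in terms of the degree, so \<open>x\<close> may be moved into the ideal
  generated by \<open>u\<close>, and then, since \<open>u\<close> acts as zero up to homotopy, into \<open>j x j\<close>.  A word \<open>f u y\<close> with
  \<open>f\<close> in the corner and free of \<open>u\<close> is contracted by \<open>p\<^sub>2(1, -)\<close> applied to \<open>u y\<close>, up to words in which the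
  degree of \<open>f\<close> has grown; degrees are nonpositive, so this process ends.
\<close>

text \<open>The ideal of relations is not accessible directly. Evaluating trees in the module of
  words, where the relations hold by construction, turns membership into \<open>NF x = 0\<close> for
  combinations of well-formed trees. Since \<open>NF\<close> commutes with the differentials,
  stability of the ideal under the differential comes for free. The square of the differential
  vanishes only modulo the ideal; it is computed on brackets of inputs and symbols \<open>1\<close>,
  where no Koszul signs occur, and spreads to all trees because it is a derivation.

  One contraction is not enough for acyclicity. The differential of \<open>p_n(1, a, ...)\<close>
  with a proper word \<open>a\<close> contains \<open>b - j b\<close>, where
  \<open>b = p_{n-1}(a, ...)\<close>. These two terms also drop a symbol \<open>1\<close>, but do
  not fit the complex on blocks of symbols; they cancel only modulo \<open>u\<close>. This forces
  the passage to the quotient by the ideal of \<open>u\<close>, and a separate argument for that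
  ideal. All contractions have coefficients 1 or -1, so the characteristic of the field is
  irrelevant.

  A canonical map is prescribed on generators only; its remaining values are recovered from
  exactness in degree 0.\<close>

abbreviation "keys \<equiv> Poly_Mapping.keys"
abbreviation "lookup \<equiv> Poly_Mapping.lookup"
abbreviation "single \<equiv> Poly_Mapping.single"

section \<open>Linear maps between free modules\<close>

text \<open>\<open>free_scl\<close> and \<open>lin_ext\<close> are tied to trees; the same
  operations are needed over words, lists of words and a one-point basis.\<close>

definition sc :: "'k::field \<Rightarrow> ('b \<Rightarrow>\<^sub>0 'k) \<Rightarrow> ('b \<Rightarrow>\<^sub>0 'k)" where
  "sc c f = Poly_Mapping.map ((*) c) f"

definition lin :: "('a \<Rightarrow> ('b \<Rightarrow>\<^sub>0 'k::field)) \<Rightarrow> ('a \<Rightarrow>\<^sub>0 'k) \<Rightarrow> ('b \<Rightarrow>\<^sub>0 'k)" where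
  "lin h f = (\<Sum>t\<in>keys f. sc (lookup f t) (h t))"

definition linmap :: "(('a \<Rightarrow>\<^sub>0 'k::field) \<Rightarrow> ('b \<Rightarrow>\<^sub>0 'k)) \<Rightarrow> bool" where
  "linmap A \<longleftrightarrow> (\<forall>x y. A (x + y) = A x + A y) \<and> (\<forall>c x. A (sc c x) = sc c (A x))"

lemma free_scl_eq_sc: "free_scl = sc"
  by (intro ext) (simp add: free_scl_def sc_def)

lemma lin_ext_eq_lin: "lin_ext = lin"
  by (intro ext) (simp add: lin_ext_def lin_def free_scl_eq_sc)

lemma lookup_sc [simp]: "lookup (sc c f) t = c * lookup f t"
  by (simp add: sc_def Poly_Mapping.map.rep_eq when_def)

lemma sc_add: "sc c (f + g) = sc c f + sc c g"
  by (rule poly_mapping_eqI) (simp add: lookup_add algebra_simps)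

lemma sc_diff: "sc c (f - g) = sc c f - sc c g"
  by (rule poly_mapping_eqI) (simp add: lookup_minus algebra_simps)

lemma sc_minus: "sc c (- f) = - sc c f"
  by (rule poly_mapping_eqI) simp

lemma sc_minus_left: "sc (- c) f = - sc c f"
  by (rule poly_mapping_eqI) simp

lemma sc_add_left: "sc (c + d) f = sc c f + sc d f"
  by (rule poly_mapping_eqI) (simp add: lookup_add algebra_simps)

lemma sc_zero [simp]: "sc c 0 = 0" "sc 0 f = 0"
  by (rule poly_mapping_eqI, simp)+

lemma sc_one [simp]: "sc 1 f = f"
  by (rule poly_mapping_eqI) simp

lemma sc_sc [simp]: "sc c (sc d f) = sc (c * d) f"
  by (rule poly_mapping_eqI) (simp add: mult.assoc)

lemma sc_sum: "sc c (sum f I) = (\<Sum>i\<in>I. sc c (f i))"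
  by (induction I rule: infinite_finite_induct) (auto simp: sc_add)

lemma sc_single [simp]: "sc c (single t d) = single t (c * d)"
  by (rule poly_mapping_eqI) (simp add: lookup_single when_def)

lemma keys_sc: "keys (sc c f) \<subseteq> keys f"
  by (auto simp: in_keys_iff)

lemma linmapI:
  assumes "\<And>x y. A (x + y) = A x + A y" "\<And>c x. A (sc c x) = sc c (A x)"
  shows "linmap A"
  using assms by (simp add: linmap_def)

lemma linmap_add: "linmap A \<Longrightarrow> A (x + y) = A x + A y"
  and linmap_sc: "linmap A \<Longrightarrow> A (sc c x) = sc c (A x)"
  by (simp_all add: linmap_def)

lemma linmap_zero: "linmap A \<Longrightarrow> A 0 = 0"
  using linmap_sc[of A 0 0] by simp

lemma linmap_minus: "linmap A \<Longrightarrow> A (- x) = - A x"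
  using linmap_sc[of A "-1" x] by (simp add: sc_minus_left)

lemma linmap_diff: "linmap A \<Longrightarrow> A (x - y) = A x - A y"
  using linmap_add[of A x "- y"] by (simp add: linmap_minus)

lemma linmap_sum: "linmap A \<Longrightarrow> A (sum f I) = (\<Sum>i\<in>I. A (f i))"
  by (induction I rule: infinite_finite_induct) (auto simp: linmap_zero linmap_add)

lemma linmap_sc_left: "linmap A \<Longrightarrow> linmap (\<lambda>x. sc c (A x))"
  by (simp add: linmap_def sc_add mult.commute)

lemma linmap_plus: "linmap A \<Longrightarrow> linmap B \<Longrightarrow> linmap (\<lambda>x. A x + B x)"
  by (simp add: linmap_def sc_add algebra_simps)

lemma linmap_minus_left: "linmap A \<Longrightarrow> linmap (\<lambda>x. - A x)"
  by (simp add: linmap_def sc_minus)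

lemma linmap_sub: "linmap A \<Longrightarrow> linmap B \<Longrightarrow> linmap (\<lambda>x. A x - B x)"
  by (simp add: linmap_def sc_diff algebra_simps)

lemma linmap_comp: "linmap A \<Longrightarrow> linmap B \<Longrightarrow> linmap (\<lambda>x. A (B x))"
  by (simp add: linmap_def)

lemma linmap_id [simp]: "linmap (\<lambda>x. x)"
  by (simp add: linmap_def)

lemma linmap_const_zero [simp]: "linmap (\<lambda>x. 0)"
  by (simp add: linmap_def)

lemma linmap_sum_left: "(\<And>i. i \<in> I \<Longrightarrow> linmap (A i)) \<Longrightarrow> linmap (\<lambda>x. \<Sum>i\<in>I. A i x)"
  by (auto simp: linmap_def sum.distrib sc_sum)

lemma lin_on_superset: "finite S \<Longrightarrow> keys f \<subseteq> S \<Longrightarrow> lin h f = (\<Sum>t\<in>S. sc (lookup f t) (h t))"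
  unfolding lin_def by (rule sum.mono_neutral_left) (auto simp: in_keys_iff)

lemma linmap_lin [simp]: "linmap (lin h)"
proof (rule linmapI)
  fix x y :: "'a \<Rightarrow>\<^sub>0 'b"
  let ?S = "keys x \<union> keys y"
  have "lin h (x + y) = (\<Sum>t\<in>?S. sc (lookup (x + y) t) (h t))"
    by (rule lin_on_superset) (auto dest: subsetD[OF keys_add])
  also have "\<dots> = lin h x + lin h y"
    by (simp add: lin_on_superset[of ?S x] lin_on_superset[of ?S y] lookup_add sc_add_left sum.distrib)
  finally show "lin h (x + y) = lin h x + lin h y" .
next
  fix c and x :: "'a \<Rightarrow>\<^sub>0 'b"
  have "lin h (sc c x) = (\<Sum>t\<in>keys x. sc (lookup (sc c x) t) (h t))"
    by (rule lin_on_superset) (auto dest: subsetD[OF keys_sc])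
  then show "lin h (sc c x) = sc c (lin h x)" by (simp add: lin_def sc_sum)
qed

lemmas lin_zero [simp] = linmap_zero[OF linmap_lin] and lin_diff = linmap_diff[OF linmap_lin]

lemma lin_single [simp]: "lin h (single t c) = sc c (h t)"
  by (cases "c = 0") (simp_all add: lin_def)

lemma poly_mapping_expand: "f = (\<Sum>t\<in>keys f. sc (lookup f t) (single t 1))"
proof (rule poly_mapping_eqI)
  fix k
  show "lookup f k = lookup (\<Sum>t\<in>keys f. sc (lookup f t) (single t 1)) k"
    by (cases "k \<in> keys f")
      (auto simp: lookup_sum lookup_single when_def in_keys_iff sum.delta' cong: if_cong)
qed

lemma linmap_expand:
  assumes "linmap A"
  shows "A f = (\<Sum>t\<in>keys f. sc (lookup f t) (A (single t 1)))"
  by (subst poly_mapping_expand[of f]) (simp only: linmap_sum[OF assms] linmap_sc[OF assms])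

lemma linmap_eqI:
  assumes "linmap A" "linmap B" "\<And>t. t \<in> keys f \<Longrightarrow> A (single t 1) = B (single t 1)"
  shows "A f = B f"
  by (subst linmap_expand[OF assms(1)], subst linmap_expand[OF assms(2)], rule sum.cong) (simp_all add: assms(3))

lemma linmap_lin_left:
  assumes "\<And>t. linmap (\<lambda>x. h x t)"
  shows "linmap (\<lambda>x. lin (h x) f)"
  unfolding lin_def by (intro linmap_sum_left linmap_sc_left assms)

inductive_set lspan :: "('b \<Rightarrow>\<^sub>0 'k::field) set \<Rightarrow> ('b \<Rightarrow>\<^sub>0 'k) set" for B where
  base: "x \<in> B \<Longrightarrow> x \<in> lspan B"
| zero: "0 \<in> lspan B"
| add: "x \<in> lspan B \<Longrightarrow> y \<in> lspan B \<Longrightarrow> x + y \<in> lspan B"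
| scale: "x \<in> lspan B \<Longrightarrow> sc c x \<in> lspan B"

lemma lspan_minus: "x \<in> lspan B \<Longrightarrow> - x \<in> lspan B"
  using lspan.scale[of x B "-1"] by (simp add: sc_minus_left)

lemma lspan_diff: "x \<in> lspan B \<Longrightarrow> y \<in> lspan B \<Longrightarrow> x - y \<in> lspan B"
  using lspan.add[of x B "- y"] by (simp add: lspan_minus)

lemma lspan_sum: "(\<And>i. i \<in> I \<Longrightarrow> f i \<in> lspan B) \<Longrightarrow> sum f I \<in> lspan B"
  by (induction I rule: infinite_finite_induct) (auto intro: lspan.intros)

lemma lspan_linmap:
  assumes "linmap A" "\<And>t. t \<in> keys f \<Longrightarrow> A (single t 1) \<in> lspan B"
  shows "A f \<in> lspan B"
  by (subst linmap_expand[OF assms(1)], intro lspan_sum lspan.scale assms(2))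

lemma lspan_map:
  assumes "x \<in> lspan B" "linmap A" "\<And>b. b \<in> B \<Longrightarrow> A b \<in> lspan C"
  shows "A x \<in> lspan C"
  using assms(1)
  by (induction rule: lspan.induct)
    (auto simp: linmap_zero linmap_add linmap_sc assms(2,3) intro: lspan.intros)

text \<open>Homogeneous components and the filtration by symbols \<open>1\<close> are spanned by
  basis elements; with \<open>supp_linmap\<close> and \<open>linmap_eq_supp\<close>, claims about
  linear maps on them are checked on basis elements only.\<close>

definition supp :: "'b set \<Rightarrow> ('b \<Rightarrow>\<^sub>0 'k::field) set" where
  "supp S = {f. keys f \<subseteq> S}"

lemma supp_zero [simp]: "0 \<in> supp S"
  and supp_add: "f \<in> supp S \<Longrightarrow> g \<in> supp S \<Longrightarrow> f + g \<in> supp S"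
  and supp_sc: "f \<in> supp S \<Longrightarrow> sc c f \<in> supp S"
  and supp_single: "t \<in> S \<Longrightarrow> single t c \<in> supp S"
  and supp_minus: "f \<in> supp S \<Longrightarrow> - f \<in> supp S"
  and supp_mono: "f \<in> supp S \<Longrightarrow> S \<subseteq> S' \<Longrightarrow> f \<in> supp S'"
  using keys_add[of f g] keys_sc[of c f] by (auto simp: supp_def)

lemma supp_diff: "f \<in> supp S \<Longrightarrow> g \<in> supp S \<Longrightarrow> f - g \<in> supp S"
  using supp_add[of f S "- g"] by (simp add: supp_minus)

lemma supp_sum: "(\<And>i. i \<in> I \<Longrightarrow> f i \<in> supp S) \<Longrightarrow> sum f I \<in> supp S"
  by (induction I rule: infinite_finite_induct) (auto intro: supp_add)

lemma supp_linmap: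
  assumes "linmap A" "f \<in> supp S" "\<And>t. t \<in> S \<Longrightarrow> A (single t 1) \<in> supp S'"
  shows "A f \<in> supp S'"
  by (subst linmap_expand[OF assms(1)], intro supp_sum supp_sc assms(3))
    (use assms(2) in \<open>auto simp: supp_def\<close>)

lemma linmap_eq_supp:
  assumes "f \<in> supp S" "linmap A" "linmap B" "\<And>t. t \<in> S \<Longrightarrow> A (single t 1) = B (single t 1)"
  shows "A f = B f"
  by (rule linmap_eqI[OF assms(2,3)], rule assms(4)) (use assms(1) in \<open>auto simp: supp_def\<close>)

text \<open>A sign that depends only on the parity of an integer, so that degrees, which are mostly
  negative, can be added and negated freely in the exponent.\<close>

definition pm :: "int \<Rightarrow> 'k::field" where
  "pm n = (if even n then 1 else - 1)"

lemma pm_simps [simp]: "pm 0 = 1" "pm n * pm n = 1" "pm (- n) = pm n" "pm 1 = -1"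
  by (simp_all add: pm_def)

lemma powi_eq_pm: "(-1) powi n = pm n"
  by (simp add: pm_def power_int_minus_left)

lemma power_eq_pm: "(-1) ^ n = (pm (int n))"
  by (simp add: pm_def)

lemma pm_add: "pm (m + n) = pm m * pm n"
  by (auto simp: pm_def)

lemma pm_diff: "pm (m - n) = pm m * pm n"
  by (auto simp: pm_def)

lemma pm_cancel [simp]: "pm n * (pm n * x) = x"
  by (simp add: mult.assoc[symmetric])

section \<open>Free graded operads\<close>

lemma leaves_graft:
  "1 \<le> i \<Longrightarrow> i \<le> leaves t \<Longrightarrow> leaves (graft i t s) + 1 = leaves t + leaves s"
  "1 \<le> i \<Longrightarrow> i \<le> sum_list (map leaves ts) \<Longrightarrow>
    sum_list (map leaves (graft_list i ts s)) + 1 = sum_list (map leaves ts) + leaves s"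
  by (induction i t s and i ts s rule: graft_graft_list.induct) (auto simp: not_le)

lemma tdeg_graft:
  "1 \<le> i \<Longrightarrow> i \<le> leaves t \<Longrightarrow> tdeg dg (graft i t s) = tdeg dg t + tdeg dg s"
  "1 \<le> i \<Longrightarrow> i \<le> sum_list (map leaves ts) \<Longrightarrow>
    sum_list (map (tdeg dg) (graft_list i ts s)) = sum_list (map (tdeg dg) ts) + tdeg dg s"
  by (induction i t s and i ts s rule: graft_graft_list.induct) auto

lemma length_graft_list [simp]: "length (graft_list i ts s) = length ts"
  by (induction ts arbitrary: i) auto

lemma wf_graft:
  "wf_tree G ar t \<Longrightarrow> wf_tree G ar s \<Longrightarrow> wf_tree G ar (graft i t s)"
  "\<forall>t\<in>set ts. wf_tree G ar t \<Longrightarrow> wf_tree G ar s \<Longrightarrow> \<forall>t\<in>set (graft_list i ts s). wf_tree G ar t"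
  by (induction i t s and i ts s rule: graft_graft_list.induct) auto

lemma graft_seq:
  "1 \<le> i \<Longrightarrow> i \<le> leaves t \<Longrightarrow> 1 \<le> j \<Longrightarrow> j \<le> leaves s \<Longrightarrow>
    graft (i - 1 + j) (graft i t s) u = graft i t (graft j s u)"
  "1 \<le> i \<Longrightarrow> i \<le> sum_list (map leaves ts) \<Longrightarrow> 1 \<le> j \<Longrightarrow> j \<le> leaves s \<Longrightarrow>
    graft_list (i - 1 + j) (graft_list i ts s) u = graft_list i ts (graft j s u)"
proof (induction i t s and i ts s rule: graft_graft_list.induct)
  case (4 i t ts s)
  show ?case
  proof (cases "i \<le> leaves t")
    case True
    then have "i - 1 + j \<le> leaves (graft i t s)"
      using leaves_graft(1)[of i t s] 4(3-) by simp
    then show ?thesis using 4 True by simp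
  next
    case False
    then have "\<not> i - 1 + j \<le> leaves t" "i - 1 + j - leaves t = i - leaves t - 1 + j"
      using 4(3-) by auto
    then show ?thesis using 4 False by simp
  qed
qed auto

lemma deg_after_seq:
  "1 \<le> i \<Longrightarrow> i \<le> leaves t \<Longrightarrow> 1 \<le> j \<Longrightarrow> j \<le> leaves s \<Longrightarrow>
    deg_after dg (i - 1 + j) (graft i t s) = deg_after dg j s + deg_after dg i t"
  "1 \<le> i \<Longrightarrow> i \<le> sum_list (map leaves ts) \<Longrightarrow> 1 \<le> j \<Longrightarrow> j \<le> leaves s \<Longrightarrow>
    deg_after_list dg (i - 1 + j) (graft_list i ts s) = deg_after dg j s + deg_after_list dg i ts"
proof (induction i t s and i ts s rule: graft_graft_list.induct)
  case (4 i t ts s)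
  show ?case
  proof (cases "i \<le> leaves t")
    case True
    then have "i - 1 + j \<le> leaves (graft i t s)"
      using leaves_graft(1)[of i t s] 4(3-) by simp
    then show ?thesis using 4 True by simp
  next
    case False
    then have "\<not> i - 1 + j \<le> leaves t" "i - 1 + j - leaves t = i - leaves t - 1 + j"
      using 4(3-) by auto
    then show ?thesis using 4 False by simp
  qed
qed auto

lemma graft_par:
  "1 \<le> i \<Longrightarrow> i < k \<Longrightarrow> k \<le> leaves t \<Longrightarrow>
    graft (k + leaves s - 1) (graft i t s) u = graft i (graft k t u) s"
  "1 \<le> i \<Longrightarrow> i < k \<Longrightarrow> k \<le> sum_list (map leaves ts) \<Longrightarrow>
    graft_list (k + leaves s - 1) (graft_list i ts s) u = graft_list i (graft_list k ts u) s"
proof (induction i t s and i ts s arbitrary: k and k rule: graft_graft_list.induct)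
  case (4 i t ts s)
  consider "k \<le> leaves t" | "i \<le> leaves t" "leaves t < k" | "leaves t < i" by linarith
  then show ?case
  proof cases
    case 1
    then have "k + leaves s - 1 \<le> leaves (graft i t s)" "i \<le> leaves (graft k t u)"
      using leaves_graft(1)[of i t s] leaves_graft(1)[of k t u] 4(3-) by simp_all
    then show ?thesis using 4 1 by simp
  next
    case 2
    then have "leaves (graft i t s) + 1 = leaves t + leaves s" using 4(3-) leaves_graft(1) by blast
    then have "\<not> k + leaves s - 1 \<le> leaves (graft i t s)"
      "k + leaves s - 1 - leaves (graft i t s) = k - leaves t"
      using 2 by simp_all
    then show ?thesis using 4(3-) 2 by simp
  next
    case 3
    then have out: "\<not> k + leaves s - 1 \<le> leaves t"
      and eq: "k - leaves t + leaves s - 1 = k + leaves s - 1 - leaves t"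
      using 4(3-) by auto
    have "1 \<le> i - leaves t" "i - leaves t < k - leaves t" "k - leaves t \<le> sum_list (map leaves ts)"
      using 4(3-) 3 by auto
    from 4(2)[OF _ this, unfolded eq] out show ?thesis using 4(3-) 3 by simp
  qed
qed auto

lemma deg_after_par1:
  "1 \<le> i \<Longrightarrow> i < k \<Longrightarrow> k \<le> leaves t \<Longrightarrow>
    deg_after dg (k + leaves s - 1) (graft i t s) = deg_after dg k t"
  "1 \<le> i \<Longrightarrow> i < k \<Longrightarrow> k \<le> sum_list (map leaves ts) \<Longrightarrow>
    deg_after_list dg (k + leaves s - 1) (graft_list i ts s) = deg_after_list dg k ts"
proof (induction i t s and i ts s arbitrary: k and k rule: graft_graft_list.induct)
  case (4 i t ts s)
  consider "k \<le> leaves t" | "i \<le> leaves t" "leaves t < k" | "leaves t < i" by linarith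
  then show ?case
  proof cases
    case 1
    then have "k + leaves s - 1 \<le> leaves (graft i t s)"
      using leaves_graft(1)[of i t s] 4(3-) by simp_all
    then show ?thesis using 4 1 by simp
  next
    case 2
    then have "leaves (graft i t s) + 1 = leaves t + leaves s" using 4(3-) leaves_graft(1) by blast
    then have "\<not> k + leaves s - 1 \<le> leaves (graft i t s)"
      "k + leaves s - 1 - leaves (graft i t s) = k - leaves t"
      using 2 by simp_all
    then show ?thesis using 4(3-) 2 by simp
  next
    case 3
    then have out: "\<not> k + leaves s - 1 \<le> leaves t"
      and eq: "k - leaves t + leaves s - 1 = k + leaves s - 1 - leaves t"
      using 4(3-) by auto
    have "1 \<le> i - leaves t" "i - leaves t < k - leaves t" "k - leaves t \<le> sum_list (map leaves ts)"
      using 4(3-) 3 by auto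
    from 4(2)[OF _ this, unfolded eq] out show ?thesis using 4(3-) 3 by simp
  qed
qed auto

text \<open>The grafted tree lies behind leaf \<open>i\<close> in preorder, so its degree is added.
  This is the source of the Koszul sign in the parallel axiom \<open>comp_par\<close>; by
  \<open>deg_after_par1\<close> the other order of insertion adds nothing.\<close>

lemma deg_after_par2:
  "1 \<le> i \<Longrightarrow> i < k \<Longrightarrow> k \<le> leaves t \<Longrightarrow>
    deg_after dg i (graft k t u) = deg_after dg i t + tdeg dg u"
  "1 \<le> i \<Longrightarrow> i < k \<Longrightarrow> k \<le> sum_list (map leaves ts) \<Longrightarrow>
    deg_after_list dg i (graft_list k ts u) = deg_after_list dg i ts + tdeg dg u"
proof (induction k t u and k ts u arbitrary: i and i rule: graft_graft_list.induct)
  case (4 k t ts u)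
  consider "k \<le> leaves t" | "i \<le> leaves t" "leaves t < k" | "leaves t < i" by linarith
  then show ?case
  proof cases
    case 1
    then have "i \<le> leaves (graft k t u)" using leaves_graft(1)[of k t u] 4(3-) by simp_all
    then show ?thesis using 4 1 by simp
  next
    case 2
    then show ?thesis using 4(3-) 2 tdeg_graft(2)[of "k - leaves t" ts dg u] by simp
  next
    case 3
    then show ?thesis using 4 3 by simp
  qed
qed auto

lemma graft_list_append:
  "graft_list i (as @ bs) s =
    (if i \<le> sum_list (map leaves as) then graft_list i as s @ bs
     else as @ graft_list (i - sum_list (map leaves as)) bs s)"
  if "1 \<le> i"
  using that
proof (induction as arbitrary: i)
  case (Cons t ts)
  then show ?case by (cases "i \<le> leaves t") auto
qed auto

lemma deg_after_list_append:
  "deg_after_list dg i (as @ bs) =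
    (if i \<le> sum_list (map leaves as) then deg_after_list dg i as + sum_list (map (tdeg dg) bs)
     else deg_after_list dg (i - sum_list (map leaves as)) bs)"
  if "1 \<le> i"
  using that
proof (induction as arbitrary: i)
  case (Cons t ts)
  then show ?case by (cases "i \<le> leaves t") auto
qed auto

section \<open>Composition of linear combinations of trees: the axioms of the free operad\<close>

definition tset :: "'g set \<Rightarrow> ('g \<Rightarrow> nat) \<Rightarrow> ('g \<Rightarrow> int) \<Rightarrow> nat \<Rightarrow> int \<Rightarrow> 'g tree set" where
  "tset G ar dg N p = {t. wf_tree G ar t \<and> leaves t = N \<and> tdeg dg t = p}"

lemma linmap_comp_left [simp]: "linmap (\<lambda>f. free_comp dg i f g)"
  unfolding free_comp_def lin_ext_eq_lin by simp

lemma linmap_comp_right [simp]: "linmap (\<lambda>g. free_comp dg i f g)"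
  unfolding free_comp_def lin_ext_eq_lin by (rule linmap_lin_left) simp

lemmas comp_add_left = linmap_add[OF linmap_comp_left]
  and comp_add_right = linmap_add[OF linmap_comp_right]
  and comp_sc_left = linmap_sc[OF linmap_comp_left]
  and comp_sc_right = linmap_sc[OF linmap_comp_right]
  and comp_zero_left [simp] = linmap_zero[OF linmap_comp_left]
  and comp_zero_right [simp] = linmap_zero[OF linmap_comp_right]

lemma comp_mono_mono:
  "1 \<le> i \<Longrightarrow> i \<le> leaves t \<Longrightarrow>
    free_comp dg i (mono t) (mono s) = sc (pm (tdeg dg s * deg_after dg i t)) (mono (graft i t s))"
  by (simp add: free_comp_def lin_ext_eq_lin tree_comp_def free_scl_eq_sc powi_eq_pm)

lemma comp_mono_out:
  "\<not> (1 \<le> i \<and> i \<le> leaves t) \<Longrightarrow> free_comp dg i (mono t) (mono s) = 0"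
  by (auto simp: free_comp_def lin_ext_eq_lin tree_comp_def)

lemma comp_supp:
  assumes "f \<in> supp (tset G ar dg M p)" "g \<in> supp (tset G ar dg N q)" "1 \<le> i" "i \<le> M"
  shows "free_comp dg i f g \<in> supp (tset G ar dg (M + N - 1) (p + q))"
proof (rule supp_linmap[OF linmap_comp_left assms(1)])
  fix t assume t: "t \<in> tset G ar dg M p"
  show "free_comp dg i (mono t) g \<in> supp (tset G ar dg (M + N - 1) (p + q))"
  proof (rule supp_linmap[OF linmap_comp_right assms(2)])
    fix s assume s: "s \<in> tset G ar dg N q"
    show "free_comp dg i (mono t) (mono s) \<in> supp (tset G ar dg (M + N - 1) (p + q))"
      using t s assms(3,4) leaves_graft(1)[of i t s]
      by (auto simp: comp_mono_mono tset_def tdeg_graft wf_graft intro!: supp_single)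
  qed
qed

lemma comp_seq:
  assumes "f \<in> supp (tset G ar dg L p)" "g \<in> supp (tset G ar dg M q)" "h \<in> supp (tset G ar dg N r)"
    "1 \<le> i" "i \<le> L" "1 \<le> j" "j \<le> M"
  shows "free_comp dg (i - 1 + j) (free_comp dg i f g) h = free_comp dg i f (free_comp dg j g h)"
proof (rule linmap_eq_supp[OF assms(1)])
  fix t assume t: "t \<in> tset G ar dg L p"
  show "free_comp dg (i - 1 + j) (free_comp dg i (mono t) g) h =
      free_comp dg i (mono t) (free_comp dg j g h)"
  proof (rule linmap_eq_supp[OF assms(2)])
    fix s assume s: "s \<in> tset G ar dg M q"
    show "free_comp dg (i - 1 + j) (free_comp dg i (mono t) (mono s)) h =
        free_comp dg i (mono t) (free_comp dg j (mono s) h)"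
    proof (rule linmap_eq_supp[OF assms(3)])
      fix u assume u: "u \<in> tset G ar dg N r"
      have ij: "i \<le> leaves t" "j \<le> leaves s" using t s assms(5,7) by (auto simp: tset_def)
      have "i - 1 + j \<le> leaves (graft i t s)"
        using leaves_graft(1)[of i t s] assms(4,6) ij by simp
      then show "free_comp dg (i - 1 + j) (free_comp dg i (mono t) (mono s)) (mono u) =
          free_comp dg i (mono t) (free_comp dg j (mono s) (mono u))"
        using assms(4,6) ij graft_seq(1)[of i t j s u] deg_after_seq(1)[of i t j s dg]
          tdeg_graft(1)[of j s dg u]
        by (simp add: comp_mono_mono comp_sc_left comp_sc_right del: sc_single
            flip: pm_add) (simp add: algebra_simps)
    qed (intro linmap_comp[OF linmap_comp_right] linmap_comp_right)+
  qed (intro linmap_comp[OF linmap_comp_left] linmap_comp[OF linmap_comp_right] linmap_comp_left linmap_comp_right)+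
qed (intro linmap_comp[OF linmap_comp_left] linmap_comp_left)+

lemma comp_par:
  assumes "f \<in> supp (tset G ar dg L p)" "g \<in> supp (tset G ar dg M q)" "h \<in> supp (tset G ar dg N r)"
    "1 \<le> i" "i < k" "k \<le> L"
  shows "free_comp dg (k + M - 1) (free_comp dg i f g) h
    = sc (pm (q * r)) (free_comp dg i (free_comp dg k f h) g)"
proof (rule linmap_eq_supp[OF assms(1)])
  fix t assume t: "t \<in> tset G ar dg L p"
  show "free_comp dg (k + M - 1) (free_comp dg i (mono t) g) h
      = sc (pm (q * r)) (free_comp dg i (free_comp dg k (mono t) h) g)"
  proof (rule linmap_eq_supp[OF assms(2)])
    fix s assume s: "s \<in> tset G ar dg M q"
    show "free_comp dg (k + M - 1) (free_comp dg i (mono t) (mono s)) h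
        = sc (pm (q * r)) (free_comp dg i (free_comp dg k (mono t) h) (mono s))"
    proof (rule linmap_eq_supp[OF assms(3)])
      fix u assume u: "u \<in> tset G ar dg N r"
      have ij: "k \<le> leaves t" "M = leaves s" "q = tdeg dg s" "r = tdeg dg u"
        using t s u assms(6) by (auto simp: tset_def)
      have "k + leaves s - 1 \<le> leaves (graft i t s)" "i \<le> leaves (graft k t u)"
        using leaves_graft(1)[of i t s] leaves_graft(1)[of k t u] assms(4,5) ij by simp_all
      then show "free_comp dg (k + M - 1) (free_comp dg i (mono t) (mono s)) (mono u)
        = sc (pm (q * r)) (free_comp dg i (free_comp dg k (mono t) (mono u)) (mono s))"
        using assms(4,5) ij graft_par(1)[of i k t s u] deg_after_par1(1)[of i k t dg s]
          deg_after_par2(1)[of i k t dg u]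
        by (simp add: comp_mono_mono comp_sc_left comp_sc_right del: sc_single flip: pm_add)
          (simp add: pm_def algebra_simps)
    qed (intro linmap_comp[OF linmap_comp_left] linmap_comp_right linmap_sc_left linmap_comp_left)+
  qed (intro linmap_comp[OF linmap_comp_left] linmap_sc_left linmap_comp_right)+
qed (intro linmap_comp[OF linmap_comp_left] linmap_comp_left linmap_sc_left)+

lemma comp_opid_left: "f \<in> supp (tset G ar dg N p) \<Longrightarrow> free_comp dg 1 (mono Leaf) f = f"
  by (rule linmap_eq_supp[where A = "free_comp dg 1 (mono Leaf)"]) (auto simp: comp_mono_mono)

lemma graft_Leaf:
  fixes t :: "'a tree" and ts :: "'a tree list"
  shows "1 \<le> i \<Longrightarrow> i \<le> leaves t \<Longrightarrow> graft i t Leaf = t"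
  "1 \<le> i \<Longrightarrow> i \<le> sum_list (map leaves ts) \<Longrightarrow> graft_list i ts Leaf = ts"
  by (induction i t "Leaf :: 'a tree" and i ts "Leaf :: 'a tree" rule: graft_graft_list.induct) auto

lemma comp_opid_right:
  "f \<in> supp (tset G ar dg N p) \<Longrightarrow> 1 \<le> i \<Longrightarrow> i \<le> N \<Longrightarrow> free_comp dg i f (mono Leaf) = f"
  by (rule linmap_eq_supp[where A = "\<lambda>f. free_comp dg i f (mono Leaf)"])
    (auto simp: comp_mono_mono graft_Leaf tset_def)

text \<open>Insertion into one input of \<open>g\<close> without a Koszul sign, as in the second
  summand of \<open>tree_dif\<close>. The lemmas below compare it with \<open>free_comp\<close>,
  where signs appear.\<close>

definition node :: "'g \<Rightarrow> 'g tree list \<Rightarrow> 'g tree list \<Rightarrow> ('g, 'k::field) free \<Rightarrow> ('g, 'k) free" where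
  "node g as bs = lin (\<lambda>s. mono (Node g (as @ s # bs)))"

lemma linmap_node [simp]: "linmap (node g as bs)"
  by (simp add: node_def)

lemma node_mono [simp]: "node g as bs (mono t) = mono (Node g (as @ t # bs))"
  by (simp add: node_def)

abbreviation "lvs \<equiv> \<lambda>ts. sum_list (map leaves ts)"
abbreviation "tdegs dg \<equiv> \<lambda>ts. sum_list (map (tdeg dg) ts)"

lemma comp_node_mid:
  assumes "x \<in> supp (tset G ar dg N p)" "1 \<le> i" "i \<le> N"
  shows "free_comp dg (lvs as + i) (node g as bs x) (mono s)
    = sc (pm (tdeg dg s * tdegs dg bs)) (node g as bs (free_comp dg i x (mono s)))"
proof (rule linmap_eq_supp[OF assms(1)])
  fix t assume "t \<in> tset G ar dg N p"
  then show "free_comp dg (lvs as + i) (node g as bs (mono t)) (mono s)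
    = sc (pm (tdeg dg s * tdegs dg bs)) (node g as bs (free_comp dg i (mono t) (mono s)))"
    using assms(2,3)
    by (simp add: comp_mono_mono tset_def graft_list_append deg_after_list_append
        linmap_sc[OF linmap_node] del: sc_single) (simp add: ring_distribs pm_add mult.commute)
qed (intro linmap_comp[OF linmap_comp_left] linmap_sc_left linmap_comp[OF linmap_node] linmap_comp_left linmap_node)+

lemma comp_node_mid_right:
  assumes "1 \<le> i" "i \<le> leaves t"  "x \<in> supp (tset G ar dg N p)"
  shows "free_comp dg (lvs as + i) (mono (Node g (as @ t # bs))) x
    = sc (pm (p * tdegs dg bs)) (node g as bs (free_comp dg i (mono t) x))"
proof (rule linmap_eq_supp[OF assms(3)])
  fix s assume "s \<in> tset G ar dg N p"
  then show "free_comp dg (lvs as + i) (mono (Node g (as @ t # bs))) (mono s)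
    = sc (pm (p * tdegs dg bs)) (node g as bs (free_comp dg i (mono t) (mono s)))"
    using assms(1,2)
    by (simp add: comp_mono_mono tset_def graft_list_append deg_after_list_append
        linmap_sc[OF linmap_node] del: sc_single) (auto simp add: ring_distribs pm_add mult.commute)
qed (intro linmap_comp_right linmap_sc_left linmap_comp[OF linmap_node] linmap_node)+

lemma comp_node_before:
  assumes "x \<in> supp (tset G ar dg N p)" "1 \<le> i" "i \<le> leaves t"
  shows "free_comp dg (lvs as + i) (node g (as @ t # bs) cs x) (mono s)
    = sc (pm (tdeg dg s * (deg_after dg i t + tdegs dg bs + p + tdegs dg cs)))
        (node g (as @ graft i t s # bs) cs x)"
proof (rule linmap_eq_supp[OF assms(1)])
  fix u assume "u \<in> tset G ar dg N p"
  then show "free_comp dg (lvs as + i) (node g (as @ t # bs) cs (mono u)) (mono s)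
    = sc (pm (tdeg dg s * (deg_after dg i t + tdegs dg bs + p + tdegs dg cs)))
        (node g (as @ graft i t s # bs) cs (mono u))"
    using assms(2,3)
    by (auto simp: comp_mono_mono tset_def graft_list_append deg_after_list_append add.assoc)
qed (intro linmap_comp[OF linmap_comp_left] linmap_sc_left linmap_node)+

lemma comp_node_after:
  assumes "x \<in> supp (tset G ar dg N p)" "1 \<le> i" "i \<le> leaves t"
  shows "free_comp dg (lvs as + N + lvs bs + i) (node g as (bs @ t # cs) x) (mono s)
    = sc (pm (tdeg dg s * (deg_after dg i t + tdegs dg cs)))
        (node g as (bs @ graft i t s # cs) x)"
proof (rule linmap_eq_supp[OF assms(1)])
  fix u assume "u \<in> tset G ar dg N p"
  then show "free_comp dg (lvs as + N + lvs bs + i) (node g as (bs @ t # cs) (mono u)) (mono s)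
    = sc (pm (tdeg dg s * (deg_after dg i t + tdegs dg cs)))
        (node g as (bs @ graft i t s # cs) (mono u))"
    using assms(2,3)
    by (auto simp: comp_mono_mono tset_def graft_list_append deg_after_list_append)
qed (intro linmap_comp[OF linmap_comp_left] linmap_sc_left linmap_node)+

lemma node_supp:
  assumes "x \<in> supp (tset G ar dg N p)" "g \<in> G" "length as + length bs + 1 = ar g"
    "\<forall>t\<in>set (as @ bs). wf_tree G ar t"
  shows "node g as bs x \<in> supp (tset G ar dg (lvs as + N + lvs bs) (dg g + tdegs dg as + p + tdegs dg bs))"
  by (rule supp_linmap[OF linmap_node assms(1)])
    (use assms(2-) in \<open>auto simp: tset_def intro!: supp_single\<close>)

lemma plug_append: "plug dg k f (as @ bs) = plug dg (k + lvs as) (plug dg k f as) bs"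
  by (induction as arbitrary: k f) (auto simp: add.assoc)

lemma linmap_plug [simp]: "linmap (\<lambda>f. plug dg k f ts)"
proof (induction ts arbitrary: k)
  case (Cons t ts)
  show ?case using linmap_comp[OF Cons[of "k + leaves t"] linmap_comp_left[of dg k "mono t"]] by simp
qed simp

lemma plug_supp:
  assumes "f \<in> supp (tset G ar dg N p)" "1 \<le> k" "k + length ts \<le> N + 1" "\<forall>t\<in>set ts. wf_tree G ar t"
  shows "plug dg k f ts \<in> supp (tset G ar dg (N + lvs ts - length ts) (p + tdegs dg ts))"
  using assms
proof (induction ts arbitrary: k f N p)
  case (Cons t ts)
  have "mono t \<in> supp (tset G ar dg (leaves t) (tdeg dg t))"
    using Cons.prems by (intro supp_single) (simp add: tset_def)
  from comp_supp[OF Cons.prems(1) this, of k]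
  have c: "free_comp dg k f (mono t) \<in> supp (tset G ar dg (N + leaves t - 1) (p + tdeg dg t))"
    using Cons.prems by simp
  have "N \<ge> 1" using Cons.prems by auto
  then have "N + leaves t - 1 + lvs ts - length ts = N + lvs (t # ts) - length (t # ts)"
    using Cons.prems(3) by simp
  with Cons.IH[OF c, of "k + leaves t"] Cons.prems \<open>N \<ge> 1\<close>
  show ?case by (simp add: add.assoc)
qed simp

text \<open>The parallel axiom, once for each tree: leaf \<open>m\<close> lies to the left of all
  insertions, so \<open>s\<close> may be inserted first, at the price of moving it past
  \<open>ts\<close>.\<close>

lemma comp_plug:
  assumes "f \<in> supp (tset G ar dg N p)" "1 \<le> m" "m < k" "k + length ts \<le> N + 1"
    "\<forall>t\<in>set ts. wf_tree G ar t" "s \<in> supp (tset G ar dg L q)"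
  shows "free_comp dg m (plug dg k f ts) s
    = sc (pm (q * tdegs dg ts)) (plug dg (k + L - 1) (free_comp dg m f s) ts)"
  using assms(1-5)
proof (induction ts arbitrary: k f N p)
  case (Cons t ts)
  have t: "mono t \<in> supp (tset G ar dg (leaves t) (tdeg dg t))"
    using Cons.prems by (intro supp_single) (simp add: tset_def)
  have c: "free_comp dg k f (mono t) \<in> supp (tset G ar dg (N + leaves t - 1) (p + tdeg dg t))"
    using comp_supp[OF Cons.prems(1) t, of k] Cons.prems by simp
  have N: "N \<ge> 1" using Cons.prems by auto
  have "free_comp dg m (plug dg k f (t # ts)) s
    = sc (pm (q * tdegs dg ts)) (plug dg (k + leaves t + L - 1) (free_comp dg m (free_comp dg k f (mono t)) s) ts)"
    using Cons.IH[OF c, of "k + leaves t"] Cons.prems N by simp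
  also have "free_comp dg m (free_comp dg k f (mono t)) s
      = sc (pm (q * tdeg dg t)) (free_comp dg (k + L - 1) (free_comp dg m f s) (mono t))"
    using comp_par[OF Cons.prems(1) assms(6) t, of m k] Cons.prems by simp
  finally show ?case
    using Cons.prems(2,3) by (simp add: linmap_sc[OF linmap_plug] ring_distribs pm_add algebra_simps)
qed simp

text \<open>Filling goes from left to right, so a tree already inserted joins the prefix
  \<open>as\<close>. A new tree passes the remaining leaves, of degree 0, and then
  \<open>bs\<close>, whence the sign.\<close>

lemma plug_leaves:
  fixes dg :: "'g \<Rightarrow> int"
  assumes "length ts = n"
  shows "plug dg (Suc (lvs as)) (mono (Node g (as @ replicate n Leaf @ bs))) ts
    = sc (pm (tdegs dg ts * tdegs dg bs)) (mono (Node g (as @ ts @ bs)) :: ('g, 'k::field) free)"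
  using assms
proof (induction ts arbitrary: as n)
  case (Cons t ts)
  obtain m where n: "n = Suc m" "length ts = m" using Cons.prems by auto
  have "sum_list (map (tdeg dg) (replicate m Leaf)) = 0" by (induction m) auto
  then have "free_comp dg (Suc (lvs as)) (mono (Node g (as @ replicate n Leaf @ bs))) (mono t)
    = sc (pm (tdeg dg t * tdegs dg bs)) (mono (Node g ((as @ [t]) @ replicate m Leaf @ bs)) :: ('g, 'k) free)"
    by (subst comp_mono_mono) (simp_all add: n graft_list_append deg_after_list_append)
  then show ?case
    using Cons.IH[OF n(2), of "as @ [t]"]
    by (simp add: linmap_sc[OF linmap_plug] ring_distribs pm_add mult.commute add.commute del: sc_single)
qed simp

lemma plug_corolla:
  "length ts = n \<Longrightarrow> plug dg (Suc 0) (mono (Node g (replicate n Leaf))) ts = mono (Node g ts)"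
  using plug_leaves[of ts n dg "[]" g "[]"] by simp

lemma plug_node_mid:
  assumes "x \<in> supp (tset G ar dg N p)" "1 \<le> k" "k + length ts \<le> N + 1" "\<forall>t\<in>set ts. wf_tree G ar t"
  shows "plug dg (lvs as + k) (node g as bs x) ts
    = sc (pm (tdegs dg ts * tdegs dg bs)) (node g as bs (plug dg k x ts))"
  using assms
proof (induction ts arbitrary: k x N p)
  case (Cons t ts)
  have t: "mono t \<in> supp (tset G ar dg (leaves t) (tdeg dg t))"
    using Cons.prems by (intro supp_single) (simp add: tset_def)
  have c: "free_comp dg k x (mono t) \<in> supp (tset G ar dg (N + leaves t - 1) (p + tdeg dg t))"
    using comp_supp[OF Cons.prems(1) t, of k] Cons.prems by simp
  show ?case
    using comp_node_mid[OF Cons.prems(1), of k as g bs t] Cons.IH[OF c, of "k + leaves t"] Cons.prems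
    by (simp add: linmap_sc[OF linmap_plug] ring_distribs pm_add mult.commute add.assoc)
qed simp

section \<open>Derivations of free operads\<close>

locale free_dg =
  fixes G :: "'g set" and ar :: "'g \<Rightarrow> nat" and dg :: "'g \<Rightarrow> int" and \<delta> :: "'g \<Rightarrow> ('g, 'k::field) free"
  assumes \<delta>_supp: "g \<in> G \<Longrightarrow> \<delta> g \<in> supp (tset G ar dg (ar g) (dg g + 1))"
begin

abbreviation "TS \<equiv> tset G ar dg"
abbreviation "dt \<equiv> tree_dif dg \<delta>"

text \<open>The second summand of \<open>tree_dif\<close>, with the children already passed kept in
  \<open>as\<close>. In this form the sum splits under append (\<open>inner_append\<close>), which
  isolates the child that contains a given leaf.\<close>

fun inner :: "'g \<Rightarrow> 'g tree list \<Rightarrow> 'g tree list \<Rightarrow> 'g tree list \<Rightarrow> ('g, 'k) free" where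
  "inner g as [] cs = 0"
| "inner g as (b # bs) cs =
    sc (pm (dg g + tdegs dg as)) (node g as (bs @ cs) (dt b)) + inner g (as @ [b]) bs cs"

lemma inner_append: "inner g as (bs @ bs') cs = inner g as bs (bs' @ cs) + inner g (as @ bs) bs' cs"
  by (induction bs arbitrary: as) (auto simp: add.assoc)

lemma inner_sum:
  "inner g as ts [] = (\<Sum>i<length ts. sc (pm (dg g + tdegs dg (as @ take i ts)))
     (node g (as @ take i ts) (drop (Suc i) ts) (dt (ts ! i))))"
  by (induction ts arbitrary: as) (auto simp: sum.lessThan_Suc_shift add.assoc simp del: sum.lessThan_Suc)

lemma tree_dif_Node: "dt (Node g ts) = plug dg 1 (\<delta> g) ts + inner g [] ts []"
  unfolding inner_sum
  by (auto simp: node_def free_scl_eq_sc lin_ext_eq_lin powi_eq_pm upd_conv_take_nth_drop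
      intro!: sum.cong)

declare tree_dif.simps(2) [simp del]

lemma mono_supp: "wf_tree G ar t \<Longrightarrow> mono t \<in> supp (TS (leaves t) (tdeg dg t))"
  by (rule supp_single) (simp add: tset_def)

lemma inner_supp:
  assumes "g \<in> G" "length (as @ bs @ cs) = ar g" "\<forall>t\<in>set (as @ bs @ cs). wf_tree G ar t"
    "\<forall>b\<in>set bs. dt b \<in> supp (TS (leaves b) (tdeg dg b + 1))"
  shows "inner g as bs cs \<in> supp (TS (lvs (as @ bs @ cs)) (dg g + tdegs dg (as @ bs @ cs) + 1))"
  using assms
proof (induction bs arbitrary: as)
  case (Cons b bs)
  have "node g as (bs @ cs) (dt b) \<in> supp (TS (lvs as + leaves b + lvs (bs @ cs))
      (dg g + tdegs dg as + (tdeg dg b + 1) + tdegs dg (bs @ cs)))"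
    using Cons.prems by (intro node_supp) auto
  moreover have "inner g (as @ [b]) bs cs \<in>
      supp (TS (lvs ((as @ [b]) @ bs @ cs)) (dg g + tdegs dg ((as @ [b]) @ bs @ cs) + 1))"
    using Cons.prems by (intro Cons.IH) auto
  ultimately show ?case by (auto intro!: supp_add supp_sc simp: algebra_simps)
qed simp

lemma tree_dif_supp: "wf_tree G ar t \<Longrightarrow> dt t \<in> supp (TS (leaves t) (tdeg dg t + 1))"
proof (induction t)
  case (Node g ts)
  have "plug dg 1 (\<delta> g) ts \<in> supp (TS (ar g + lvs ts - length ts) (dg g + 1 + tdegs dg ts))"
    using Node.prems by (intro plug_supp \<delta>_supp) auto
  moreover have "inner g [] ts [] \<in> supp (TS (lvs ([] @ ts @ [])) (dg g + tdegs dg ([] @ ts @ []) + 1))"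
    using Node by (intro inner_supp) auto
  ultimately show ?case
    using Node.prems by (auto simp: tree_dif_Node algebra_simps intro!: supp_add)
qed simp

lemma inner_before:
  assumes "\<forall>a\<in>set as. wf_tree G ar a" "1 \<le> i" "i \<le> leaves t"
  shows "free_comp dg (lvs as0 + lvs as + i) (inner g as0 as (t # bs)) (mono s)
    = sc (pm (tdeg dg s * (deg_after dg i t + tdegs dg bs))) (inner g as0 as (graft i t s # bs))"
  using assms(1)
proof (induction as arbitrary: as0)
  case (Cons a as)
  have "free_comp dg (lvs as0 + leaves a + lvs as + i) (node g as0 (as @ t # bs) (dt a)) (mono s)
    = sc (pm (tdeg dg s * (deg_after dg i t + tdegs dg bs))) (node g as0 (as @ graft i t s # bs) (dt a))"
    using Cons.prems assms(2,3) by (intro comp_node_after[OF tree_dif_supp]) auto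
  then show ?case
    using Cons.IH[of "as0 @ [a]"] Cons.prems
    by (simp add: comp_add_left comp_sc_left sc_add mult.commute add.assoc)
qed simp

text \<open>Two extra signs cancel: \<open>s\<close> moves past \<open>dt b\<close>, whose degree is
  one higher than that of \<open>b\<close>, and the graft adds the degree of \<open>s\<close> to the
  degree in front of \<open>dt b\<close>.\<close>

lemma inner_after:
  assumes "\<forall>b\<in>set bs. wf_tree G ar b" "1 \<le> i" "i \<le> leaves t"
  shows "free_comp dg (lvs as + i) (inner g (as @ t # cs) bs []) (mono s)
    = sc (pm (tdeg dg s * (deg_after dg i t + tdegs dg cs + tdegs dg bs)))
        (inner g (as @ graft i t s # cs) bs [])"
  using assms(1)
proof (induction bs arbitrary: cs)
  case (Cons b bs)
  have "free_comp dg (lvs as + i) (node g (as @ t # cs) bs (dt b)) (mono s)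
    = sc (pm (tdeg dg s * (deg_after dg i t + tdegs dg cs + (tdeg dg b + 1) + tdegs dg bs)))
      (node g (as @ graft i t s # cs) bs (dt b))"
    using Cons.prems assms(2,3) by (intro comp_node_before[OF tree_dif_supp]) auto
  then show ?case
    using Cons.IH[of "cs @ [b]"] Cons.prems tdeg_graft(1)[OF assms(2,3), of dg s]
    by (simp add: comp_add_left comp_sc_left sc_add add.assoc)
      (simp add: pm_add ring_distribs mult_ac)
qed simp

lemma leaf_position:
  "1 \<le> i \<Longrightarrow> i \<le> lvs ts \<Longrightarrow>
    \<exists>as t bs j. ts = as @ t # bs \<and> i = lvs as + j \<and> 1 \<le> j \<and> j \<le> leaves t"
proof (induction ts arbitrary: i)
  case (Cons u ts)
  show ?case
  proof (cases "i \<le> leaves u")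
    case True
    with Cons.prems show ?thesis
      by (intro exI[of _ "[]"] exI[of _ u] exI[of _ ts] exI[of _ i]) simp
  next
    case False
    then have "1 \<le> i - leaves u" "i - leaves u \<le> lvs ts" using Cons.prems by auto
    from Cons.IH[OF this] obtain as t bs j where
      "ts = as @ t # bs" "i - leaves u = lvs as + j" "1 \<le> j" "j \<le> leaves t" by blast
    with False show ?thesis
      by (intro exI[of _ "u # as"] exI[of _ t] exI[of _ bs] exI[of _ j]) simp
  qed
qed simp

lemma plug_graft:
  assumes f: "f \<in> supp (TS N p)" and N: "length as + length bs + 1 \<le> N"
    and wf: "\<forall>t\<in>set (as @ t # bs). wf_tree G ar t" "wf_tree G ar s" and i: "1 \<le> i" "i \<le> leaves t"
  shows "free_comp dg (lvs as + i) (plug dg 1 f (as @ t # bs)) (mono s)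
    = sc (pm (tdeg dg s * (deg_after dg i t + tdegs dg bs))) (plug dg 1 f (as @ graft i t s # bs))"
proof -
  let ?F = "plug dg 1 f as" and ?k = "1 + lvs as"
  have F: "?F \<in> supp (TS (N + lvs as - length as) (p + tdegs dg as))"
    using f N wf by (intro plug_supp) auto
  have len: "length as \<le> lvs as + N" using N by simp
  have Ft: "free_comp dg ?k ?F (mono t)
      \<in> supp (TS (N + lvs as - length as + leaves t - 1) (p + tdegs dg as + tdeg dg t))"
    using comp_supp[OF F mono_supp, of t ?k] wf N by simp
  have "free_comp dg (lvs as + i) (plug dg 1 f (as @ t # bs)) (mono s)
    = free_comp dg (lvs as + i) (plug dg (?k + leaves t) (free_comp dg ?k ?F (mono t)) bs) (mono s)"
    by (simp add: plug_append)
  also have "\<dots> = sc (pm (tdeg dg s * tdegs dg bs))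
      (plug dg (?k + leaves t + leaves s - 1) (free_comp dg (lvs as + i) (free_comp dg ?k ?F (mono t)) (mono s)) bs)"
    using wf N i by (intro comp_plug[OF Ft _ _ _ _ mono_supp]) auto
  finally have 1: "free_comp dg (lvs as + i) (plug dg 1 f (as @ t # bs)) (mono s) = \<dots>" .
  have 2: "free_comp dg (lvs as + i) (free_comp dg ?k ?F (mono t)) (mono s)
      = free_comp dg ?k ?F (free_comp dg i (mono t) (mono s))"
    using comp_seq[OF F mono_supp mono_supp, of t s ?k i] wf N i by simp
  have 3: "?k + leaves t + leaves s - 1 = ?k + leaves (graft i t s)"
    using leaves_graft(1)[OF i, of s] by simp
  show ?thesis unfolding 1 2 3 comp_mono_mono[OF i]
    by (simp add: plug_append comp_sc_right linmap_sc[OF linmap_plug] ring_distribs pm_add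
        mult.commute del: sc_single)
qed

text \<open>The Leibniz rule. The leaf lies in one child, and the differential splits into the part
  of the root (\<open>P\<close>), the earlier children (\<open>A\<close>), this child
  (\<open>B\<close>) and the later children (\<open>C\<close>). Only \<open>B\<close> uses the
  induction hypothesis, and only \<open>B\<close> produces the term with
  \<open>dt s\<close>.\<close>

lemma tree_dif_graft:
  assumes "wf_tree G ar t" "wf_tree G ar s" "1 \<le> i" "i \<le> leaves t"
  shows "sc (pm (tdeg dg s * deg_after dg i t)) (dt (graft i t s))
    = free_comp dg i (dt t) (mono s) + sc (pm (tdeg dg t)) (free_comp dg i (mono t) (dt s))"
  using assms
proof (induction t arbitrary: i)
  case Leaf
  then show ?case
    using comp_opid_left[OF tree_dif_supp[OF Leaf(2)]] by simp
next
  case (Node g ts)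
  from leaf_position[of i ts] Node.prems obtain as t bs j where
    ts: "ts = as @ t # bs" and i: "i = lvs as + j" and j: "1 \<le> j" "j \<le> leaves t" by auto
  have g: "graft i (Node g ts) s = Node g (as @ graft j t s # bs)"
    using j by (simp add: ts i graft_list_append)
  have da: "deg_after dg i (Node g ts) = deg_after dg j t + tdegs dg bs"
    using j by (simp add: ts i deg_after_list_append)
  let ?t = "graft j t s"
  let ?\<kappa> = "pm (tdeg dg s * (deg_after dg j t + tdegs dg bs)) :: 'k"
  have IH: "sc (pm (tdeg dg s * deg_after dg j t)) (dt ?t)
    = free_comp dg j (dt t) (mono s) + sc (pm (tdeg dg t)) (free_comp dg j (mono t) (dt s))"
    using Node.IH[of t j] Node.prems j by (simp add: ts)
  have wf: "\<forall>t\<in>set (as @ t # bs). wf_tree G ar t" "g \<in> G" "length as + length bs + 1 = ar g"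
    using Node.prems by (auto simp: ts)
  let ?S = "sc (pm (dg g + tdegs dg as)) :: ('g, 'k) free \<Rightarrow> _"
  have P: "sc ?\<kappa> (plug dg 1 (\<delta> g) (as @ ?t # bs)) = free_comp dg i (plug dg 1 (\<delta> g) ts) (mono s)"
    unfolding ts i using wf Node.prems(2) j by (subst plug_graft[OF \<delta>_supp]) auto
  have A: "sc ?\<kappa> (inner g [] as (?t # bs)) = free_comp dg i (inner g [] as (t # bs)) (mono s)"
    using inner_before[of as j t "[]" g bs s] wf j by (simp add: i)
  have C: "sc ?\<kappa> (inner g (as @ [?t]) bs []) = free_comp dg i (inner g (as @ [t]) bs []) (mono s)"
    using inner_after[of bs j t as g "[]" s] wf j by (simp add: i)
  have "node g as bs (sc (pm (tdeg dg s * deg_after dg j t)) (dt ?t))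
      = node g as bs (free_comp dg j (dt t) (mono s)) + sc (pm (tdeg dg t)) (node g as bs (free_comp dg j (mono t) (dt s)))"
    unfolding IH by (simp add: linmap_add[OF linmap_node] linmap_sc[OF linmap_node])
  then have "sc (pm (tdeg dg s * tdegs dg bs)) (node g as bs (sc (pm (tdeg dg s * deg_after dg j t)) (dt ?t)))
      = sc (pm (tdeg dg s * tdegs dg bs)) (node g as bs (free_comp dg j (dt t) (mono s)))
        + sc (pm (tdeg dg s * tdegs dg bs)) (sc (pm (tdeg dg t)) (node g as bs (free_comp dg j (mono t) (dt s))))"
    by (simp add: sc_add)
  then have B0: "sc ?\<kappa> (node g as bs (dt ?t))
      = sc (pm (tdeg dg s * tdegs dg bs)) (node g as bs (free_comp dg j (dt t) (mono s)))
        + sc (pm (tdeg dg s * tdegs dg bs) * pm (tdeg dg t)) (node g as bs (free_comp dg j (mono t) (dt s)))"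
    by (simp add: linmap_sc[OF linmap_node] ring_distribs pm_add mult.commute)
  have B1: "free_comp dg i (node g as bs (dt t)) (mono s)
      = sc (pm (tdeg dg s * tdegs dg bs)) (node g as bs (free_comp dg j (dt t) (mono s)))"
    unfolding i using wf j by (intro comp_node_mid[OF tree_dif_supp]) auto
  have B2: "free_comp dg i (mono (Node g ts)) (dt s)
      = sc (pm ((tdeg dg s + 1) * tdegs dg bs)) (node g as bs (free_comp dg j (mono t) (dt s)))"
    unfolding i ts by (rule comp_node_mid_right[OF j tree_dif_supp[OF Node.prems(2)]])
  have B: "sc ?\<kappa> (?S (node g as bs (dt ?t)))
      = free_comp dg i (?S (node g as bs (dt t))) (mono s)
        + sc (pm (tdeg dg (Node g ts))) (free_comp dg i (mono (Node g ts)) (dt s))"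
  proof -
    have "sc ?\<kappa> (?S (node g as bs (dt ?t))) = ?S (sc ?\<kappa> (node g as bs (dt ?t)))"
      by (simp add: mult.commute)
    also have "\<dots> = ?S (free_comp dg i (node g as bs (dt t)) (mono s))
      + ?S (sc (pm (tdeg dg s * tdegs dg bs) * pm (tdeg dg t)) (node g as bs (free_comp dg j (mono t) (dt s))))"
      unfolding B0 B1 by (simp add: sc_add)
    also have "?S (sc (pm (tdeg dg s * tdegs dg bs) * pm (tdeg dg t)) (node g as bs (free_comp dg j (mono t) (dt s))))
      = sc (pm (tdeg dg (Node g ts))) (free_comp dg i (mono (Node g ts)) (dt s))"
      unfolding B2 by (simp add: ts ring_distribs pm_add) (simp add: mult_ac)
    finally show ?thesis by (simp add: comp_sc_left)
  qed
  have E1: "dt (Node g ts) = plug dg 1 (\<delta> g) ts + (inner g [] as (t # bs)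
      + (?S (node g as bs (dt t)) + inner g (as @ [t]) bs []))"
    by (simp add: tree_dif_Node ts inner_append)
  have E2: "dt (Node g (as @ ?t # bs)) = plug dg 1 (\<delta> g) (as @ ?t # bs) + (inner g [] as (?t # bs)
      + (?S (node g as bs (dt ?t)) + inner g (as @ [?t]) bs []))"
    by (simp add: tree_dif_Node inner_append)
  show ?case
    unfolding g da E1 E2 sc_add comp_add_left P A B C by (simp only: add_ac)
qed

abbreviation "D \<equiv> free_dif dg \<delta>"

lemma linmap_dif [simp]: "linmap D"
  by (simp add: free_dif_def lin_ext_eq_lin)

lemma dif_mono [simp]: "D (mono t) = dt t"
  by (simp add: free_dif_def lin_ext_eq_lin)

lemma dif_supp: "f \<in> supp (TS N p) \<Longrightarrow> D f \<in> supp (TS N (p + 1))"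
  by (erule supp_linmap[OF linmap_dif]) (auto simp: tset_def dest: tree_dif_supp)

lemma dif_comp:
  assumes "f \<in> supp (TS M p)" "g \<in> supp (TS N q)" "1 \<le> i" "i \<le> M"
  shows "D (free_comp dg i f g) = free_comp dg i (D f) g + sc (pm p) (free_comp dg i f (D g))"
proof (rule linmap_eq_supp[OF assms(1)])
  fix t assume t: "t \<in> TS M p"
  show "D (free_comp dg i (mono t) g) = free_comp dg i (D (mono t)) g + sc (pm p) (free_comp dg i (mono t) (D g))"
  proof (rule linmap_eq_supp[OF assms(2)])
    fix s assume s: "s \<in> TS N q"
    show "D (free_comp dg i (mono t) (mono s))
        = free_comp dg i (D (mono t)) (mono s) + sc (pm p) (free_comp dg i (mono t) (D (mono s)))"
      using t s assms(3,4) tree_dif_graft[of t s i]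
      by (simp add: tset_def comp_mono_mono linmap_sc[OF linmap_dif] del: sc_single)
  qed (intro linmap_comp[OF linmap_dif] linmap_comp_right linmap_plus linmap_sc_left
      linmap_comp[OF linmap_comp_right] linmap_dif)+
qed (intro linmap_comp[OF linmap_dif] linmap_comp_left linmap_plus linmap_sc_left
      linmap_comp[OF linmap_comp_left] linmap_dif)+

end

section \<open>Words and brackets\<close>

text \<open>
  A word is an alternating product of the idempotent \<open>j\<close> and of letters: \<open>Gap b l w\<close> is
  \<open>j\<^sup>b l w\<close>, and \<open>End b\<close> is \<open>j\<^sup>b\<close>, so that \<open>End False\<close> is a formally adjoined unit.  The letter
  \<open>LX\<close> is an input, and \<open>LP [a\<^sub>1, \<dots>, a\<^sub>n]\<close> is \<open>p\<^sub>n(a\<^sub>1, \<dots>, a\<^sub>n)\<close>, where the empty word in position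
  \<open>i\<close> stands for the symbol \<open>1\<close>.
\<close>

datatype letter = LX | LP "wrd list" and wrd = End bool | Gap bool letter wrd

text \<open>Concatenation with \<open>j j = j\<close>. The class is additive because multiplication
  on \<open>poly_mapping\<close> then is that of the monoid algebra. All inputs are the same letter,
  since in a non-symmetric operad they are numbered by their order of occurrence.\<close>

instantiation wrd :: monoid_add
begin

fun flag :: "bool \<Rightarrow> wrd \<Rightarrow> wrd" where
  "flag a (End b) = End (a \<or> b)"
| "flag a (Gap b l w) = Gap (a \<or> b) l w"

fun plus_wrd :: "wrd \<Rightarrow> wrd \<Rightarrow> wrd" where
  "End a + w = flag a w"
| "Gap a l v + w = Gap a l (v + w)"

definition zero_wrd :: wrd where "0 = End False"

lemma flag_False [simp]: "flag False w = w"
  by (cases w) auto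

lemma flag_flag [simp]: "flag a (flag b w) = flag (a \<or> b) w"
  by (cases w) auto

lemma flag_plus: "flag a v + w = flag a (v + w)"
  by (cases v) auto

instance
proof
  fix u v w :: wrd
  show "u + v + w = u + (v + w)" by (induction u v rule: plus_wrd.induct) (auto simp: flag_plus)
  show "0 + w = w" by (simp add: zero_wrd_def)
  show "w + 0 = w"
    unfolding zero_wrd_def by (induction w "End False" rule: plus_wrd.induct) auto
qed

end

text \<open>With concatenation as addition, \<open>'k lmod\<close> is the tensor algebra over the
  module of words, and multiplication by \<open>Ls [a]\<close> prepends an entry.\<close>

instantiation list :: (type) monoid_add
begin

definition plus_list :: "'a list \<Rightarrow> 'a list \<Rightarrow> 'a list" where "plus_list = (@)"
definition zero_list :: "'a list" where "zero_list = []"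

instance by standard (auto simp: plus_list_def zero_list_def)

end

lemma plus_wrd_eq_0 [simp]: "v + w = 0 \<longleftrightarrow> v = 0 \<and> w = (0 :: wrd)"
proof (cases v)
  case (End a)
  then show ?thesis by (cases w) (auto simp: zero_wrd_def)
qed (auto simp: zero_wrd_def)

lemma Gap_neq_0 [simp]: "Gap b l w \<noteq> 0" "End True \<noteq> 0" "End b = 0 \<longleftrightarrow> \<not> b"
  by (auto simp: zero_wrd_def)

type_synonym 'k wmod = "wrd \<Rightarrow>\<^sub>0 'k"
type_synonym 'k lmod = "wrd list \<Rightarrow>\<^sub>0 'k"

lemma sc_mult_left: "sc c x * y = sc c (x * y :: 'a::monoid_add \<Rightarrow>\<^sub>0 'k::field)"
  by (simp add: sc_def mult_map_scale_conv_mult mult.assoc)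

lemma single_zero_commute: "x * single 0 c = single 0 c * (x :: 'a::monoid_add \<Rightarrow>\<^sub>0 'k::field)"
proof -
  have "(\<Sum>t\<in>keys x. single t (lookup x t)) * single 0 c = single 0 c * (\<Sum>t\<in>keys x. single t (lookup x t))"
    by (simp add: sum_distrib_left sum_distrib_right mult_single mult.commute)
  then show ?thesis using poly_mapping_expand[of x] by simp
qed

lemma sc_mult_right: "x * sc c y = sc c (x * y :: 'a::monoid_add \<Rightarrow>\<^sub>0 'k::field)"
  by (simp add: sc_def mult_map_scale_conv_mult mult.assoc[symmetric] single_zero_commute)

lemma linmap_mult_left: "linmap (\<lambda>x. x * (y :: 'a::monoid_add \<Rightarrow>\<^sub>0 'k::field))"
  by (rule linmapI) (simp_all add: sc_mult_left distrib_right)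

lemma linmap_mult_right: "linmap (\<lambda>y. (x :: 'a::monoid_add \<Rightarrow>\<^sub>0 'k::field) * y)"
  by (rule linmapI) (simp_all add: sc_mult_right distrib_left)

lemma linmap_mult_left': "linmap A \<Longrightarrow> linmap (\<lambda>x. A x * (y :: 'a::monoid_add \<Rightarrow>\<^sub>0 'k::field))"
  by (rule linmap_comp[OF linmap_mult_left])

lemma linmap_mult_right': "linmap A \<Longrightarrow> linmap (\<lambda>x. (y :: 'a::monoid_add \<Rightarrow>\<^sub>0 'k::field) * A x)"
  by (rule linmap_comp[OF linmap_mult_right])

lemma supp_mult:
  "x \<in> supp S \<Longrightarrow> y \<in> supp S' \<Longrightarrow> (\<And>s s'. s \<in> S \<Longrightarrow> s' \<in> S' \<Longrightarrow> s + s' \<in> S'') \<Longrightarrow>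
    x * y \<in> supp S''"
  using keys_mult[of x y] unfolding supp_def by blast

abbreviation W :: "wrd \<Rightarrow> 'k::field wmod" where "W w \<equiv> single w 1"
abbreviation Ls :: "wrd list \<Rightarrow> 'k::field lmod" where "Ls as \<equiv> single as 1"

lemma W_mult: "W v * W w = W (v + w)"
  and Ls_mult: "Ls as * Ls bs = Ls (as @ bs)"
  by (simp_all add: mult_single plus_list_def)

lemma W_zero: "W 0 = 1" and Ls_Nil: "Ls [] = 1"
  using single_one[where 'a = wrd] single_one[where 'a = "wrd list"] by (simp_all add: zero_list_def)

definition io :: "'k::field wmod \<Rightarrow> 'k lmod" where "io = lin (\<lambda>w. Ls [w])"

lemma linmap_io [simp]: "linmap io" by (simp add: io_def)
lemma io_single [simp]: "io (single w c) = single [w] c" by (simp add: io_def)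

fun ldeg :: "letter \<Rightarrow> int" and wdeg :: "wrd \<Rightarrow> int" where
  "ldeg LX = 0"
| "ldeg (LP as) = 1 - int (length as) + sum_list (map wdeg as)"
| "wdeg (End b) = 0"
| "wdeg (Gap b l w) = ldeg l + wdeg w"

fun lxc :: "letter \<Rightarrow> nat" and wxc :: "wrd \<Rightarrow> nat" where
  "lxc LX = 1"
| "lxc (LP as) = sum_list (map wxc as)"
| "wxc (End b) = 0"
| "wxc (Gap b l w) = lxc l + wxc w"

text \<open>By relation (iii), a bracket with at least two entries survives only if it contains both
  a symbol \<open>1\<close> and a proper word. Unmixed brackets must not count as letters if the
  valid words are to be a basis.\<close>

definition mixed :: "wrd list \<Rightarrow> bool" where
  "mixed as \<longleftrightarrow> 0 \<in> set as \<and> (\<exists>a\<in>set as. a \<noteq> 0)"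

fun lval :: "letter \<Rightarrow> bool" and wval :: "wrd \<Rightarrow> bool" where
  "lval LX = True"
| "lval (LP as) = (mixed as \<and> (\<forall>a\<in>set as. wval a))"
| "wval (End b) = True"
| "wval (Gap b l w) = (lval l \<and> wval w)"

abbreviation "wdegs as \<equiv> sum_list (map wdeg as)"
abbreviation "wxcs as \<equiv> sum_list (map wxc as)"

lemma flag_inv [simp]: "wdeg (flag a w) = wdeg w" "wxc (flag a w) = wxc w" "wval (flag a w) = wval w"
  by (cases w; simp)+

lemma wdeg_plus [simp]: "wdeg (v + w) = wdeg v + wdeg w"
  and wxc_plus [simp]: "wxc (v + w) = wxc v + wxc w"
  and wval_plus [simp]: "wval (v + w) \<longleftrightarrow> wval v \<and> wval w"
  by (induction v w rule: plus_wrd.induct) auto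

lemma word_zero [simp]: "wdeg 0 = 0" "wxc 0 = 0" "wval 0"
  by (simp_all add: zero_wrd_def)

lemma mixed_length: "mixed as \<Longrightarrow> length as \<ge> 2"
  unfolding mixed_def by (cases as; cases "tl as") auto

abbreviation J :: wrd where "J \<equiv> End True"
abbreviation lw :: "letter \<Rightarrow> wrd" where "lw l \<equiv> Gap False l 0"

text \<open>Relations (iii) and (iv) as evaluation rules. Defining the bracket on unmixed lists and
  on lists of length 1 lets the formula for its differential be stated without case distinctions,
  see \<open>DW_br\<close>.\<close>

definition br :: "wrd list \<Rightarrow> 'k::field wmod" where
  "br as = (if length as = 1 then (if hd as = 0 then W J else W (hd as))
            else if mixed as then W (lw (LP as)) else 0)"

definition Br :: "'k::field lmod \<Rightarrow> 'k wmod" where "Br = lin br"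

lemma linmap_Br [simp]: "linmap Br" by (simp add: Br_def)
lemma Br_single [simp]: "Br (single as c) = sc c (br as)" by (simp add: Br_def)
lemma br_one [simp]: "br [a] = W (if a = 0 then J else a)" by (simp add: br_def)
lemma br_mixed: "mixed as \<Longrightarrow> br as = W (lw (LP as))"
  using mixed_length[of as] by (auto simp: br_def)
lemma br_pure: "\<not> mixed as \<Longrightarrow> length as \<noteq> 1 \<Longrightarrow> br as = 0"
  by (simp add: br_def)

text \<open>The terms with \<open>m\<close> in the differential, for arbitrary entries: the second
  sign moves the first \<open>l\<close> entries past the second bracket, whose own degree is
  \<open>1 - (n - l)\<close> for a list of length \<open>n\<close>.\<close>

definition sp :: "wrd list \<Rightarrow> 'k::field wmod" where
  "sp as = (\<Sum>l\<in>{1..<length as}.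
     sc (pm (int l) * pm ((int (length as) - int l - 1) * wdegs (take l as)))
       (br (take l as) * br (drop l as)))"

text \<open>The symbol \<open>1\<close> is the unit of the monoid of words, so the rules for
  products with \<open>1\<close> need no cases. As \<open>m\<close> has degree 0, no Koszul sign
  joins the alternating sign of the position.\<close>

fun mg :: "wrd list \<Rightarrow> 'k::field lmod" where
  "mg (a # b # as) = Ls ((a + b) # as) - Ls [a] * mg (b # as)"
| "mg [a] = 0"
| "mg [] = 0"

text \<open>The sign before \<open>Br (da as)\<close> comes from moving the differential past a
  bracket of degree \<open>1 - n\<close>. That this is the differential of the operad is
  \<open>NF_tree_dif\<close>.\<close>

fun dl :: "letter \<Rightarrow> 'k::field wmod" and dw :: "wrd \<Rightarrow> 'k wmod" and da :: "wrd list \<Rightarrow> 'k lmod" where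
  "dl LX = 0"
| "dl (LP as) = sc (pm (int (length as) - 1)) (Br (da as)) + Br (mg as) + sp as"
| "dw (End b) = 0"
| "dw (Gap b l w) = W (End b) * (dl l * W w + sc (pm (ldeg l)) (W (lw l) * dw w))"
| "da [] = 0"
| "da (a # as) = io (dw a) * Ls as + sc (pm (wdeg a)) (Ls [a] * da as)"

definition DW :: "'k::field wmod \<Rightarrow> 'k wmod" where "DW = lin dw"
definition DA :: "'k::field lmod \<Rightarrow> 'k lmod" where "DA = lin da"
definition MG :: "'k::field lmod \<Rightarrow> 'k lmod" where "MG = lin mg"
definition SP :: "'k::field lmod \<Rightarrow> 'k wmod" where "SP = lin sp"

lemma linmap_ops [simp]: "linmap DW" "linmap DA" "linmap MG" "linmap SP"
  by (simp_all add: DW_def DA_def MG_def SP_def)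

lemma ops_single [simp]: "DW (single w c) = sc c (dw w)" "DA (single as c) = sc c (da as)"
  "MG (single as c) = sc c (mg as)" "SP (single as c) = sc c (sp as)"
  by (simp_all add: DW_def DA_def MG_def SP_def)

lemma dw_zero [simp]: "dw 0 = 0" by (simp add: zero_wrd_def)

lemma dw_plus: "dw (v + w) = dw v * W w + sc (pm (wdeg v)) (W v * dw w)"
proof (induction v w rule: plus_wrd.induct)
  case (1 a w)
  have "W (End (a \<or> b)) = (W (End a) * W (End b) :: 'a wmod)" for b
    by (simp add: W_mult)
  then show ?case by (cases w) (auto simp: mult.assoc)
next
  case (2 a l v w)
  have "W (Gap a l v) = (W (End a) * (W (lw l) * W v) :: 'a wmod)"
    by (simp add: W_mult)
  then show ?case
    by (simp add: 2 W_mult[symmetric] distrib_left distrib_right mult.assoc sc_add sc_mult_left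
        sc_mult_right pm_add)
qed

section \<open>Arity and degree on words\<close>

definition HW :: "nat \<Rightarrow> int \<Rightarrow> wrd set" where
  "HW N p = {w. wval w \<and> wxc w = N \<and> wdeg w = p}"

text \<open>The empty word is only a formal unit, needed to write \<open>1 - j\<close>. It
  represents no element of the operad, so normal forms live in \<open>HW'\<close>.\<close>

definition HW' :: "nat \<Rightarrow> int \<Rightarrow> wrd set" where
  "HW' N p = HW N p - {0}"

definition HL :: "nat \<Rightarrow> nat \<Rightarrow> int \<Rightarrow> wrd list set" where
  "HL n N p = {as. length as = n \<and> (\<forall>a\<in>set as. wval a) \<and> wxcs as = N \<and> wdegs as = p}"

lemma HW_mult: "x \<in> supp (HW N p) \<Longrightarrow> y \<in> supp (HW M q) \<Longrightarrow> x * y \<in> supp (HW (N + M) (p + q))"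
  by (erule (1) supp_mult) (simp add: HW_def)

lemma HW'_mult_left: "x \<in> supp (HW' N p) \<Longrightarrow> y \<in> supp (HW M q) \<Longrightarrow> x * y \<in> supp (HW' (N + M) (p + q))"
  by (erule (1) supp_mult) (simp add: HW_def HW'_def)

lemma HW'_mult_right: "x \<in> supp (HW N p) \<Longrightarrow> y \<in> supp (HW' M q) \<Longrightarrow> x * y \<in> supp (HW' (N + M) (p + q))"
  by (erule (1) supp_mult) (simp add: HW_def HW'_def)

lemma HW'_HW: "x \<in> supp (HW' N p) \<Longrightarrow> x \<in> supp (HW N p)"
  by (erule supp_mono) (auto simp: HW'_def)

lemma HL_mult: "x \<in> supp (HL n N p) \<Longrightarrow> y \<in> supp (HL m M q) \<Longrightarrow> x * y \<in> supp (HL (n + m) (N + M) (p + q))"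
  by (erule (1) supp_mult) (auto simp: HL_def plus_list_def)

lemma W_HW: "wval w \<Longrightarrow> W w \<in> supp (HW (wxc w) (wdeg w))"
  by (rule supp_single) (simp add: HW_def)

lemma Ls_HL: "\<forall>a\<in>set as. wval a \<Longrightarrow> Ls as \<in> supp (HL (length as) (wxcs as) (wdegs as))"
  by (rule supp_single) (simp add: HL_def)

lemma io_HL: "x \<in> supp (HW N p) \<Longrightarrow> io x \<in> supp (HL 1 N p)"
  by (rule supp_linmap[OF linmap_io]) (auto simp: HW_def HL_def intro: supp_single)

lemma br_HW':
  assumes "as \<in> HL n N p"
  shows "br as \<in> supp (HW' N (p + 1 - int n))"
proof (cases "length as = 1")
  case True
  then obtain a where "as = [a]" by (auto simp: length_Suc_conv)
  with assms show ?thesis by (auto simp: HL_def HW_def HW'_def intro!: supp_single)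
next
  case False
  with assms show ?thesis by (auto simp: br_def HL_def HW_def HW'_def intro!: supp_single)
qed

lemma Br_HW': "x \<in> supp (HL n N p) \<Longrightarrow> Br x \<in> supp (HW' N (p + 1 - int n))"
  by (rule supp_linmap[OF linmap_Br]) (auto intro: br_HW')

lemma mg_HL:
  "\<forall>a\<in>set as. wval a \<Longrightarrow> (mg as :: 'k::field lmod) \<in> supp (HL (length as - 1) (wxcs as) (wdegs as))"
proof (induction as rule: mg.induct)
  case (1 a b as)
  have "(Ls [a] * mg (b # as) :: 'k lmod) \<in> supp (HL (1 + length as) (wxc a + wxcs (b # as)) (wdeg a + wdegs (b # as)))"
    using 1 by (intro HL_mult) (auto intro!: supp_single simp: HL_def)
  moreover have "(Ls ((a + b) # as) :: 'k lmod) \<in> supp (HL (1 + length as) (wxc a + wxcs (b # as)) (wdeg a + wdegs (b # as)))"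
    using 1 by (intro supp_single) (auto simp: HL_def)
  ultimately show ?case by (auto intro: supp_diff)
qed auto

lemma sp_HW':
  assumes "\<forall>a\<in>set as. wval a"
  shows "sp as \<in> supp (HW' (wxcs as) (wdegs as + 2 - int (length as)))"
  unfolding sp_def
proof (intro supp_sum supp_sc)
  fix l assume l: "l \<in> {1..<length as}"
  have a: "as = take l as @ drop l as" by simp
  have v: "\<forall>a\<in>set (take l as). wval a" "\<forall>a\<in>set (drop l as). wval a"
    using assms by (auto dest: in_set_takeD in_set_dropD)
  have "br (take l as) * br (drop l as) \<in> supp (HW' (wxcs (take l as) + wxcs (drop l as))
      ((wdegs (take l as) + 1 - int l) + (wdegs (drop l as) + 1 - int (length as - l))))"
    using v l by (intro HW'_mult_left HW'_HW br_HW') (auto simp: HL_def)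
  moreover have "wxcs (take l as) + wxcs (drop l as) = wxcs as" "wdegs (take l as) + wdegs (drop l as) = wdegs as"
    by (subst (3) a, simp only: map_append sum_list_append)+
  ultimately show "br (take l as) * br (drop l as) \<in> supp (HW' (wxcs as) (wdegs as + 2 - int (length as)))"
    using l by (simp add: algebra_simps of_nat_diff)
qed

lemma d_supp:
  "lval l \<Longrightarrow> (dl l :: 'k::field wmod) \<in> supp (HW' (lxc l) (ldeg l + 1))"
  "wval w \<Longrightarrow> (dw w :: 'k wmod) \<in> supp (HW' (wxc w) (wdeg w + 1))"
  "\<forall>a\<in>set as. wval a \<Longrightarrow> (da as :: 'k lmod) \<in> supp (HL (length as) (wxcs as) (wdegs as + 1))"
proof (induction l and w and as rule: dl_dw_da.induct)
  case (2 as)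
  then have v: "\<forall>a\<in>set as. wval a" and n: "length as \<ge> 2" using mixed_length by auto
  have "(Br (da as) :: 'k wmod) \<in> supp (HW' (wxcs as) (wdegs as + 1 + 1 - int (length as)))"
    using 2 v by (intro Br_HW') auto
  moreover have "(Br (mg as) :: 'k wmod) \<in> supp (HW' (wxcs as) (wdegs as + 1 - int (length as - 1)))"
    using v by (intro Br_HW' mg_HL)
  ultimately show ?case
    using sp_HW'[OF v] n by (auto intro!: supp_add supp_sc simp: of_nat_diff algebra_simps)
next
  case (4 b l w)
  have 1: "(dl l * W w :: 'k wmod) \<in> supp (HW' (lxc l + wxc w) (ldeg l + 1 + wdeg w))"
    using 4 by (intro HW'_mult_left W_HW) auto
  have "(W (lw l) * dw w :: 'k wmod) \<in> supp (HW' (lxc l + wxc w) (ldeg l + (wdeg w + 1)))"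
    using 4 by (intro HW'_mult_right) (auto intro!: supp_single simp: HW_def)
  with 1 have "dl l * W w + sc (pm (ldeg l)) (W (lw l) * dw w :: 'k wmod) \<in> supp (HW' (lxc l + wxc w) (ldeg l + 1 + wdeg w))"
    by (auto intro!: supp_add supp_sc simp: algebra_simps)
  then have "W (End b) * (dl l * W w + sc (pm (ldeg l)) (W (lw l) * dw w :: 'k wmod))
      \<in> supp (HW' (0 + (lxc l + wxc w)) (0 + (ldeg l + 1 + wdeg w)))"
    by (intro HW'_mult_right) (auto intro!: supp_single simp: HW_def)
  then show ?case by (simp add: algebra_simps)
next
  case (6 a as)
  have 1: "(io (dw a) * Ls as :: 'k lmod) \<in> supp (HL (1 + length as) (wxc a + wxcs as) (wdeg a + 1 + wdegs as))"
    using 6 by (intro HL_mult io_HL Ls_HL HW'_HW) auto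
  have "(Ls [a] * da as :: 'k lmod) \<in> supp (HL (1 + length as) (wxc a + wxcs as) (wdeg a + (wdegs as + 1)))"
    using 6 by (intro HL_mult) (auto intro!: supp_single simp: HL_def)
  with 1 show ?case by (auto intro!: supp_add supp_sc simp: algebra_simps)
qed simp_all

lemma DW_supp: "x \<in> supp (HW N p) \<Longrightarrow> DW x \<in> supp (HW' N (p + 1))"
  by (rule supp_linmap[OF linmap_ops(1)]) (use d_supp(2) in \<open>auto simp: HW_def\<close>)

lemma dl_no_unit: "(dl l :: 'k::field wmod) \<in> supp (- {0})"
proof (cases l)
  case (LP as)
  have b: "(br as :: 'k wmod) \<in> supp (- {0})" for as
    by (auto simp: br_def intro!: supp_single)
  have "Br x \<in> supp (- {0})" for x :: "'k lmod"
    by (rule supp_linmap[OF linmap_Br, of _ UNIV]) (use b in \<open>auto simp: supp_def[of UNIV]\<close>)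
  moreover have "(sp as :: 'k wmod) \<in> supp (- {0})"
    unfolding sp_def by (intro supp_sum supp_sc supp_mult[OF b b]) auto
  ultimately show ?thesis by (auto simp: LP intro!: supp_add supp_sc)
qed simp

text \<open>Brackets evaluate to nonempty words, even \<open>p_1(1) = j\<close>. Hence the
  differential of an entry never turns it into the symbol \<open>1\<close>, and the pattern of
  symbols in a bracket is preserved.\<close>

lemma dw_no_unit: "(dw w :: 'k::field wmod) \<in> supp (- {0})"
proof (cases w)
  case (Gap b l w')
  have u: "x \<in> supp UNIV" for x :: "'k wmod" by (simp add: supp_def)
  have l: "x * y \<in> supp (- {0})" if "x \<in> supp (- {0})" for x y :: "'k wmod"
    by (rule supp_mult[OF that u]) auto
  have r: "y * x \<in> supp (- {0})" if "x \<in> supp (- {0})" for x y :: "'k wmod"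
    by (rule supp_mult[OF u that]) auto
  have w: "(W (lw l) :: 'k wmod) \<in> supp (- {0})" by (rule supp_single) simp
  show ?thesis unfolding Gap dw.simps by (rule r[OF supp_add[OF l[OF dl_no_unit] supp_sc[OF l[OF w]]]])
qed simp

lemma Br_io: "x \<in> supp (- {0}) \<Longrightarrow> Br (io x) = x"
  by (rule linmap_eq_supp[where A = "\<lambda>x. Br (io x)"]) (auto intro: linmap_comp)

lemma da_replicate: "da (replicate n 0) = 0"
  by (induction n) (auto simp: linmap_zero)

lemma da_nonzero: "0 \<notin> set as \<Longrightarrow> (da as :: 'k::field lmod) \<in> supp {bs. 0 \<notin> set bs \<and> length bs = length as}"
proof (induction as)
  case (Cons a as)
  have "(io (dw a) :: 'k lmod) \<in> supp {bs. 0 \<notin> set bs \<and> length bs = 1}"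
    by (rule supp_linmap[OF linmap_io dw_no_unit]) (auto intro: supp_single)
  then have "(io (dw a) * Ls as :: 'k lmod) \<in> supp {bs. 0 \<notin> set bs \<and> length bs = length (a # as)}"
    by (rule supp_mult[where S' = "{as}"]) (use Cons.prems in \<open>auto simp: plus_list_def intro: supp_single\<close>)
  moreover have "(Ls [a] * da as :: 'k lmod) \<in> supp {bs. 0 \<notin> set bs \<and> length bs = length (a # as)}"
    using Cons.prems by (intro supp_mult[where S = "{[a]}", OF _ Cons.IH])
      (use Cons.prems in \<open>auto simp: plus_list_def intro: supp_single\<close>)
  ultimately show ?case by (auto intro!: supp_add supp_sc)
qed simp

lemma mg_pure:
  "\<forall>a\<in>set as. (a = 0) = P \<Longrightarrow> (mg as :: 'k::field lmod) \<in> supp {bs. (\<forall>a\<in>set bs. (a = 0) = P) \<and> length bs = length as - 1}"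
proof (induction as rule: mg.induct)
  case (1 a b as)
  have "(Ls [a] * mg (b # as) :: 'k lmod) \<in> supp {bs. (\<forall>a\<in>set bs. (a = 0) = P) \<and> length bs = length (a # b # as) - 1}"
    using 1(2) by (intro supp_mult[where S = "{[a]}", OF _ 1(1)])
      (use 1(2) in \<open>auto simp: plus_list_def intro: supp_single\<close>)
  moreover have "(Ls ((a + b) # as) :: 'k lmod) \<in> supp {bs. (\<forall>a\<in>set bs. (a = 0) = P) \<and> length bs = length (a # b # as) - 1}"
    using 1(2) by (intro supp_single) auto
  ultimately show ?case by (auto intro: supp_diff)
qed auto

lemma Br_pure:
  fixes x :: "'k::field lmod"
  assumes "x \<in> supp {bs. (\<forall>a\<in>set bs. (a = (0 :: wrd)) = P) \<and> length bs = n}" "n \<noteq> 1"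
  shows "Br x = 0"
proof (rule linmap_eq_supp[OF assms(1) linmap_Br linmap_const_zero])
  fix t :: "wrd list" assume "t \<in> {bs. (\<forall>a\<in>set bs. (a = (0 :: wrd)) = P) \<and> length bs = n}"
  then have "\<not> mixed t" "length t \<noteq> 1" using assms(2) by (auto simp: mixed_def)
  then show "Br (Ls t) = 0" by (simp add: br_pure)
qed

text \<open>For mixed lists this is the definition of \<open>dl\<close>; the content is that the
  formula is compatible with relations (iii) and (iv). On unmixed lists, \<open>da\<close> and
  \<open>mg\<close> produce unmixed lists again; in length 2 the merged entry cancels against the
  product, and in greater length every term vanishes.\<close>

lemma DW_br:
  assumes "as \<noteq> []"
  shows "DW (br as) = ( sc (pm (int (length as) - 1)) (Br (da as)) + Br (mg as) + sp as :: 'k::field wmod)"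
proof (cases "mixed as")
  case True
  then show ?thesis by (simp add: br_mixed W_zero zero_wrd_def[symmetric])
next
  case False
  show ?thesis
  proof (cases "length as = 1")
    case True
    then obtain a where a: "as = [a]" by (auto simp: length_Suc_conv)
    show ?thesis
      by (cases "a = 0") (simp_all add: a sp_def Ls_Nil Br_io[OF dw_no_unit] linmap_zero)
  next
    case l: False
    with assms have n: "length as \<ge> 2" by (cases as; cases "tl as") auto
    obtain P where P: "\<forall>a\<in>set as. (a = 0) = P" using False by (auto simp: mixed_def)
    have 1: "Br (da as) = (0 :: 'k wmod)"
    proof (cases P)
      case True
      with P have "as = replicate (length as) 0" by (simp add: replicate_eqI)
      then have "da as = (0 :: 'k lmod)" by (metis da_replicate)
      then show ?thesis by (simp add: linmap_zero)
    next
      case False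
      have "(da as :: 'k lmod) \<in> supp {bs. (\<forall>a\<in>set bs. (a = 0) = False) \<and> length bs = length as}"
        using P False by (intro supp_mono[OF da_nonzero]) auto
      then show ?thesis using l by (rule Br_pure)
    qed
    have 2: "Br (mg as) + sp as = (0 :: 'k wmod)"
    proof (cases "length as = 2")
      case True
      then obtain a b where ab: "as = [a, b]" by (auto simp: length_Suc_conv numeral_2_eq_2)
      have "sp [a, b] = (- (br [a] * br [b]) :: 'k wmod)" by (simp add: sp_def sc_minus_left)
      moreover have "W (if a + b = 0 then J else a + b) = (br [a] * br [b] :: 'k wmod)"
        using P by (auto simp: ab W_mult)
      ultimately show ?thesis by (simp add: ab linmap_diff)
    next
      case False
      then have 3: "Br (mg as) = (0 :: 'k wmod)" using n by (intro Br_pure[OF mg_pure[OF P]]) auto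
      have "sp as = (0 :: 'k wmod)"
        unfolding sp_def
      proof (rule sum.neutral, rule ballI)
        fix l assume l: "l \<in> {1..<length as}"
        have "\<not> mixed (take l as)" "\<not> mixed (drop l as)"
          using P by (auto simp: mixed_def dest!: in_set_takeD in_set_dropD)
        moreover have "length (take l as) \<noteq> 1 \<or> length (drop l as) \<noteq> 1" using l n False by auto
        ultimately have "br (take l as) * br (drop l as) = (0 :: 'k wmod)" by (auto simp: br_pure)
        then show "sc (pm (int l) * pm ((int (length as) - int l - 1) * wdegs (take l as)))
            (br (take l as) * br (drop l as)) = (0 :: 'k wmod)" by simp
      qed
      with 3 show ?thesis by simp
    qed
    have "br as = (0 :: 'k wmod)" using False l by (rule br_pure)
    with 1 2 show ?thesis by (simp add: linmap_zero)
  qed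
qed

section \<open>Normal forms of trees\<close>

text \<open>\<open>mask n T\<close> records the positions of the symbol \<open>1\<close> in \<open>p\<^bsub>n;T\<^esub>\<close>.\<close>

definition mask :: "nat \<Rightarrow> nat set \<Rightarrow> bool list" where
  "mask n T = map (\<lambda>i. Suc i \<in> T) [0..<n]"

abbreviation "slots m \<equiv> length (filter Not m)"

fun fl :: "bool list \<Rightarrow> 'k::field wmod list \<Rightarrow> 'k lmod" where
  "fl [] [] = 1"
| "fl [] (r # rs) = 0"
| "fl (True # m) rs = Ls [0] * fl m rs"
| "fl (False # m) [] = 0"
| "fl (False # m) (r # rs) = io r * fl m rs"

fun fil :: "bool list \<Rightarrow> wrd list \<Rightarrow> wrd list" where
  "fil [] ws = []"
| "fil (True # m) ws = 0 # fil m ws"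
| "fil (False # m) [] = []"
| "fil (False # m) (w # ws) = w # fil m ws"

text \<open>A model in which all relations hold: concatenation is associative, \<open>j\<close> is
  idempotent, and \<open>br\<close> takes care of the relations on the \<open>p\<close>. Argument
  lists of the wrong length give 0, except for \<open>GenJ\<close>, which ignores its
  arguments.\<close>

primrec nfop :: "gen \<Rightarrow> 'k::field wmod list \<Rightarrow> 'k wmod" where
  "nfop GenM rs = (case rs of [a, b] \<Rightarrow> a * b | _ \<Rightarrow> 0)"
| "nfop (GenP n T) rs = Br (fl (mask n T) rs)"
| "nfop GenJ rs = W J"

primrec nf :: "gen tree \<Rightarrow> 'k::field wmod" where
  "nf Leaf = W (lw LX)"
| "nf (Node g ts) = nfop g (map nf ts)"

definition NF :: "(gen, 'k::field) free \<Rightarrow> 'k wmod" where "NF = lin nf"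

lemma linmap_NF [simp]: "linmap NF" by (simp add: NF_def)
lemma NF_single [simp]: "NF (single t c) = sc c (nf t)" by (simp add: NF_def)

lemma fl_append: "slots m = length rs \<Longrightarrow> fl (m @ m') (rs @ rs') = fl m rs * fl m' rs'"
  by (induction m rs rule: fl.induct) (auto simp: mult.assoc)

lemma fil_append: "slots m = length ws \<Longrightarrow> fil (m @ m') (ws @ ws') = fil m ws @ fil m' ws'"
  by (induction m ws rule: fil.induct) auto

lemma fl_W: "slots m = length ws \<Longrightarrow> fl m (map W ws) = Ls (fil m ws)"
  by (induction m ws rule: fil.induct) (auto simp: Ls_Nil Ls_mult)

lemma fl_zero: "0 \<in> set rs \<Longrightarrow> slots m = length rs \<Longrightarrow> fl m rs = 0"
  by (induction m rs rule: fl.induct) (auto simp: linmap_zero)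

lemma length_fil: "slots m = length ws \<Longrightarrow> length (fil m ws) = length m"
  by (induction m ws rule: fil.induct) auto

lemma fil_sums: "slots m = length ws \<Longrightarrow> wdegs (fil m ws) = wdegs ws \<and> wxcs (fil m ws) = wxcs ws"
  by (induction m ws rule: fil.induct) auto

lemma set_fil: "set (fil m ws) \<subseteq> insert 0 (set ws)"
  by (induction m ws rule: fil.induct) auto

lemma linmap_fl: "linmap (\<lambda>r. fl m (rs @ r # rs'))"
proof (induction m arbitrary: rs)
  case (Cons b m)
  show ?case
  proof (cases b)
    case True
    then show ?thesis by (simp add: linmap_mult_right' Cons)
  next
    case False
    then show ?thesis
      by (cases rs) (auto intro: linmap_mult_right' linmap_mult_left' Cons)
  qed
next
  case Nil
  then show ?case by (cases rs) auto
qed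

text \<open>The operation of \<open>GenJ\<close> is a nonzero constant, so it has to be
  excluded.\<close>

lemma linmap_nfop: "g \<noteq> GenJ \<Longrightarrow> linmap (\<lambda>r. nfop g (rs @ r # rs'))"
proof (cases g)
  case GenM
  have "linmap (\<lambda>r. case rs @ r # rs' of [a, b] \<Rightarrow> a * b | _ \<Rightarrow> 0)"
  proof (cases rs)
    case Nil
    then show ?thesis by (cases rs'; cases "tl rs'") (auto intro: linmap_mult_left)
  next
    case (Cons a as)
    show ?thesis
    proof (cases "as = [] \<and> rs' = []")
      case True
      then show ?thesis using Cons by (simp add: linmap_mult_right)
    next
      case False
      have "(\<lambda>r. case rs @ r # rs' of [a, b] \<Rightarrow> a * b | _ \<Rightarrow> 0) = (\<lambda>r. 0)"
        using False Cons by (intro ext) (cases as; auto split: list.splits)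
      then show ?thesis by simp
    qed
  qed
  then show ?thesis using GenM by simp
qed (auto intro: linmap_comp[OF linmap_Br] linmap_fl)

lemma NF_node: "g \<noteq> GenJ \<Longrightarrow> NF (node g as bs x) = nfop g (map nf as @ NF x # map nf bs)"
  by (rule linmap_eqI[OF linmap_comp[OF linmap_NF linmap_node] linmap_comp[OF linmap_nfop linmap_NF]]) auto

section \<open>Masks of generators and the shape of the generator differentials\<close>

lemma length_mask [simp]: "length (mask n T) = n"
  by (simp add: mask_def)

lemma slots_mask: "slots (mask n T) + card (T \<inter> {1..n}) = n"
proof (induction n)
  case (Suc n)
  have "T \<inter> {1..Suc n} = (if Suc n \<in> T then insert (Suc n) (T \<inter> {1..n}) else T \<inter> {1..n})"
    by (auto simp: le_Suc_eq)
  then have "card (T \<inter> {1..Suc n}) = card (T \<inter> {1..n}) + (if Suc n \<in> T then 1 else 0)"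
    by simp
  then show ?case using Suc by (auto simp: mask_def)
qed (simp add: mask_def)

lemma gar_GenP: "T \<subseteq> {1..n} \<Longrightarrow> gar (GenP n T) = slots (mask n T)"
  using slots_mask[of n T] by (simp add: Int_absorb2)

lemma take_mask: "l \<le> n \<Longrightarrow> take l (mask n T) = mask l T"
  by (rule nth_equalityI) (auto simp: mask_def)

lemma mask_Int: "mask n (T \<inter> {1..n}) = mask n T"
  by (auto simp: mask_def)

lemma drop_mask: "l \<le> n \<Longrightarrow> drop l (mask n T) = mask (n - l) ((\<lambda>i. i - l) ` (T \<inter> {l + 1..n}))"
proof (rule nth_equalityI)
  fix i assume l: "l \<le> n" and i: "i < length (drop l (mask n T))"
  have "(\<exists>x\<in>T \<inter> {l + 1..n}. Suc i = x - l) \<longleftrightarrow> (\<exists>x\<in>T \<inter> {l + 1..n}. x = Suc (l + i))"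
    by (rule bex_cong) auto
  with l i show "drop l (mask n T) ! i = mask (n - l) ((\<lambda>i. i - l) ` (T \<inter> {l + 1..n})) ! i"
    by (auto simp: mask_def image_iff)
qed auto

definition qset :: "nat set \<Rightarrow> nat \<Rightarrow> nat set" where
  "qset T r = {i \<in> T. i < r} \<union> (\<lambda>i. i - 1) ` {i \<in> T. i > r + 1} \<union> (if r \<in> T \<and> r + 1 \<in> T then {r} else {})"

lemma qset_subset: "T \<subseteq> {1..n} \<Longrightarrow> 1 \<le> r \<Longrightarrow> r < n \<Longrightarrow> qset T r \<subseteq> {1..n - 1}"
proof
  fix i assume T: "T \<subseteq> {1..n}" and r: "1 \<le> r" "r < n" and "i \<in> qset T r"
  then consider "i \<in> T" "i < r" | k where "k \<in> T" "k > r + 1" "i = k - 1" | "i = r"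
    by (auto simp: qset_def split: if_splits)
  then show "i \<in> {1..n - 1}"
    using T r by cases (auto dest!: subsetD[of T _ i] subsetD[of T])
qed

lemma mem_qset: "i \<in> qset T r \<longleftrightarrow> (if i < r then i \<in> T else if i = r then r \<in> T \<and> r + 1 \<in> T else Suc i \<in> T)"
  by (auto simp: qset_def image_iff intro: bexI[of _ "Suc i"])

text \<open>Multiplying the arguments \<open>r\<close> and \<open>r + 1\<close> replaces two mask
  entries by their conjunction: a product is the symbol \<open>1\<close> only if both factors
  are.\<close>

lemma mask_split:
  assumes "1 \<le> r" "r < n"
  shows "mask n T = mask (r - 1) T @ [r \<in> T, r + 1 \<in> T] @ drop (r + 1) (mask n T)"
    "mask (n - 1) (qset T r) = mask (r - 1) T @ [r \<in> T \<and> r + 1 \<in> T] @ drop (r + 1) (mask n T)"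
proof -
  have 1: "[0..<n] = [0..<r - 1] @ [r - 1, r] @ [r + 1..<n]"
    using assms upt_add_eq_append[of 0 "r - 1" "n - (r - 1)"] by (simp add: upt_conv_Cons)
  have 2: "[0..<n - 1] = [0..<r - 1] @ [r - 1] @ [r..<n - 1]"
    using assms upt_add_eq_append[of 0 "r - 1" "n - r"] by (simp add: upt_conv_Cons)
  have d: "drop (r + 1) (mask n T) = map (\<lambda>i. Suc i \<in> T) [r + 1..<n]"
    by (simp add: mask_def drop_map)
  show "mask n T = mask (r - 1) T @ [r \<in> T, r + 1 \<in> T] @ drop (r + 1) (mask n T)"
    unfolding d unfolding mask_def 1 using assms by simp
  have "[r + 1..<n] = map Suc [r..<n - 1]" using assms by (simp add: map_Suc_upt)
  then have "drop (r + 1) (mask n T) = map (\<lambda>i. Suc i \<in> qset T r) [r..<n - 1]"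
    unfolding d by (auto simp: mem_qset)
  then show "mask (n - 1) (qset T r) = mask (r - 1) T @ [r \<in> T \<and> r + 1 \<in> T] @ drop (r + 1) (mask n T)"
    unfolding mask_def 2 using assms by (auto simp: mem_qset)
qed

lemma q_term_eq:
  assumes T: "T \<subseteq> {1..n}" and r: "1 \<le> r" "r < n"
  shows "q_term n T r =
    (let k = slots (mask (r - 1) T); k' = slots (drop (r + 1) (mask n T)) in
     if r \<notin> T \<and> r + 1 \<notin> T
     then mono (Node (GenP (n - 1) (qset T r)) (replicate k Leaf @ [corolla GenM] @ replicate k' Leaf))
     else mono (corolla (GenP (n - 1) (qset T r))))"
proof (cases "r \<notin> T \<and> r + 1 \<notin> T")
  case True
  let ?T = "{i \<in> T. i < r} \<union> (\<lambda>i. i - 1) ` {i \<in> T. i > r + 1}"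
  let ?k = "slots (mask (r - 1) T)" and ?k' = "slots (drop (r + 1) (mask n T))"
  have q: "qset T r = ?T" using True by (simp add: qset_def)
  \<comment> \<open>The input into which \<open>m\<close> is inserted has as its number the count of
    free slots before position \<open>r\<close>, plus one.\<close>
  have "{i \<in> T. i < r} = T \<inter> {1..r - 1}" using T r by auto
  then have k: "r - card {i \<in> T. i < r} = Suc ?k" using slots_mask[of "r - 1" T] r by simp
  have "gar (GenP (n - 1) (qset T r)) = ?k + (1 + ?k')"
    unfolding gar_GenP[OF qset_subset[OF T r]] using True by (subst mask_split(2)[OF r]) simp
  note g = this[unfolded q]
  have c: "corolla (GenP (n - 1) ?T)
      = Node (GenP (n - 1) ?T) (replicate ?k Leaf @ Leaf # replicate ?k' Leaf)"
    unfolding corolla_def g replicate_add by simp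
  have s: "tdeg gdeg (corolla GenM) = 0" by (simp add: corolla_def sum_list_replicate)
  have "free_comp gdeg (Suc ?k) (mono (corolla (GenP (n - 1) ?T))) (mono (corolla GenM))
      = (mono (Node (GenP (n - 1) ?T) (replicate ?k Leaf @ corolla GenM # replicate ?k' Leaf)) :: (gen, 'a) free)"
    unfolding c by (subst comp_mono_mono) (simp_all add: s graft_list_append deg_after_list_append sum_list_replicate)
  then show ?thesis
    using True by (simp add: q_term_def Let_def k q)
next
  case False
  then show ?thesis
    by (auto simp: q_term_def Let_def qset_def)
qed

lemma corolla_tset: "g \<in> gens \<Longrightarrow> corolla g \<in> tset gens gar gdeg (gar g) (gdeg g)"
  by (auto simp: tset_def corolla_def sum_list_replicate)

lemma corolla_supp: "g \<in> gens \<Longrightarrow> mono (corolla g) \<in> supp (tset gens gar gdeg (gar g) (gdeg g))"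
  by (intro supp_single corolla_tset)

lemma GenP_gens: "1 \<le> n \<Longrightarrow> T \<subseteq> {1..n} \<Longrightarrow> GenP n T \<in> gens"
  and GenM_gens [simp]: "GenM \<in> gens" and GenJ_gens [simp]: "GenJ \<in> gens"
  by (auto simp: gens_def)

lemma GenP_gensD: "GenP n T \<in> gens \<Longrightarrow> 1 \<le> n \<and> T \<subseteq> {1..n}"
  by (auto simp: gens_def)

lemma q_term_supp:
  assumes T: "T \<subseteq> {1..n}" and r: "1 \<le> r" "r < n"
  shows "q_term n T r \<in> supp (tset gens gar gdeg (gar (GenP n T)) (2 - int n))"
proof -
  have g: "GenP (n - 1) (qset T r) \<in> gens" using r by (intro GenP_gens qset_subset T) auto
  have "gar (GenP n T) = gar (GenP (n - 1) (qset T r)) + (if r \<notin> T \<and> r + 1 \<notin> T then 1 else 0)"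
    unfolding gar_GenP[OF T] gar_GenP[OF qset_subset[OF T r]]
    by (subst mask_split(1)[OF r], subst mask_split(2)[OF r]) auto
  moreover have "gar (GenP (n - 1) (qset T r)) = slots (mask (r - 1) T) +
      ((if r \<in> T \<and> r + 1 \<in> T then 0 else 1) + slots (drop (r + 1) (mask n T)))"
    unfolding gar_GenP[OF qset_subset[OF T r]] by (subst mask_split(2)[OF r]) auto
  ultimately show ?thesis
    using g r unfolding q_term_eq[OF T r] Let_def
    by (auto intro!: supp_single simp: tset_def corolla_def sum_list_replicate simp del: gar.simps(2)
        simp: of_nat_diff)
qed

lemma m_term_supp:
  assumes T: "T \<subseteq> {1..n}" and l: "1 \<le> l" "l < n"
  shows "m_term n T l \<in> supp (tset gens gar gdeg (gar (GenP n T)) (2 - int n))"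
proof -
  let ?T = "T \<inter> {1..l}" and ?T' = "(\<lambda>i. i - l) ` (T \<inter> {l + 1..n})"
  have sub: "?T \<subseteq> {1..l}" "?T' \<subseteq> {1..n - l}" by auto
  then have g: "GenP l ?T \<in> gens" "GenP (n - l) ?T' \<in> gens" using l by (auto intro!: GenP_gens)
  have "mask l ?T = take l (mask n T)" using take_mask[of l n T] mask_Int[of l T] l by simp
  moreover have "mask (n - l) ?T' = drop l (mask n T)" using drop_mask[of l n T] l by simp
  ultimately have "mask n T = mask l ?T @ mask (n - l) ?T'" by simp
  then have "gar (GenP n T) = gar (GenP l ?T) + gar (GenP (n - l) ?T')"
    unfolding gar_GenP[OF T] gar_GenP[OF sub(1)] gar_GenP[OF sub(2)] by simp
  then show ?thesis
    using g l unfolding m_term_def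
    by (auto intro!: supp_single simp: tset_def corolla_def sum_list_replicate simp del: gar.simps(2)
        simp: of_nat_diff)
qed

lemma gen_dif_supp:
  assumes "g \<in> gens"
  shows "(gen_dif g :: (gen, 'k::field) free) \<in> supp (tset gens gar gdeg (gar g) (gdeg g + 1))"
proof (cases g)
  case (GenP n T)
  with assms have "1 \<le> n" "T \<subseteq> {1..n}" using GenP_gensD by blast+
  then show ?thesis
    using q_term_supp[of T n, where 'a = 'k] m_term_supp[of T n, where 'a = 'k] unfolding GenP gen_dif.simps free_scl_eq_sc
    by (intro supp_add supp_sum supp_sc) (auto simp del: gar.simps simp: algebra_simps)
qed simp_all

interpretation wu: free_dg gens gar gdeg gen_dif
  by standard (rule gen_dif_supp)

lemma br_cases: "br as = 0 \<or> (\<exists>w. br as = W w)"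
  by (auto simp: br_def)

lemma supp_W: "(W w :: 'k::field wmod) \<in> supp S \<Longrightarrow> w \<in> S"
  by (simp add: supp_def)

lemma nf_list_cases:
  assumes "\<forall>t\<in>set ts. nf t = (0 :: 'k::field wmod) \<or> (\<exists>w\<in>HW' (leaves t) (tdeg gdeg t). nf t = (W w :: 'k wmod))"
  shows "(0 :: 'k wmod) \<in> set (map nf ts) \<or> (\<exists>ws. map nf ts = map (W :: _ \<Rightarrow> 'k wmod) ws \<and>
    (\<forall>w\<in>set ws. wval w \<and> w \<noteq> 0) \<and> map wxc ws = map leaves ts \<and> map wdeg ws = map (tdeg gdeg) ts)"
  using assms
proof (induction ts)
  case (Cons t ts)
  then consider "(0 :: 'k wmod) \<in> set (map nf (t # ts))"
    | w ws where "w\<in>HW' (leaves t) (tdeg gdeg t)" "nf t = (W w :: 'k wmod)"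
      "map nf ts = map (W :: _ \<Rightarrow> 'k wmod) ws" "\<forall>w\<in>set ws. wval w \<and> w \<noteq> 0"
      "map wxc ws = map leaves ts" "map wdeg ws = map (tdeg gdeg) ts"
    by auto
  then show ?case
  proof cases
    case 2
    then show ?thesis by (intro disjI2 exI[of _ "w # ws"]) (auto simp: HW'_def HW_def)
  qed auto
qed simp

text \<open>The relations only identify trees or kill them, so evaluation never leads to sums. The
  word obtained is nonempty and therefore cannot be mistaken for the symbol \<open>1\<close> when it
  is filled into a bracket.\<close>

lemma nf_cases:
  "wf_tree gens gar t \<Longrightarrow>
    nf t = (0 :: 'k::field wmod) \<or> (\<exists>w\<in>HW' (leaves t) (tdeg gdeg t). nf t = (W w :: 'k wmod))"
proof (induction t)
  case Leaf
  show ?case by (rule disjI2, rule bexI[of _ "lw LX"]) (auto simp: HW'_def HW_def)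
next
  case (Node g ts)
  then have wf: "g \<in> gens" "length ts = gar g" by auto
  from Node nf_list_cases[of ts, where 'k = 'k] consider "(0 :: 'k wmod) \<in> set (map nf ts)"
    | ws where "map nf ts = map (W :: _ \<Rightarrow> 'k wmod) ws" "\<forall>w\<in>set ws. wval w \<and> w \<noteq> 0"
      "map wxc ws = map leaves ts" "map wdeg ws = map (tdeg gdeg) ts"
    by auto
  then show ?case
  proof cases
    case 1
    have "g \<noteq> GenJ" using 1 wf by auto
    then have "nfop g (map nf ts) = (0 :: 'k wmod)"
      using 1 wf by (cases g) (auto simp: length_Suc_conv numeral_2_eq_2 fl_zero gar_GenP
          linmap_zero dest!: GenP_gensD simp del: gar.simps(2))
    then show ?thesis by simp
  next
    case 2
    have len: "length ws = length ts" using 2(3) by (metis length_map)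
    show ?thesis
    proof (cases g)
      case GenM
      then obtain a b where ab: "ts = [a, b]" using wf by (auto simp: length_Suc_conv numeral_2_eq_2)
      then obtain v w where vw: "ws = [v, w]" using len by (auto simp: length_Suc_conv)
      show ?thesis using 2
        by (intro disjI2 bexI[of _ "v + w"]) (auto simp: GenM ab vw W_mult HW_def HW'_def)
    next
      case GenJ
      then show ?thesis using wf by (intro disjI2 bexI[of _ J]) (auto simp: HW_def HW'_def)
    next
      case (GenP n T)
      with wf have T: "T \<subseteq> {1..n}" using GenP_gensD by blast
      with wf GenP len have sl: "slots (mask n T) = length ws" by (simp add: gar_GenP del: gar.simps)
      let ?as = "fil (mask n T) ws"
      have nf: "nf (Node g ts) = (br ?as :: 'k wmod)" by (simp add: GenP 2(1) fl_W sl)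
      have "?as \<in> HL n (leaves (Node g ts)) (tdegs gdeg ts)"
        using 2 sl set_fil[of "mask n T" ws] by (auto simp: HL_def length_fil fil_sums)
      from br_HW'[OF this] have s: "(br ?as :: 'k wmod) \<in> supp (HW' (leaves (Node g ts)) (tdeg gdeg (Node g ts)))"
        by (simp add: GenP algebra_simps)
      from br_cases[of ?as, where 'a = 'k] show ?thesis
      proof (elim disjE exE)
        fix w assume w: "br ?as = (W w :: 'k wmod)"
        with s have "w \<in> HW' (leaves (Node g ts)) (tdeg gdeg (Node g ts))" by (intro supp_W) simp
        with w show ?thesis unfolding nf by blast
      next
        assume "br ?as = (0 :: 'k wmod)"
        then show ?thesis unfolding nf by blast
      qed
    qed
  qed
qed

lemma NF_supp:
  fixes f :: "(gen, 'k::field) free"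
  assumes "f \<in> supp (tset gens gar gdeg N p)"
  shows "NF f \<in> supp (HW' N p)"
proof (rule supp_linmap[OF linmap_NF assms])
  fix t assume "t \<in> tset gens gar gdeg N p"
  then have "wf_tree gens gar t" "leaves t = N" "tdeg gdeg t = p" by (auto simp: tset_def)
  with nf_cases[of t, where 'k = 'k] show "(NF (mono t) :: 'k wmod) \<in> supp (HW' N p)" by (auto intro: supp_single)
qed

section \<open>The normal form commutes with the differentials\<close>

definition mgr :: "nat \<Rightarrow> wrd list \<Rightarrow> wrd list" where
  "mgr r as = take (r - 1) as @ (as ! (r - 1) + as ! r) # drop (r + 1) as"

lemma mg_sum: "mg as = (\<Sum>r\<in>{1..<length as}. sc (pm (int r - 1)) (Ls (mgr r as)))"
proof (induction as rule: mg.induct)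
  case (1 a b as)
  have "(\<Sum>r\<in>{1..<length (a # b # as)}. sc (pm (int r - 1)) (Ls (mgr r (a # b # as))) :: 'a lmod)
    = (\<Sum>r\<in>{0..<Suc (length as)}. sc (pm (int r)) (Ls (mgr (Suc r) (a # b # as))))"
    by (simp add: sum.atLeast_Suc_lessThan_Suc_shift del: sum.op_ivl_Suc)
  also have "\<dots> = Ls ((a + b) # as)
      + (\<Sum>r\<in>{Suc 0..<Suc (length as)}. sc (pm (int r)) (Ls (mgr (Suc r) (a # b # as))))"
    by (simp add: sum.atLeast_Suc_lessThan[of 0] mgr_def del: sum.op_ivl_Suc)
  also have "(\<Sum>r\<in>{Suc 0..<Suc (length as)}. sc (pm (int r)) (Ls (mgr (Suc r) (a # b # as))) :: 'a lmod)
      = (\<Sum>r\<in>{1..<length (b # as)}. - (Ls [a] * sc (pm (int r - 1)) (Ls (mgr r (b # as)))))"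
    by (rule sum.cong) (auto simp: mgr_def mult_single plus_list_def sc_mult_right pm_diff take_Cons'
        single_uminus[symmetric] simp del: single_uminus)
  finally show ?case by (simp add: 1 sum_negf sum_distrib_left del: sum.op_ivl_Suc)
qed auto

abbreviation "dtree \<equiv> tree_dif gdeg gen_dif"

lemma nfop_zero:
  assumes "0 \<in> set rs" "length rs = gar g" "g \<in> gens"
  shows "nfop g rs = 0"
  using assms by (cases g) (auto simp: length_Suc_conv numeral_2_eq_2 fl_zero gar_GenP linmap_zero
      dest: GenP_gensD simp del: gar.simps(2))

lemma plug_q_term:
  assumes T: "T \<subseteq> {1..n}" and r: "1 \<le> r" "r < n" and ts: "length ts = gar (GenP n T)"
    and wf: "\<forall>t\<in>set ts. wf_tree gens gar t"
    and m1: "m1 = mask (r - 1) T" and m2: "m2 = drop (r + 1) (mask n T)"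
  shows "NF (plug gdeg 1 (q_term n T r) ts :: (gen, 'k::field) free) = (if r \<notin> T \<and> r + 1 \<notin> T
     then nfop (GenP (n - 1) (qset T r)) (map nf (take (slots m1) ts) @
        [nf (ts ! slots m1) * nf (ts ! (slots m1 + 1))] @ map nf (drop (slots m1 + 2) ts))
     else nfop (GenP (n - 1) (qset T r)) (map nf ts))"
proof -
  have len: "length ts = slots m1 + ((if r \<in> T then 0 else 1) + ((if r + 1 \<in> T then 0 else 1) + slots m2))"
    unfolding ts gar_GenP[OF T] m1 m2 by (subst mask_split(1)[OF r]) auto
  show ?thesis
  proof (cases "r \<notin> T \<and> r + 1 \<notin> T")
    case True
    then have l: "length ts = slots m1 + (2 + slots m2)" using len by simp
    define ts1 ts2 where "ts1 = take (slots m1) ts" and "ts2 = drop (slots m1 + 2) ts"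
    define t t' where "t = ts ! slots m1" and "t' = ts ! (slots m1 + 1)"
    have ts_eq: "ts = ts1 @ [t, t'] @ ts2"
    proof -
      have "drop (slots m1) ts = t # drop (Suc (slots m1)) ts"
        using l unfolding t_def by (intro Cons_nth_drop_Suc[symmetric]) simp
      also have "drop (Suc (slots m1)) ts = t' # drop (Suc (Suc (slots m1))) ts"
        using l unfolding t'_def Suc_eq_plus1[symmetric] by (intro Cons_nth_drop_Suc[symmetric]) simp
      finally have "drop (slots m1) ts = [t, t'] @ ts2" by (simp add: ts2_def)
      then show ?thesis unfolding ts1_def by (metis append_take_drop_id)
    qed
    have len1: "length ts1 = slots m1" "length ts2 = slots m2" using l by (auto simp: ts1_def ts2_def)
    let ?g = "GenP (n - 1) (qset T r)" and ?k = "slots m2"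
    have [simp]: "tdegs gdeg (replicate i Leaf) = 0" "tdegs gdeg (replicate i Leaf @ us) = tdegs gdeg us" for i us
      by (simp_all add: sum_list_replicate)
    have c: "corolla GenM = Node GenM (replicate 2 Leaf)" by (simp add: corolla_def)
    have "plug gdeg 1 (q_term n T r) ts = (plug gdeg 1 (mono (Node ?g ([] @ replicate (slots m1) Leaf @
        corolla GenM # replicate ?k Leaf))) (ts1 @ [t, t'] @ ts2) :: (gen, 'k) free)"
      using True unfolding q_term_eq[OF T r] Let_def m1[symmetric] m2[symmetric] ts_eq by simp
    also have "\<dots> = plug gdeg (Suc (lvs ts1)) (mono (Node ?g (ts1 @ corolla GenM # replicate ?k Leaf))) ([t, t'] @ ts2)"
      using plug_leaves[OF len1(1), of gdeg "[]" ?g "corolla GenM # replicate ?k Leaf", where 'k = 'k]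
      unfolding plug_append[of _ _ _ ts1] by (simp add: c sum_list_replicate)
    also have "\<dots> = plug gdeg (Suc (lvs (ts1 @ [t, t']))) (plug gdeg (lvs ts1 + 1)
        (node ?g ts1 (replicate ?k Leaf) (mono (corolla GenM))) [t, t']) ts2"
      by (subst plug_append) (simp add: add_ac)
    also have "plug gdeg (lvs ts1 + 1) (node ?g ts1 (replicate ?k Leaf) (mono (corolla GenM) :: (gen, 'k) free)) [t, t']
      = node ?g ts1 (replicate ?k Leaf) (plug gdeg (Suc 0) (mono (corolla GenM)) [t, t'])"
    proof -
      have cs: "(mono (corolla GenM) :: (gen, 'k) free) \<in> supp (tset gens gar gdeg 2 0)"
        using corolla_supp[OF GenM_gens] by simp
      show ?thesis
        using plug_node_mid[OF cs, of 1 "[t, t']" ts1 ?g "replicate ?k Leaf"] wf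
          by (simp add: ts_eq sum_list_replicate)
    qed
    also have "plug gdeg (Suc 0) (mono (corolla GenM)) [t, t'] = (mono (Node GenM [t, t']) :: (gen, 'k) free)"
      unfolding c by (rule plug_corolla) simp
    also have "plug gdeg (Suc (lvs (ts1 @ [t, t']))) (node ?g ts1 (replicate ?k Leaf) (mono (Node GenM [t, t']))) ts2
      = (mono (Node ?g (ts1 @ Node GenM [t, t'] # ts2)) :: (gen, 'k) free)"
      using plug_leaves[OF len1(2), of gdeg "ts1 @ [Node GenM [t, t']]" ?g "[]", where 'k = 'k] by (simp add: add_ac)
    finally show ?thesis using True by (simp add: ts1_def ts2_def t_def t'_def)
  next
    case False
    have "gar (GenP (n - 1) (qset T r)) = length ts"
      unfolding gar_GenP[OF qset_subset[OF T r]] using len False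
      by (subst mask_split(2)[OF r]) (auto simp: m1 m2)
    then have "plug gdeg 1 (mono (corolla (GenP (n - 1) (qset T r)))) ts
        = (mono (Node (GenP (n - 1) (qset T r)) ts) :: (gen, 'k) free)"
      unfolding corolla_def One_nat_def by (intro plug_corolla) simp
    then show ?thesis using False unfolding q_term_eq[OF T r] Let_def by auto
  qed
qed

text \<open>The sign arises from moving the trees \<open>ts1\<close> past the second factor, of
  degree \<open>1 - (n - l)\<close>; it is the Koszul sign in \<open>sp\<close>.\<close>

lemma plug_m_term:
  assumes T: "T \<subseteq> {1..n}" and l: "1 \<le> l" "l < n"
    and ts1: "length ts1 = slots (mask l T)" and ts2: "length ts2 = slots (drop l (mask n T))"
    and wf: "\<forall>t\<in>set (ts1 @ ts2). wf_tree gens gar t"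
  shows "NF (plug gdeg 1 (m_term n T l) (ts1 @ ts2) :: (gen, 'k::field) free)
    = sc (pm ((int n - int l - 1) * tdegs gdeg ts1))
       (Br (fl (mask l T) (map nf ts1)) * Br (fl (drop l (mask n T)) (map nf ts2)))"
proof -
  define U U' where "U = T \<inter> {1..l}" and "U' = (\<lambda>i. i - l) ` (T \<inter> {l + 1..n})"
  have sub: "U \<subseteq> {1..l}" "U' \<subseteq> {1..n - l}" by (auto simp: U_def U'_def)
  let ?g = "GenP l U" and ?g' = "GenP (n - l) U'"
  have g: "?g \<in> gens" "?g' \<in> gens" using l sub by (auto intro!: GenP_gens)
  have m: "mask l U = mask l T" "mask (n - l) U' = drop l (mask n T)"
    using drop_mask[of l n T] mask_Int[of l T] l by (simp_all add: U_def U'_def)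
  have len: "length ts1 = gar ?g" "length ts2 = gar ?g'"
    unfolding gar_GenP[OF sub(1)] gar_GenP[OF sub(2)] m using ts1 ts2 by simp_all
  have pc: "plug gdeg (Suc 0) (mono (corolla ?g)) ts1 = (mono (Node ?g ts1) :: (gen, 'k) free)"
    "plug gdeg (Suc 0) (mono (corolla ?g')) ts2 = (mono (Node ?g' ts2) :: (gen, 'k) free)"
    unfolding corolla_def by (intro plug_corolla len)+
  have c2: "tdeg gdeg (corolla ?g') = 1 - int (n - l)"
    by (simp add: corolla_def sum_list_replicate)
  have cs: "(mono (corolla ?g) :: (gen, 'k) free) \<in> supp (tset gens gar gdeg (length ts1) (gdeg ?g))"
    "(mono (corolla ?g') :: (gen, 'k) free) \<in> supp (tset gens gar gdeg (length ts2) (gdeg ?g'))"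
    unfolding len by (intro corolla_supp g)+
  have "plug gdeg 1 (m_term n T l) (ts1 @ ts2) = (plug gdeg (1 + lvs ts1)
      (plug gdeg (lvs [] + 1) (node GenM [] [corolla ?g'] (mono (corolla ?g))) ts1) ts2 :: (gen, 'k) free)"
    by (simp add: plug_append m_term_def U_def U'_def)
  also have "plug gdeg (lvs [] + 1) (node GenM [] [corolla ?g'] (mono (corolla ?g) :: (gen, 'k) free)) ts1
      = sc (pm ((int n - int l - 1) * tdegs gdeg ts1))
         (node GenM [Node ?g ts1] [] (mono (corolla ?g')))"
    using plug_node_mid[OF cs(1), of 1 ts1 "[]" GenM "[corolla ?g']"] wf l
    by (simp add: pc c2 pm_def of_nat_diff)
  also have "plug gdeg (1 + lvs ts1) \<dots> ts2 = sc (pm ((int n - int l - 1) * tdegs gdeg ts1))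
      (plug gdeg (lvs [Node ?g ts1] + 1) (node GenM [Node ?g ts1] [] (mono (corolla ?g') :: (gen, 'k) free)) ts2)"
    by (simp add: linmap_sc[OF linmap_plug] add.commute del: node_mono)
  also have "plug gdeg (lvs [Node ?g ts1] + 1) (node GenM [Node ?g ts1] [] (mono (corolla ?g') :: (gen, 'k) free)) ts2
      = mono (Node GenM [Node ?g ts1, Node ?g' ts2])"
    using plug_node_mid[OF cs(2), of 1 ts2 "[Node ?g ts1]" GenM "[]"] wf by (simp add: pc)
  finally show ?thesis
    by (simp add: m linmap_sc[OF linmap_NF] del: sc_single)
qed

lemma NF_inner_zero:
  assumes "(0 :: 'k::field wmod) \<in> set (map nf (as @ bs))" "length (as @ bs) = gar g" "g \<in> gens" "g \<noteq> GenJ"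
    and "\<forall>t\<in>set bs. NF (dtree t :: (gen, 'k) free) = DW (nf t)"
  shows "NF (wu.inner g as bs [] :: (gen, 'k) free) = 0"
  using assms
proof (induction bs arbitrary: as)
  case (Cons t bs)
  have "(0 :: 'k wmod) \<in> set (map nf as @ DW (nf t) # map nf bs)"
    using Cons.prems(1) linmap_zero[OF linmap_ops(1)] by auto
  then have "nfop g (map nf as @ DW (nf t) # map nf bs) = (0 :: 'k wmod)"
    using Cons.prems by (intro nfop_zero) auto
  moreover have "NF (wu.inner g (as @ [t]) bs [] :: (gen, 'k) free) = 0"
    using Cons.prems by (intro Cons.IH) auto
  ultimately show ?case
    using Cons.prems by (simp add: linmap_add[OF linmap_NF] linmap_sc[OF linmap_NF] NF_node)
qed (simp add: linmap_zero)

text \<open>Induction along the mask. Positions of the symbol \<open>1\<close> contribute nothing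
  because \<open>dw 0 = 0\<close>, so the sum over children is the full \<open>da\<close> of the
  filled list.\<close>

lemma NF_inner:
  assumes "\<forall>t\<in>set bs. NF (dtree t :: (gen, 'k::field) free) = DW (nf t)"
    and "map nf as = map (W :: _ \<Rightarrow> 'k wmod) vs" "map nf bs = map (W :: _ \<Rightarrow> 'k wmod) ws"
    and "map wdeg ws = map (tdeg gdeg) bs"
    and "mask n T = m @ m'" "slots m = length as" "slots m' = length bs"
  shows "NF (wu.inner (GenP n T) as bs [] :: (gen, 'k) free)
    = sc (pm (1 - int n + tdegs gdeg as)) (Br (Ls (fil m vs) * da (fil m' ws)))"
  using assms
proof (induction m' arbitrary: m as bs vs ws)
  case Nil
  then show ?case by (simp add: linmap_zero)
next
  case (Cons b m')
  have lv: "length vs = length as" using Cons.prems(2) by (metis length_map)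
  show ?case
  proof (cases b)
    case True
    have "NF (wu.inner (GenP n T) as bs [] :: (gen, 'k) free)
      = sc (pm (1 - int n + tdegs gdeg as)) (Br (Ls (fil (m @ [True]) vs) * da (fil m' ws)))"
      using Cons.prems True by (intro Cons.IH) auto
    moreover have "fil (m @ [True]) vs = fil m vs @ [0]"
      using fil_append[of m vs "[True]" "[]"] Cons.prems lv by simp
    ultimately show ?thesis using True by (simp add: linmap_zero Ls_mult[symmetric] mult.assoc)
  next
    case False
    then obtain t ts where bs: "bs = t # ts" using Cons.prems by (cases bs) auto
    then obtain w us where ws: "ws = w # us" using Cons.prems by (cases ws) auto
    have t: "nf t = (W w :: 'k wmod)" "NF (dtree t :: (gen, 'k) free) = dw w" "tdeg gdeg t = wdeg w"
      and us: "map nf ts = map (W :: _ \<Rightarrow> 'k wmod) us"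
      using Cons.prems by (auto simp: bs ws)
    have lu: "length us = length ts" using us by (metis length_map)
    have IH: "NF (wu.inner (GenP n T) (as @ [t]) ts [] :: (gen, 'k) free)
      = sc (pm (1 - int n + tdegs gdeg (as @ [t]))) (Br (Ls (fil (m @ [False]) (vs @ [w])) * da (fil m' us)))"
      using Cons.prems False by (intro Cons.IH) (auto simp: bs ws)
    have f: "fil (m @ [False]) (vs @ [w]) = fil m vs @ [w]"
      using fil_append[of m vs "[False]" "[w]"] Cons.prems lv by simp
    have "fl (mask n T) (map nf as @ dw w # map nf ts) = (Ls (fil m vs) * (io (dw w) * Ls (fil m' us)) :: 'k lmod)"
      using Cons.prems False lv lu bs
      by (simp add: fl_append fl_W us)
    then have "NF (node (GenP n T) as ts (dtree t :: (gen, 'k) free)) = Br (Ls (fil m vs) * (io (dw w) * Ls (fil m' us)))"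
      by (simp add: NF_node t)
    then show ?thesis
      using False IH
      by (simp add: bs ws linmap_add[OF linmap_NF] linmap_sc[OF linmap_NF] f linmap_add[OF linmap_Br]
          linmap_sc[OF linmap_Br] distrib_left sc_add sc_mult_right Ls_mult[symmetric] mult.assoc t pm_add)
  qed
qed

lemma fil_mask_take_drop:
  assumes "l \<le> n" "length ws1 = slots (mask l T)" "length ws2 = slots (drop l (mask n T))"
  shows "fil (mask n T) (ws1 @ ws2) = fil (mask l T) ws1 @ fil (drop l (mask n T)) ws2"
    "length (fil (mask l T) ws1) = l"
proof -
  have "mask n T = mask l T @ drop l (mask n T)"
    using append_take_drop_id[of l "mask n T"] take_mask[OF assms(1), of T] by simp
  then show "fil (mask n T) (ws1 @ ws2) = fil (mask l T) ws1 @ fil (drop l (mask n T)) ws2"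
    using fil_append[of "mask l T" ws1 "drop l (mask n T)" ws2] assms(2) by simp
  show "length (fil (mask l T) ws1) = l" using assms(2) by (simp add: length_fil)
qed

lemma NF_q_term:
  assumes T: "T \<subseteq> {1..n}" and r: "1 \<le> r" "r < n" and ts: "length ts = gar (GenP n T)"
    and wf: "\<forall>t\<in>set ts. wf_tree gens gar t" and ws: "map nf ts = map (W :: _ \<Rightarrow> 'k::field wmod) ws"
  shows "NF (plug gdeg 1 (q_term n T r) ts :: (gen, 'k) free) = br (mgr r (fil (mask n T) ws))"
proof -
  let ?b = "r \<in> T" and ?b' = "r + 1 \<in> T"
  define m1 m2 where "m1 = mask (r - 1) T" and "m2 = drop (r + 1) (mask n T)"
  note sp = mask_split[OF r, of T, folded m1_def m2_def]
  have lw: "length ws = length ts" using ws by (metis length_map)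
  have len: "length ws = slots m1 + (slots [?b, ?b'] + slots m2)"
    unfolding lw ts gar_GenP[OF T] by (subst sp(1)) auto
  define vs us xs where "vs = take (slots m1) ws" and "us = take (slots [?b, ?b']) (drop (slots m1) ws)"
    and "xs = drop (slots [?b, ?b']) (drop (slots m1) ws)"
  have ws_eq: "ws = vs @ us @ xs" unfolding vs_def us_def xs_def by (simp only: append_take_drop_id)
  have l: "length vs = slots m1" "length us = slots [?b, ?b']" "length xs = slots m2"
    using len by (auto simp: vs_def us_def xs_def)
  have fil: "fil (mask n T) ws = fil m1 vs @ fil [?b, ?b'] us @ fil m2 xs"
    unfolding sp(1) ws_eq using l by (simp only: fil_append)
  have l1: "length (fil m1 vs) = r - 1" using l by (simp add: length_fil m1_def)
  have mgr: "mgr r (fil m1 vs @ [a, b] @ fil m2 xs) = fil m1 vs @ (a + b) # fil m2 xs" for a b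
    using r l1 by (auto simp: mgr_def nth_append)
  show ?thesis
  proof (cases "r \<notin> T \<and> r + 1 \<notin> T")
    case True
    then obtain a b where us: "us = [a, b]" using l by (auto simp: length_Suc_conv)
    have bd: "slots m1 + 1 < length ts" using len True unfolding lw by simp
    have wab: "ws ! slots m1 = a" "ws ! (slots m1 + 1) = b"
      unfolding ws_eq us l(1)[symmetric] by (simp_all add: nth_append)
    have n: "nf (ts ! i) = (W (ws ! i) :: 'k wmod)" if "i < length ts" for i
      using that arg_cong[OF ws, of "\<lambda>l. l ! i"] lw by simp
    have n1: "nf (ts ! slots m1) = (W a :: 'k wmod)" "nf (ts ! (slots m1 + 1)) = (W b :: 'k wmod)"
      using n[of "slots m1"] n[of "slots m1 + 1"] bd unfolding wab by auto
    have n2: "map nf (take (slots m1) ts) = map (W :: _ \<Rightarrow> 'k wmod) vs"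
      "map nf (drop (slots m1 + 2) ts) = map (W :: _ \<Rightarrow> 'k wmod) xs"
      unfolding take_map[symmetric] drop_map[symmetric] ws using l by (simp_all add: ws_eq us)
    have "fl (mask (n - 1) (qset T r)) (map W vs @ [W a * W b] @ map W xs)
        = (Ls (fil m1 vs @ (a + b) # fil m2 xs) :: 'k lmod)"
      unfolding sp(2) W_mult
      using True l fl_W[of "m1 @ [False] @ m2" "vs @ [a + b] @ xs", where 'a = 'k]
      by (simp add: fil_append)
    then show ?thesis
      unfolding plug_q_term[OF T r ts wf m1_def m2_def] using True n1 n2 us
      by (simp add: fil mgr[simplified])
  next
    case False
    have "slots (mask (n - 1) (qset T r)) = length ws" unfolding sp(2) using False len by auto
    then have "fl (mask (n - 1) (qset T r)) (map W ws) = (Ls (fil (m1 @ [?b \<and> ?b'] @ m2) ws) :: 'k lmod)"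
      unfolding sp(2)[symmetric] by (rule fl_W)
    also have "fil (m1 @ [?b \<and> ?b'] @ m2) ws = fil m1 vs @ fil [?b \<and> ?b'] us @ fil m2 xs"
      unfolding ws_eq using l False by (subst fil_append, simp, subst fil_append) auto
    also have "\<dots> = mgr r (fil (mask n T) ws)"
      unfolding fil using False l mgr by (cases "r \<in> T"; cases "r + 1 \<in> T") (auto simp: length_Suc_conv)
    finally show ?thesis
      unfolding plug_q_term[OF T r ts wf m1_def m2_def] using False ws by auto
  qed
qed

text \<open>\<open>dl\<close> repeats the differential of the generators on letters, and
  \<open>DW_br\<close> extends it to brackets that a relation simplifies. Trees with a child of
  normal form 0 are treated apart, because no list of words describes their children.\<close>

theorem NF_tree_dif: "wf_tree gens gar t \<Longrightarrow> NF (dtree t :: (gen, 'k::field) free) = DW (nf t)"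
proof (induction t)
  case Leaf
  show ?case by (simp add: linmap_zero)
next
  case (Node g ts)
  then have wf: "g \<in> gens" "length ts = gar g" "\<forall>t\<in>set ts. wf_tree gens gar t"
    and IH: "\<forall>t\<in>set ts. NF (dtree t :: (gen, 'k) free) = DW (nf t)" by auto
  have E: "NF (dtree (Node g ts) :: (gen, 'k) free)
      = NF (plug gdeg 1 (gen_dif g) ts :: (gen, 'k) free) + NF (wu.inner g [] ts [] :: (gen, 'k) free)"
    by (simp add: wu.tree_dif_Node linmap_add[OF linmap_NF])
  from nf_list_cases[of ts, where 'k = 'k] nf_cases[where 'k = 'k] wf(3)
  consider "(0 :: 'k wmod) \<in> set (map nf ts)"
    | ws where "map nf ts = map (W :: _ \<Rightarrow> 'k wmod) ws" "map wdeg ws = map (tdeg gdeg) ts"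
    by blast
  then show ?case
  proof cases
    case 1
    have gJ: "g \<noteq> GenJ" using 1 wf by auto
    have "NF (wu.inner g [] ts [] :: (gen, 'k) free) = 0"
      using 1 wf IH gJ by (intro NF_inner_zero) auto
    \<comment> \<open>Every term of \<open>gen_dif g\<close> uses each child exactly once, so a
      child with normal form 0 kills all of them.\<close>
    moreover have "NF (plug gdeg 1 (gen_dif g) ts :: (gen, 'k) free) = 0"
    proof (cases g)
      case (GenP n T)
      with wf have T: "T \<subseteq> {1..n}" and n: "1 \<le> n" using GenP_gensD by blast+
      have len: "length ts = gar (GenP n T)" using wf GenP by simp
      have q: "NF (plug gdeg 1 (q_term n T r) ts :: (gen, 'k) free) = 0" if r: "1 \<le> r" "r < n" for r
      proof -
        let ?m1 = "mask (r - 1) T" and ?m2 = "drop (r + 1) (mask n T)"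
        have g': "GenP (n - 1) (qset T r) \<in> gens" using r by (intro GenP_gens qset_subset T) auto
        have l: "length ts = slots ?m1 + ((if r \<in> T then 0 else 1) + ((if r + 1 \<in> T then 0 else 1) + slots ?m2))"
          unfolding len gar_GenP[OF T] by (subst mask_split(1)[OF r]) auto
        have l': "gar (GenP (n - 1) (qset T r)) = slots ?m1 + ((if r \<in> T \<and> r + 1 \<in> T then 0 else 1) + slots ?m2)"
          unfolding gar_GenP[OF qset_subset[OF T r]] by (subst mask_split(2)[OF r]) auto
        show ?thesis
        proof (cases "r \<notin> T \<and> r + 1 \<notin> T")
          case True
          let ?rs = "map nf (take (slots ?m1) ts) @
            [nf (ts ! slots ?m1) * nf (ts ! (slots ?m1 + 1))] @ map nf (drop (slots ?m1 + 2) ts) :: 'k wmod list"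
          obtain i where i: "i < length ts" "nf (ts ! i) = (0 :: 'k wmod)"
            using 1 by (auto simp: in_set_conv_nth)
          consider "i < slots ?m1" | "i = slots ?m1" | "i = slots ?m1 + 1" | "slots ?m1 + 2 \<le> i" by linarith
          then have "0 \<in> set ?rs"
          proof cases
            case 1
            then have "ts ! i \<in> set (take (slots ?m1) ts)" using i by (auto simp: in_set_conv_nth intro!: exI[of _ i])
            then show ?thesis using i(2) by (auto intro!: image_eqI[of _ _ "ts ! i"])
          next
            case 4
            then have "drop (slots ?m1 + 2) ts ! (i - (slots ?m1 + 2)) = ts ! i"
              using i by (subst nth_drop) (auto simp del: add_2_eq_Suc')
            moreover have "drop (slots ?m1 + 2) ts ! (i - (slots ?m1 + 2)) \<in> set (drop (slots ?m1 + 2) ts)"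
              using i 4 by (intro nth_mem) auto
            ultimately have "ts ! i \<in> set (drop (slots ?m1 + 2) ts)" by simp
            then show ?thesis using i(2) by (auto intro!: image_eqI[of _ _ "ts ! i"])
          qed (use i(2) in auto)
          moreover have "length ?rs = gar (GenP (n - 1) (qset T r))" using l l' True by simp
          ultimately have "nfop (GenP (n - 1) (qset T r)) ?rs = 0" using g' by (rule nfop_zero)
          then show ?thesis
            unfolding plug_q_term[OF T r len wf(3) refl refl] using True by simp
        next
          case False
          then have "length (map nf ts :: 'k wmod list) = gar (GenP (n - 1) (qset T r))" using l l' by auto
          from nfop_zero[OF 1 this g'] show ?thesis
            unfolding plug_q_term[OF T r len wf(3) refl refl] using False by auto
        qed
      qed
      have m: "NF (plug gdeg 1 (m_term n T l) ts :: (gen, 'k) free) = 0" if l: "1 \<le> l" "l < n" for l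
      proof -
        let ?m = "mask l T" and ?m' = "drop l (mask n T)"
        have "slots (mask n T) = slots (take l (mask n T)) + slots ?m'"
          by (metis append_take_drop_id filter_append length_append)
        then have sl: "length ts = slots ?m + slots ?m'"
          unfolding len gar_GenP[OF T] using take_mask[of l n T] l by simp
        define ts1 ts2 where "ts1 = take (slots ?m) ts" and "ts2 = drop (slots ?m) ts"
        have ts: "ts = ts1 @ ts2" "length ts1 = slots ?m" "length ts2 = slots ?m'"
          using sl by (simp_all add: ts1_def ts2_def)
        consider "(0 :: 'k wmod) \<in> set (map nf ts1)" | "(0 :: 'k wmod) \<in> set (map nf ts2)"
          using 1 ts(1) by auto
        then have "Br (fl ?m (map nf ts1)) * Br (fl ?m' (map nf ts2)) = (0 :: 'k wmod)"
          using ts by cases (simp_all add: fl_zero linmap_zero)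
        then show ?thesis
          using plug_m_term[OF T l ts(2,3), where 'k = 'k] wf(3) ts(1) by simp
      qed
      show ?thesis
        unfolding GenP gen_dif.simps free_scl_eq_sc linmap_add[OF linmap_plug] linmap_sum[OF linmap_plug]
          linmap_sc[OF linmap_plug] linmap_add[OF linmap_NF] linmap_sum[OF linmap_NF] linmap_sc[OF linmap_NF]
      proof -
        have z: "a + b = 0" if "a = 0" "b = 0" for a b :: "'k wmod" using that by simp
        show "(\<Sum>r\<in>{1..n - 1}. sc ((- 1) ^ (r - 1)) (NF (plug gdeg 1 (q_term n T r) ts :: (gen, 'k) free)))
          + (\<Sum>l\<in>{1..n - 1}. sc ((- 1) ^ l) (NF (plug gdeg 1 (m_term n T l) ts))) = 0"
          using q m n by (intro z sum.neutral ballI) auto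
      qed
    qed (simp_all add: linmap_zero[OF linmap_plug] linmap_zero)
    moreover have "nf (Node g ts) = (0 :: 'k wmod)"
      using nfop_zero[OF 1 _ wf(1)] wf(2) by simp
    ultimately show ?thesis unfolding E by (simp add: linmap_zero)
  next
    case 2
    have lw: "length ws = length ts" using 2(1) by (metis length_map)
    show ?thesis
    proof (cases g)
      case GenJ
      then show ?thesis using wf unfolding E by (simp add: linmap_zero)
    next
      case GenM
      then obtain a b where ab: "ts = [a, b]" using wf by (auto simp: length_Suc_conv numeral_2_eq_2)
      then obtain v w where vw: "ws = [v, w]" using lw by (auto simp: length_Suc_conv)
      have "nf a = (W v :: 'k wmod)" "nf b = (W w :: 'k wmod)" "tdeg gdeg a = wdeg v"
        "NF (dtree a :: (gen, 'k) free) = dw v" "NF (dtree b :: (gen, 'k) free) = dw w"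
        using 2 IH by (auto simp: ab vw)
      then show ?thesis
        unfolding E unfolding GenM ab
        by (simp add: linmap_zero linmap_add[OF linmap_NF] linmap_sc[OF linmap_NF] NF_node W_mult dw_plus
            linmap_zero[OF linmap_comp_left])
    next
      case (GenP n T)
      with wf have T: "T \<subseteq> {1..n}" and n: "1 \<le> n" using GenP_gensD by blast+
      have len: "length ts = gar (GenP n T)" using wf GenP by simp
      have sl: "slots (mask n T) = length ws" unfolding lw len gar_GenP[OF T] ..
      let ?as = "fil (mask n T) ws"
      have la: "length ?as = n" using sl by (simp add: length_fil)
      have q: "NF (plug gdeg 1 (q_term n T r) ts :: (gen, 'k) free) = br (mgr r ?as)" if r: "1 \<le> r" "r < n" for r
        using NF_q_term[OF T r len wf(3) 2(1)] .
      have m: "NF (plug gdeg 1 (m_term n T l) ts :: (gen, 'k) free)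
          = sc (pm ((int n - int l - 1) * wdegs (take l ?as))) (br (take l ?as) * br (drop l ?as))"
        if l: "1 \<le> l" "l < n" for l
      proof -
        let ?m = "mask l T" and ?m' = "drop l (mask n T)"
        have "slots (mask n T) = slots (take l (mask n T)) + slots ?m'"
          by (metis append_take_drop_id filter_append length_append)
        then have s: "length ts = slots ?m + slots ?m'"
          unfolding len gar_GenP[OF T] using take_mask[of l n T] l by simp
        define ts1 ts2 where "ts1 = take (slots ?m) ts" and "ts2 = drop (slots ?m) ts"
        define ws1 ws2 where "ws1 = take (slots ?m) ws" and "ws2 = drop (slots ?m) ws"
        have ts: "ts = ts1 @ ts2" "length ts1 = slots ?m" "length ts2 = slots ?m'"
          using s by (simp_all add: ts1_def ts2_def)
        have ws: "ws = ws1 @ ws2" "length ws1 = slots ?m" "length ws2 = slots ?m'"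
          using s lw by (simp_all add: ws1_def ws2_def)
        have n12: "map nf ts1 = map (W :: _ \<Rightarrow> 'k wmod) ws1" "map nf ts2 = map (W :: _ \<Rightarrow> 'k wmod) ws2"
          "map wdeg ws1 = map (tdeg gdeg) ts1"
          unfolding ts1_def ts2_def ws1_def ws2_def take_map[symmetric] drop_map[symmetric] 2 by simp_all
        have td: "take l ?as = fil ?m ws1" "drop l ?as = fil ?m' ws2"
          using fil_mask_take_drop[of l n ws1 T ws2] ws l by simp_all
        have wd: "wdegs (fil ?m ws1) = tdegs gdeg ts1" using ws n12(3) by (simp add: fil_sums)
        have X: "NF (plug gdeg 1 (m_term n T l) ts :: (gen, 'k) free)
            = sc (pm ((int n - int l - 1) * tdegs gdeg ts1)) (Br (fl ?m (map nf ts1)) * Br (fl ?m' (map nf ts2)))"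
          unfolding ts(1) using wf(3) ts(1) by (intro plug_m_term T l ts) simp
        show ?thesis unfolding X td wd n12 using ws(2,3) by (simp add: fl_W)
      qed
      have i: "NF (wu.inner (GenP n T) [] ts [] :: (gen, 'k) free) = sc (pm (int n - 1)) (Br (da ?as))"
        using NF_inner[OF IH, of "[]" "[]" ws n T "[]" "mask n T"] 2 sl lw
        by (simp add: Ls_Nil pm_diff mult.commute)
      have nn: "{1..n - 1} = {1..<n}" using n by auto
      have p: "NF (plug gdeg 1 (gen_dif (GenP n T)) ts :: (gen, 'k) free) = Br (mg ?as) + sp ?as"
        unfolding gen_dif.simps free_scl_eq_sc linmap_add[OF linmap_plug] linmap_sum[OF linmap_plug]
          linmap_sc[OF linmap_plug] linmap_add[OF linmap_NF] linmap_sum[OF linmap_NF] linmap_sc[OF linmap_NF]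
          mg_sum sp_def linmap_sum[OF linmap_Br] linmap_sc[OF linmap_Br] la nn
        by (intro arg_cong2[of _ _ _ _ "(+)"] sum.cong refl)
          (auto simp: q[unfolded One_nat_def] m[unfolded One_nat_def] power_eq_pm of_nat_diff)
      have "?as \<noteq> []" using la n by auto
      from DW_br[OF this, where 'k = 'k] have "DW (nf (Node g ts)) = NF (dtree (Node g ts) :: (gen, 'k) free)"
        unfolding E unfolding GenP i p by (simp only: nf.simps nfop.simps 2(1) fl_W sl la Br_single sc_one add_ac)
      then show ?thesis ..
    qed
  qed
qed

lemma NF_dif:
  fixes f :: "(gen, 'k::field) free"
  assumes "f \<in> supp {t. wf_tree gens gar t}"
  shows "NF (wu.D f) = DW (NF f)"
  by (rule linmap_eq_supp[OF assms linmap_comp[OF linmap_NF wu.linmap_dif] linmap_comp[OF linmap_ops(1) linmap_NF]])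
    (simp add: NF_tree_dif)

section \<open>The differential squares to zero\<close>

lemma MG_Ls_mult: "MG (Ls [a] * x) = lin (\<lambda>bs. case bs of [] \<Rightarrow> 0 | b # bs' \<Rightarrow> Ls ((a + b) # bs')) x - Ls [a] * MG x"
proof (rule linmap_eqI[of "\<lambda>x. MG (Ls [a] * x)"])
  fix t
  show "MG (Ls [a] * Ls t) = lin (\<lambda>bs. case bs of [] \<Rightarrow> 0 | b # bs' \<Rightarrow> Ls ((a + b) # bs')) (Ls t) - Ls [a] * MG (Ls t)"
    by (cases t) (simp_all add: Ls_mult)
qed (intro linmap_comp[OF linmap_ops(3)] linmap_sub linmap_mult_right' linmap_mult_right linmap_ops linmap_lin)+

lemma head_mult: "lin (\<lambda>bs. case bs of [] \<Rightarrow> 0 | b # bs' \<Rightarrow> Ls ((a + b) # bs')) (Ls [b] * x) = Ls [a + b] * x"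
proof (rule linmap_eqI[of "\<lambda>x. lin _ (Ls [b] * x)"])
  fix t
  show "lin (\<lambda>bs. case bs of [] \<Rightarrow> 0 | b # bs' \<Rightarrow> Ls ((a + b) # bs')) (Ls [b] * Ls t) = Ls [a + b] * Ls t"
    by (simp add: Ls_mult)
qed (intro linmap_comp[OF linmap_lin] linmap_mult_right)+

text \<open>The bar differential of an associative product squares to zero. After peeling off
  \<open>a\<close>, its merges with the heads in \<open>mg (b # as)\<close> give back
  \<open>mg ((a + b) # as)\<close>, by associativity.\<close>

lemma MG_mg: "MG (mg as) = (0 :: 'k::field lmod)"
proof (induction as rule: mg.induct)
  case (1 a b as)
  have "MG (mg (a # b # as) :: 'k lmod) = mg ((a + b) # as)
      - (lin (\<lambda>bs. case bs of [] \<Rightarrow> 0 | b # bs' \<Rightarrow> Ls ((a + b) # bs')) (mg (b # as)) - Ls [a] * MG (mg (b # as)))"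
    by (simp add: linmap_diff MG_Ls_mult)
  also have "lin (\<lambda>bs. case bs of [] \<Rightarrow> 0 | b # bs' \<Rightarrow> Ls ((a + b) # bs')) (mg (b # as)) = (mg ((a + b) # as) :: 'k lmod)"
    by (cases as) (simp_all add: lin_diff head_mult add.assoc)
  finally show ?case by (simp add: 1 del: mg.simps)
qed (simp_all add: linmap_zero)

lemma pm_double [simp]: "pm (2 * n) = 1"
  by (simp add: pm_def)

context
  fixes K :: "'k::field itself"
begin

text \<open>Closed entries of degree 0 behave like inputs: \<open>da\<close> and all Koszul signs
  disappear. The set is stable under cutting and merging lists. The parameter \<open>K\<close> only
  fixes the field over which \<open>dw a = 0\<close> is read.\<close>

definition Z :: "wrd list set" where
  "Z = {as. as \<noteq> [] \<and> (\<forall>a\<in>set as. wval a \<and> wdeg a = 0 \<and> dw a = (0 :: 'k wmod))}"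

lemma Z_da: "as \<in> Z \<Longrightarrow> da as = (0 :: 'k lmod)"
  by (induction as rule: induct_list012) (auto simp: Z_def linmap_zero)

lemma Z_wdegs: "as \<in> Z \<Longrightarrow> wdegs as = 0"
  by (induction as rule: induct_list012) (auto simp: Z_def)

lemma Z_take: "as \<in> Z \<Longrightarrow> 1 \<le> l \<Longrightarrow> take l as \<in> Z"
  and Z_drop: "as \<in> Z \<Longrightarrow> l < length as \<Longrightarrow> drop l as \<in> Z"
  by (auto simp: Z_def dest: in_set_takeD in_set_dropD)

lemma Z_sp: "as \<in> Z \<Longrightarrow>
  sp as = (\<Sum>l\<in>{1..<length as}. sc (pm (int l)) (br (take l as) * br (drop l as) :: 'k wmod))"
  unfolding sp_def by (rule sum.cong) (auto simp: Z_wdegs[OF Z_take])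

lemma Z_DW_br: "as \<in> Z \<Longrightarrow> DW (br as :: 'k wmod) = Br (mg as) + sp as"
  using DW_br[of as, where 'k = 'k] by (auto simp: Z_def[symmetric] Z_da linmap_zero) (auto simp: Z_def)

lemma Z_mgr: "as \<in> Z \<Longrightarrow> 1 \<le> r \<Longrightarrow> r < length as \<Longrightarrow> mgr r as \<in> Z"
  by (auto simp: Z_def mgr_def dw_plus dest!: in_set_takeD in_set_dropD)

lemma Z_mg: "as \<in> Z \<Longrightarrow> (mg as :: 'k lmod) \<in> supp Z"
  unfolding mg_sum by (intro supp_sum supp_sc supp_single Z_mgr) auto

lemma Z_DW_Br: "x \<in> supp Z \<Longrightarrow> DW (Br x :: 'k wmod) = Br (MG x) + SP x"
  by (erule linmap_eq_supp)
    (auto intro: linmap_comp[OF linmap_ops(1) linmap_Br] linmap_plus[OF linmap_comp[OF linmap_Br linmap_ops(3)]]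
      simp: Z_DW_br)

lemma Z_br_mult: "as \<in> Z \<Longrightarrow> DW (br as * y :: 'k wmod) = DW (br as) * y + sc (pm (1 - int (length as))) (br as * DW y)"
proof -
  assume as: "as \<in> Z"
  then have "as \<in> HL (length as) (wxcs as) 0" by (auto simp: HL_def Z_wdegs) (auto simp: Z_def)
  note s = br_HW'[OF this, where 'a = 'k]
  from br_cases[of as, where 'a = 'k]
  consider "br as = (0 :: 'k wmod)" | w where "br as = (W w :: 'k wmod)" "wdeg w = 1 - int (length as)"
  proof (elim disjE exE)
    fix w assume w: "br as = (W w :: 'k wmod)"
    have "w \<in> HW' (wxcs as) (0 + 1 - int (length as))" by (rule supp_W) (use s w in simp)
    with w that(2) show ?thesis by (auto simp: HW'_def HW_def)
  qed (use that in auto)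
  then show ?thesis
  proof cases
    case 2
    show ?thesis unfolding 2
      by (rule linmap_eqI[of "\<lambda>y. DW (W w * y)"])
        (auto simp: W_mult dw_plus 2 intro!: linmap_comp[OF linmap_ops(1)] linmap_plus linmap_mult_right
          linmap_mult_right' linmap_sc_left)
  qed (simp add: linmap_zero)
qed

lemma mgr_take_ge: "1 \<le> r \<Longrightarrow> r \<le> l \<Longrightarrow> Suc l < length as \<Longrightarrow>
    take l (mgr r as) = mgr r (take (Suc l) as) \<and> drop l (mgr r as) = drop (Suc l) as"
  by (auto simp: mgr_def take_Cons' drop_Cons' min_def drop_take Suc_diff_le)

lemma mgr_take_lt: "1 \<le> l \<Longrightarrow> l < r \<Longrightarrow> r < length as \<Longrightarrow>
    take l (mgr r as) = take l as \<and> drop l (mgr r as) = mgr (r - l) (drop l as)"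
  by (auto simp: mgr_def take_Cons' drop_Cons' min_def drop_take)

lemma length_mgr: "1 \<le> r \<Longrightarrow> r < length as \<Longrightarrow> length (mgr r as) = length as - 1"
  by (auto simp: mgr_def)

text \<open>The relations of an \<open>A_\<infinity>\<close> functor. Double merges vanish by
  \<open>MG_mg\<close>, a merge and a cut cancel against the same two operations in the other order,
  and double cuts cancel in pairs by associativity of the product.\<close>

lemma Z_dd:
  assumes as: "as \<in> Z"
  shows "DW (DW (br as)) = (0 :: 'k wmod)"
proof -
  define n where "n = length as"
  define b where "b = (br :: _ \<Rightarrow> 'k wmod)"
  let ?P = "\<lambda>l. take l as" and ?Q = "\<lambda>l. drop l as"
  \<comment> \<open>\<open>A\<close> merges inside the left factor of a cut at \<open>l\<close>,
    \<open>B\<close> inside the right factor, and \<open>S\<close> cuts at both \<open>k\<close> and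
    \<open>l\<close>.\<close>
  define A where "A = (\<lambda>l r. sc (pm (int l + int r - 1)) (b (mgr r (?P l)) * b (?Q l)))"
  define B where "B = (\<lambda>l r. sc (pm (int r - 1)) (b (?P l) * b (mgr r (?Q l))))"
  define S where "S = (\<lambda>l k. sc (pm (int l + int k)) (b (?P k) * b (take (l - k) (?Q k)) * b (?Q l)))"
  have Pb: "DW (b (?P l)) = (\<Sum>r\<in>{1..<l}. sc (pm (int r - 1)) (b (mgr r (?P l))))
      + (\<Sum>k\<in>{1..<l}. sc (pm (int k)) (b (?P k) * b (take (l - k) (?Q k))))" if l: "l \<in> {1..<n}" for l
  proof -
    have z: "?P l \<in> Z" "length (?P l) = l" using l as by (auto simp: n_def intro: Z_take)
    show ?thesis
      unfolding b_def Z_DW_br[OF z(1)] Z_sp[OF z(1)] mg_sum linmap_sum[OF linmap_Br] linmap_sc[OF linmap_Br] z(2)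
      by (intro arg_cong2[of _ _ _ _ "(+)"] sum.cong refl) (auto simp: drop_take min_def)
  qed
  have Qb: "DW (b (?Q l)) = (\<Sum>r\<in>{1..<n - l}. sc (pm (int r - 1)) (b (mgr r (?Q l))))
      + (\<Sum>m\<in>{1..<n - l}. sc (pm (int m)) (b (take m (?Q l)) * b (?Q (l + m))))" if l: "l \<in> {1..<n}" for l
  proof -
    have z: "?Q l \<in> Z" "length (?Q l) = n - l" using l as by (auto simp: n_def intro: Z_drop)
    show ?thesis
      unfolding b_def Z_DW_br[OF z(1)] Z_sp[OF z(1)] mg_sum linmap_sum[OF linmap_Br] linmap_sc[OF linmap_Br] z(2)
      by (intro arg_cong2[of _ _ _ _ "(+)"] sum.cong refl) (auto simp: add.commute)
  qed
  have "DW (sp as) = (\<Sum>l\<in>{1..<n}. sc (pm (int l)) (DW (b (?P l)) * b (?Q l)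
      + sc (pm (1 - int l)) (b (?P l) * DW (b (?Q l)))))"
    unfolding Z_sp[OF as] linmap_sum[OF linmap_ops(1)] linmap_sc[OF linmap_ops(1)] n_def b_def
    by (rule sum.cong) (auto simp: Z_br_mult[OF Z_take[OF as]])
  also have "\<dots> = (\<Sum>l\<in>{1..<n}. (\<Sum>r\<in>{1..<l}. A l r) + (\<Sum>k\<in>{1..<l}. S l k)
      - (\<Sum>r\<in>{1..<n - l}. B l r) - (\<Sum>m\<in>{1..<n - l}. S (l + m) l))"
  proof (rule sum.cong[OF refl])
    fix l assume l: "l \<in> {1..<n}"
    have "sc (pm (int l)) (DW (b (?P l)) * b (?Q l)) = (\<Sum>r\<in>{1..<l}. A l r) + (\<Sum>k\<in>{1..<l}. S l k)"
      unfolding Pb[OF l] A_def S_def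
      by (simp add: distrib_right sum_distrib_right sc_mult_left sc_add sc_sum pm_add pm_diff)
    moreover have "sc (pm (int l)) (sc (pm (1 - int l)) (b (?P l) * DW (b (?Q l))))
      = - (\<Sum>r\<in>{1..<n - l}. B l r) - (\<Sum>m\<in>{1..<n - l}. S (l + m) l)"
      unfolding Qb[OF l] B_def S_def
      by (simp add: distrib_left sum_distrib_left sc_mult_right sc_add sc_sum pm_add pm_diff
          sc_minus_left sc_minus sum_negf mult.assoc add.commute)
        (simp add: right_diff_distrib sum_distrib_left sc_mult_right)
    ultimately show "sc (pm (int l)) (DW (b (?P l)) * b (?Q l) + sc (pm (1 - int l)) (b (?P l) * DW (b (?Q l))))
      = (\<Sum>r\<in>{1..<l}. A l r) + (\<Sum>k\<in>{1..<l}. S l k)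
      - (\<Sum>r\<in>{1..<n - l}. B l r) - (\<Sum>m\<in>{1..<n - l}. S (l + m) l)"
      by (simp only: sc_add) (simp add: algebra_simps)
  qed
  also have "\<dots> = (\<Sum>l\<in>{1..<n}. \<Sum>r\<in>{1..<l}. A l r) - (\<Sum>l\<in>{1..<n}. \<Sum>r\<in>{1..<n - l}. B l r)
      + ((\<Sum>l\<in>{1..<n}. \<Sum>k\<in>{1..<l}. S l k) - (\<Sum>l\<in>{1..<n}. \<Sum>m\<in>{1..<n - l}. S (l + m) l))"
    by (simp add: sum.distrib sum_subtractf)
  also have "(\<Sum>l\<in>{1..<n}. \<Sum>k\<in>{1..<l}. S l k) = (\<Sum>l\<in>{1..<n}. \<Sum>m\<in>{1..<n - l}. S (l + m) l)"
    unfolding sum.Sigma[OF finite_atLeastLessThan ballI[OF finite_atLeastLessThan]]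
    by (rule sum.reindex_bij_witness[where i = "\<lambda>(l, m). (l + m, l)" and j = "\<lambda>(l, k). (k, l - k)"]) auto
  finally have D: "DW (sp as) = (\<Sum>l\<in>{1..<n}. \<Sum>r\<in>{1..<l}. A l r) - (\<Sum>l\<in>{1..<n}. \<Sum>r\<in>{1..<n - l}. B l r)"
    by simp
  have "SP (mg as) = (\<Sum>r\<in>{1..<n}. sc (pm (int r - 1)) (sp (mgr r as)))"
    unfolding mg_sum linmap_sum[OF linmap_ops(4)] linmap_sc[OF linmap_ops(4)] n_def by simp
  also have "\<dots> = (\<Sum>r\<in>{1..<n}. (\<Sum>l\<in>{r..<n - 1}. - A (Suc l) r) + (\<Sum>l\<in>{1..<r}. B l (r - l)))"
  proof (rule sum.cong[OF refl])
    fix r assume r: "r \<in> {1..<n}"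
    then have r': "1 \<le> r" "r < length as" by (auto simp: n_def)
    have "sc (pm (int r - 1)) (sp (mgr r as)) = (\<Sum>l\<in>{1..<n - 1}. sc (pm (int r - 1) * pm (int l))
        (b (take l (mgr r as)) * b (drop l (mgr r as))))"
      unfolding Z_sp[OF Z_mgr[OF as r']] length_mgr[OF r'] sc_sum n_def b_def by simp
    \<comment> \<open>A cut of \<open>mgr r as\<close> at \<open>l \<ge> r\<close> lies behind the
      merged entry and is a cut of \<open>as\<close> at \<open>Suc l\<close>; a cut at
      \<open>l < r\<close> is one of \<open>as\<close> at the same place.\<close>
    also have "{1..<n - 1} = {r..<n - 1} \<union> {1..<r}" using r by auto
    also have "(\<Sum>l\<in>{r..<n - 1} \<union> {1..<r}. sc (pm (int r - 1) * pm (int l))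
        (b (take l (mgr r as)) * b (drop l (mgr r as))))
      = (\<Sum>l\<in>{r..<n - 1}. sc (pm (int r - 1) * pm (int l)) (b (take l (mgr r as)) * b (drop l (mgr r as))))
      + (\<Sum>l\<in>{1..<r}. sc (pm (int r - 1) * pm (int l)) (b (take l (mgr r as)) * b (drop l (mgr r as))))"
      by (rule sum.union_disjoint) auto
    also have "(\<Sum>l\<in>{r..<n - 1}. sc (pm (int r - 1) * pm (int l)) (b (take l (mgr r as)) * b (drop l (mgr r as))))
      = (\<Sum>l\<in>{r..<n - 1}. - A (Suc l) r)"
    proof (rule sum.cong[OF refl])
      fix l assume "l \<in> {r..<n - 1}"
      then have "r \<le> l" "Suc l < length as" by (auto simp: n_def)
      then show "sc (pm (int r - 1) * pm (int l)) (b (take l (mgr r as)) * b (drop l (mgr r as))) = - A (Suc l) r"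
        using mgr_take_ge[of r l as] r' by (simp add: A_def n_def pm_add pm_diff sc_minus_left[symmetric] mult.commute)
    qed
    also have "(\<Sum>l\<in>{1..<r}. sc (pm (int r - 1) * pm (int l)) (b (take l (mgr r as)) * b (drop l (mgr r as))))
      = (\<Sum>l\<in>{1..<r}. B l (r - l))"
    proof (rule sum.cong[OF refl])
      fix l assume "l \<in> {1..<r}"
      then show "sc (pm (int r - 1) * pm (int l)) (b (take l (mgr r as)) * b (drop l (mgr r as))) = B l (r - l)"
        using mgr_take_lt[of l r as] r' by (simp add: B_def pm_diff of_nat_diff mult_ac)
    qed
    finally show "sc (pm (int r - 1)) (sp (mgr r as)) = (\<Sum>l\<in>{r..<n - 1}. - A (Suc l) r) + (\<Sum>l\<in>{1..<r}. B l (r - l))" .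
  qed
  also have "\<dots> = (\<Sum>r\<in>{1..<n}. \<Sum>l\<in>{1..<r}. B l (r - l)) - (\<Sum>r\<in>{1..<n}. \<Sum>l\<in>{r..<n - 1}. A (Suc l) r)"
    by (simp add: sum.distrib sum_negf sum_subtractf)
  also have "(\<Sum>r\<in>{1..<n}. \<Sum>l\<in>{1..<r}. B l (r - l)) = (\<Sum>l\<in>{1..<n}. \<Sum>r\<in>{1..<n - l}. B l r)"
    unfolding sum.Sigma[OF finite_atLeastLessThan ballI[OF finite_atLeastLessThan]]
    by (rule sum.reindex_bij_witness[where i = "\<lambda>(l, r). (l + r, l)" and j = "\<lambda>(r, l). (l, r - l)"]) auto
  also have "(\<Sum>r\<in>{1..<n}. \<Sum>l\<in>{r..<n - 1}. A (Suc l) r) = (\<Sum>l\<in>{1..<n}. \<Sum>r\<in>{1..<l}. A l r)"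
    unfolding sum.Sigma[OF finite_atLeastLessThan ballI[OF finite_atLeastLessThan]]
    by (rule sum.reindex_bij_witness[where i = "\<lambda>(l, r). (r, l - 1)" and j = "\<lambda>(r, l). (Suc l, r)"]) auto
  finally have "SP (mg as) + DW (sp as) = (0 :: 'k wmod)" unfolding D by simp
  then show ?thesis
    unfolding Z_DW_br[OF as] linmap_add[OF linmap_ops(1)] Z_DW_Br[OF Z_mg[OF as]] MG_mg
    by (simp add: linmap_zero)
qed

end

section \<open>The ideal of relations\<close>

lemma wu_free_simps [simp]: "piece wu_free N p = supp (tset gens gar gdeg N p)"
  "pcomp wu_free = free_comp gdeg" "dif wu_free = wu.D" "opid wu_free = mono Leaf"
  by (auto simp: wu_free_def free_operad_def supp_def tset_def)

lemma ideal_sc: "x \<in> wu_ideal \<Longrightarrow> sc c x \<in> wu_ideal"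
  using wu_ideal_scl[of x c] by (simp add: free_scl_eq_sc)

lemma ideal_sum: "(\<And>i. i \<in> I \<Longrightarrow> f i \<in> wu_ideal) \<Longrightarrow> sum f I \<in> wu_ideal"
  by (induction I rule: infinite_finite_induct) (auto intro: wu_ideal_zero wu_ideal_add)

lemma ideal_comp_left: "x \<in> wu_ideal \<Longrightarrow> x \<in> supp (tset gens gar gdeg M p) \<Longrightarrow>
    y \<in> supp (tset gens gar gdeg N q) \<Longrightarrow> 1 \<le> i \<Longrightarrow> i \<le> M \<Longrightarrow> free_comp gdeg i x y \<in> wu_ideal"
  using operad_ideal.comp_left[of x wu_free wu_relations M p y N q i] by (simp add: wu_ideal_def)

lemma ideal_comp_right: "x \<in> wu_ideal \<Longrightarrow> x \<in> supp (tset gens gar gdeg N q) \<Longrightarrow>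
    y \<in> supp (tset gens gar gdeg M p) \<Longrightarrow> 1 \<le> i \<Longrightarrow> i \<le> M \<Longrightarrow> free_comp gdeg i y x \<in> wu_ideal"
  using operad_ideal.comp_right[of x wu_free wu_relations N q y M p i] by (simp add: wu_ideal_def)

abbreviation "wft \<equiv> {t. wf_tree gens gar t}"

text \<open>
  The relations identify trees or kill them; \<open>eqv\<close> and \<open>nul\<close> are the closures of these two kinds
  of relations under contexts and substitution.
\<close>

inductive eqv :: "gen tree \<Rightarrow> gen tree \<Rightarrow> bool" where
  refl: "eqv t t"
| sym: "eqv t t' \<Longrightarrow> eqv t' t"
| trans: "eqv t t' \<Longrightarrow> eqv t' t'' \<Longrightarrow> eqv t t''"
| assoc: "eqv (Node GenM [Node GenM [a, b], c]) (Node GenM [a, Node GenM [b, c]])"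
| idem: "eqv (Node GenM [Node GenJ [], Node GenJ []]) (Node GenJ [])"
| one: "eqv (Node (GenP 1 {1}) []) (Node GenJ [])"
| ident: "eqv (Node (GenP 1 {}) [a]) a"
| ctx: "eqv t t' \<Longrightarrow> eqv (Node g (as @ t # bs)) (Node g (as @ t' # bs))"

inductive nul :: "gen tree \<Rightarrow> bool" where
  base: "2 \<le> n \<Longrightarrow> T = {} \<or> T = {1..n} \<Longrightarrow> nul (Node (GenP n T) ts)"
| ctx: "nul t \<Longrightarrow> nul (Node g (as @ t # bs))"

lemma eqv_inv: "eqv t t' \<Longrightarrow> leaves t = leaves t' \<and> tdeg gdeg t = tdeg gdeg t' \<and>
    (wf_tree gens gar t \<longleftrightarrow> wf_tree gens gar t')"
  by (induction rule: eqv.induct) (auto simp: gens_def)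

text \<open>The sign of a grafting depends on this number. Equivalent trees receive the same sign,
  so composition maps a difference of equivalent trees to a multiple of such a difference.\<close>

lemma eqv_deg_after: "eqv t t' \<Longrightarrow> 1 \<le> i \<Longrightarrow> i \<le> leaves t \<Longrightarrow> deg_after gdeg i t = deg_after gdeg i t'"
proof (induction arbitrary: i rule: eqv.induct)
  case (sym t t')
  then show ?case using eqv_inv by metis
next
  case (trans t t' t'')
  then show ?case using eqv_inv by metis
next
  case (ctx t t' g as bs)
  then show ?case using eqv_inv[OF ctx(1)] by (auto simp: deg_after_list_append)
qed auto

lemma eqv_graft_left: "eqv t t' \<Longrightarrow> 1 \<le> i \<Longrightarrow> i \<le> leaves t \<Longrightarrow> eqv (graft i t s) (graft i t' s)"
proof (induction arbitrary: i rule: eqv.induct)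
  case (sym t t')
  then show ?case using eqv_inv eqv.sym by metis
next
  case (trans t t' t'')
  then show ?case using eqv_inv eqv.trans by metis
next
  case (ctx t t' g as bs)
  then show ?case using eqv_inv[OF ctx(1)] by (auto simp: graft_list_append intro: eqv.ctx)
qed (auto intro: eqv.intros eqv.ident[unfolded One_nat_def])

lemma eqv_graft_right: "eqv s s' \<Longrightarrow> 1 \<le> i \<Longrightarrow> i \<le> leaves t \<Longrightarrow> eqv (graft i t s) (graft i t s')"
proof (induction t arbitrary: i)
  case (Node g ts)
  from wu.leaf_position[of i ts] Node.prems obtain as t bs j where
    ts: "ts = as @ t # bs" and i: "i = lvs as + j" and j: "1 \<le> j" "j \<le> leaves t" by auto
  have "eqv (graft j t s) (graft j t s')" using Node.IH[of t j] Node.prems j by (simp add: ts)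
  then show ?case using j by (simp add: ts i graft_list_append eqv.ctx)
qed simp

lemma nul_graft_left: "nul t \<Longrightarrow> 1 \<le> i \<Longrightarrow> nul (graft i t s)"
proof (induction arbitrary: i rule: nul.induct)
  case (ctx t g as bs)
  show ?case
  proof (cases "i \<le> lvs as")
    case True
    then show ?thesis using ctx by (simp add: graft_list_append nul.ctx)
  next
    case False
    then show ?thesis using ctx by (cases "i - lvs as \<le> leaves t") (simp_all add: graft_list_append nul.ctx)
  qed
qed (simp add: nul.base)

lemma nul_graft_right: "nul s \<Longrightarrow> 1 \<le> i \<Longrightarrow> i \<le> leaves t \<Longrightarrow> nul (graft i t s)"
proof (induction t arbitrary: i)
  case (Node g ts)
  from wu.leaf_position[of i ts] Node.prems obtain as t bs j where
    ts: "ts = as @ t # bs" and i: "i = lvs as + j" and j: "1 \<le> j" "j \<le> leaves t" by auto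
  have "nul (graft j t s)" using Node.IH[of t j] Node.prems j by (simp add: ts)
  then show ?case using j by (simp add: ts i graft_list_append nul.ctx)
qed simp

text \<open>The composite of two trees is a tree up to sign. Hence the ideal is the linear span of
  these elements, see \<open>ideal_rels\<close> and \<open>rels_ideal\<close>, and no compositions
  of sums have to be handled.\<close>

definition rels :: "(gen, 'k::field) free set" where
  "rels = {mono t - mono t' | t t'. eqv t t' \<and> wf_tree gens gar t \<and> wf_tree gens gar t'}
    \<union> {mono t | t. nul t \<and> wf_tree gens gar t}"

lemma rels_eqv: "eqv t t' \<Longrightarrow> wf_tree gens gar t \<Longrightarrow> mono t - mono t' \<in> rels"
  unfolding rels_def using eqv_inv by blast

lemma rels_nul: "nul t \<Longrightarrow> wf_tree gens gar t \<Longrightarrow> mono t \<in> rels"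
  unfolding rels_def by blast

lemma comp_rels_left:
  fixes x :: "(gen, 'k::field) free"
  assumes x: "x \<in> lspan rels" and y: "y \<in> supp wft"
  shows "free_comp gdeg i x y \<in> lspan rels"
proof (rule lspan_map[OF x linmap_comp_left])
  fix b :: "(gen, 'k) free" assume b: "b \<in> rels"
  show "free_comp gdeg i b y \<in> lspan rels"
  proof (rule lspan_linmap[OF linmap_comp_right])
    fix s assume "s \<in> keys y"
    then have s: "wf_tree gens gar s" using y by (auto simp: supp_def)
    from b consider t t' where "b = mono t - mono t'" "eqv t t'" "wf_tree gens gar t"
      | t where "b = mono t" "nul t" "wf_tree gens gar t" by (auto simp: rels_def)
    then show "free_comp gdeg i b (mono s) \<in> lspan rels"
    proof cases
      case 1
      show ?thesis
      proof (cases "1 \<le> i \<and> i \<le> leaves t")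
        case True
        have "mono (graft i t s) - mono (graft i t' s) \<in> (rels :: (gen, 'k) free set)"
          using 1 s True by (intro rels_eqv eqv_graft_left wf_graft) auto
        then have "sc (pm (tdeg gdeg s * deg_after gdeg i t)) (mono (graft i t s) - mono (graft i t' s))
            \<in> lspan (rels :: (gen, 'k) free set)" by (intro lspan.scale lspan.base)
        then show ?thesis
          using 1 True eqv_inv[OF 1(2)] eqv_deg_after[OF 1(2), of i]
          by (simp add: linmap_diff[OF linmap_comp_left] comp_mono_mono sc_diff)
      next
        case False
        then show ?thesis using 1 eqv_inv[OF 1(2)]
          by (simp add: linmap_diff[OF linmap_comp_left] comp_mono_out lspan.zero)
      qed
    next
      case 2
      show ?thesis
      proof (cases "1 \<le> i \<and> i \<le> leaves t")
        case True
        have "mono (graft i t s) \<in> (rels :: (gen, 'k) free set)"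
          using 2 s True by (intro rels_nul nul_graft_left wf_graft) auto
        then show ?thesis using 2 True lspan.scale[OF lspan.base]
          by (simp add: comp_mono_mono del: sc_single)
      qed (use 2 in \<open>simp add: comp_mono_out lspan.zero\<close>)
    qed
  qed
qed

lemma comp_rels_right:
  fixes x :: "(gen, 'k::field) free"
  assumes x: "x \<in> lspan rels" and y: "y \<in> supp wft"
  shows "free_comp gdeg i y x \<in> lspan rels"
proof (rule lspan_map[OF x linmap_comp_right])
  fix b :: "(gen, 'k) free" assume b: "b \<in> rels"
  show "free_comp gdeg i y b \<in> lspan rels"
  proof (rule lspan_linmap[OF linmap_comp_left])
    fix s assume "s \<in> keys y"
    then have s: "wf_tree gens gar s" using y by (auto simp: supp_def)
    from b consider t t' where "b = mono t - mono t'" "eqv t t'" "wf_tree gens gar t"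
      | t where "b = mono t" "nul t" "wf_tree gens gar t" by (auto simp: rels_def)
    then show "free_comp gdeg i (mono s) b \<in> lspan rels"
    proof cases
      case 1
      show ?thesis
      proof (cases "1 \<le> i \<and> i \<le> leaves s")
        case True
        have "mono (graft i s t) - mono (graft i s t') \<in> (rels :: (gen, 'k) free set)"
          using 1 s True by (intro rels_eqv eqv_graft_right wf_graft) auto
        then have "sc (pm (tdeg gdeg t * deg_after gdeg i s)) (mono (graft i s t) - mono (graft i s t'))
            \<in> lspan (rels :: (gen, 'k) free set)" by (intro lspan.scale lspan.base)
        then show ?thesis
          using 1 True eqv_inv[OF 1(2)]
          by (simp add: linmap_diff[OF linmap_comp_right] comp_mono_mono sc_diff)
      next
        case False
        then show ?thesis using 1
          by (simp add: linmap_diff[OF linmap_comp_right] comp_mono_out lspan.zero)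
      qed
    next
      case 2
      show ?thesis
      proof (cases "1 \<le> i \<and> i \<le> leaves s")
        case True
        have "mono (graft i s t) \<in> (rels :: (gen, 'k) free set)"
          using 2 s True by (intro rels_nul nul_graft_right wf_graft) auto
        then show ?thesis using 2 True lspan.scale[OF lspan.base]
          by (simp add: comp_mono_mono del: sc_single)
      qed (use 2 in \<open>simp add: comp_mono_out lspan.zero\<close>)
    qed
  qed
qed

lemma supp_wft: "x \<in> supp (tset gens gar gdeg N p) \<Longrightarrow> x \<in> supp wft"
  by (erule supp_mono) (auto simp: tset_def)

lemma wu_relations_rels: "(wu_relations :: (gen, 'k::field) free set) \<subseteq> rels"
proof -
  have c: "corolla GenM = Node GenM [Leaf, Leaf]" "corolla GenJ = Node GenJ []"
    "corolla (GenP 1 {1}) = Node (GenP 1 {1}) []" "corolla (GenP 1 {}) = Node (GenP 1 {}) [Leaf]"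
    by (simp_all add: corolla_def numeral_2_eq_2)
  have g: "GenP n T \<in> gens" if "2 \<le> n" "T = {} \<or> T = {1..n}" for n T
    using that by (intro GenP_gens) auto
  have p: "GenP 1 {1} \<in> gens" "GenP 1 {} \<in> gens" by (auto intro: GenP_gens)
  show ?thesis
    unfolding wu_relations_def c
    using p by (auto intro!: rels_eqv eqv.assoc eqv.idem eqv.one[unfolded One_nat_def] eqv.ident[unfolded One_nat_def])
      (auto simp: corolla_def intro!: rels_nul nul.base g)
qed

lemma ideal_rels: "x \<in> wu_ideal \<Longrightarrow> x \<in> lspan rels"
  unfolding wu_ideal_def
proof (induction rule: operad_ideal.induct)
  case (gen x)
  then show ?case using wu_relations_rels by (auto intro: lspan.base)
next
  case (scl x c)
  then show ?case by (simp add: free_scl_eq_sc lspan.scale)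
qed (auto intro: lspan.intros comp_rels_left comp_rels_right supp_wft)

section \<open>The relations, inside arbitrary contexts, belong to the ideal\<close>

lemma supp_node_Leaf:
  assumes "g \<in> gens" "length as + length bs + 1 = gar g" "\<forall>t\<in>set (as @ bs). wf_tree gens gar t"
  shows "mono (Node g (as @ Leaf # bs)) \<in> supp (tset gens gar gdeg (lvs as + 1 + lvs bs) (gdeg g + tdegs gdeg as + tdegs gdeg bs))"
  using assms by (intro supp_single) (auto simp: tset_def)

lemma ideal_node:
  assumes "x \<in> wu_ideal" "x \<in> supp (tset gens gar gdeg N p)"
    "g \<in> gens" "length as + length bs + 1 = gar g" "\<forall>t\<in>set (as @ bs). wf_tree gens gar t"
  shows "node g as bs x \<in> wu_ideal"
proof -
  have "free_comp gdeg (lvs as + 1) (mono (Node g (as @ Leaf # bs))) x \<in> wu_ideal"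
    using assms by (intro ideal_comp_right[OF assms(1,2) supp_node_Leaf]) auto
  then have "sc (pm (p * tdegs gdeg bs)) (free_comp gdeg (lvs as + 1) (mono (Node g (as @ Leaf # bs))) x) \<in> wu_ideal"
    by (rule ideal_sc)
  then show ?thesis
    using comp_node_mid_right[OF _ _ assms(2), of 1 Leaf as g bs] comp_opid_left[OF assms(2)] by simp
qed

lemma ideal_plug:
  assumes "x \<in> wu_ideal" "x \<in> supp (tset gens gar gdeg N p)" "1 \<le> k" "k + length ts \<le> N + 1"
    "\<forall>t\<in>set ts. wf_tree gens gar t"
  shows "plug gdeg k x ts \<in> wu_ideal"
  using assms
proof (induction ts arbitrary: k x N p)
  case (Cons t ts)
  have t: "mono t \<in> supp (tset gens gar gdeg (leaves t) (tdeg gdeg t))"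
    using Cons.prems by (intro supp_single) (simp add: tset_def)
  have "free_comp gdeg k x (mono t) \<in> supp (tset gens gar gdeg (N + leaves t - 1) (p + tdeg gdeg t))"
    using comp_supp[OF Cons.prems(2) t, of k] Cons.prems by simp
  moreover have "free_comp gdeg k x (mono t) \<in> wu_ideal"
    using Cons.prems by (intro ideal_comp_left[OF _ _ t]) auto
  ultimately show ?case using Cons.prems by (auto intro!: Cons.IH)
qed simp

lemma relation_in: "x \<in> wu_relations \<Longrightarrow> x \<in> wu_ideal"
  unfolding wu_ideal_def by (rule operad_ideal.gen)

lemma eqv_ideal: "eqv t t' \<Longrightarrow> wf_tree gens gar t \<Longrightarrow> (mono t - mono t' :: (gen, 'k::field) free) \<in> wu_ideal"
proof (induction rule: eqv.induct)
  case (refl t)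
  then show ?case by (simp add: wu_ideal_zero)
next
  case (sym t t')
  then have "- (mono t - mono t' :: (gen, 'k) free) \<in> wu_ideal"
    using eqv_inv by (intro wu_ideal_uminus) auto
  then show ?case by simp
next
  case (trans t t' t'')
  then have "(mono t - mono t') + (mono t' - mono t'' :: (gen, 'k) free) \<in> wu_ideal"
    using eqv_inv by (intro wu_ideal_add) auto
  then show ?case by simp
next
  case (assoc a b c)
  \<comment> \<open>The relation is given for corollas; plugging \<open>a\<close>, \<open>b\<close>,
    \<open>c\<close> into its three leaves yields it for arbitrary trees, without signs since
    \<open>m\<close> has degree 0.\<close>
  let ?t = "Node GenM [corolla GenM, Leaf]" and ?t' = "Node GenM [Leaf, corolla GenM]"
  let ?x = "mono ?t - mono ?t' :: (gen, 'k) free"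
  have wf: "\<forall>t\<in>set [a, b, c]. wf_tree gens gar t" using assoc by simp
  have x: "?x \<in> supp (tset gens gar gdeg 3 0)"
    by (intro supp_diff supp_single) (auto simp: tset_def corolla_def numeral_2_eq_2)
  have "?x \<in> wu_ideal" by (rule relation_in) (simp add: wu_relations_def)
  from ideal_plug[OF this x, of 1 "[a, b, c]"] wf
  have 1: "plug gdeg 1 ?x [a, b, c] \<in> wu_ideal" by simp
  have cM: "(mono (corolla GenM) :: (gen, 'k) free) \<in> supp (tset gens gar gdeg 2 0)"
    using corolla_supp[OF GenM_gens] by simp
  have pc: "plug gdeg (Suc 0) (mono (corolla GenM)) [u, v] = (mono (Node GenM [u, v]) :: (gen, 'k) free)" for u v
    unfolding corolla_def by (intro plug_corolla) simp
  have tc: "tdeg gdeg (corolla GenM) = 0" by (simp add: corolla_def sum_list_replicate)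
  have "plug gdeg 1 (mono ?t) ([a, b] @ [c]) = (mono (Node GenM [Node GenM [a, b], c]) :: (gen, 'k) free)"
    unfolding plug_append
    using plug_node_mid[OF cM, of 1 "[a, b]" "[]" GenM "[Leaf]"] wf
      plug_leaves[of "[c]" 1 gdeg "[Node GenM [a, b]]" GenM "[]", where 'k = 'k]
    by (simp add: pc add.commute del: plug.simps)
  moreover have "plug gdeg 1 (mono ?t') ([a] @ [b, c]) = (mono (Node GenM [a, Node GenM [b, c]]) :: (gen, 'k) free)"
    unfolding plug_append
    using plug_node_mid[OF cM, of 1 "[b, c]" "[a]" GenM "[]"] wf
      plug_leaves[of "[a]" 1 gdeg "[]" GenM "[corolla GenM]", where 'k = 'k]
    by (simp add: pc add.commute tc del: plug.simps)
  ultimately show ?case using 1 by (simp add: linmap_diff[OF linmap_plug] del: plug.simps)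
next
  case idem
  show ?case by (rule relation_in) (simp add: wu_relations_def corolla_def)
next
  case one
  show ?case by (rule relation_in) (simp add: wu_relations_def corolla_def)
next
  case (ident a)
  let ?x = "mono (corolla (GenP 1 {})) - mono Leaf :: (gen, 'k) free"
  have "?x \<in> supp (tset gens gar gdeg 1 0)"
    by (intro supp_diff supp_single) (auto simp: tset_def corolla_def gens_def)
  moreover have "?x \<in> wu_ideal" by (rule relation_in) (simp add: wu_relations_def)
  ultimately have "plug gdeg 1 ?x [a] \<in> wu_ideal" using ident by (intro ideal_plug) auto
  moreover have "plug gdeg (Suc 0) (mono (Node (GenP 1 {}) (replicate 1 Leaf))) [a] = (mono (Node (GenP 1 {}) [a]) :: (gen, 'k) free)"
    by (rule plug_corolla) simp
  ultimately show ?case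
    by (simp add: linmap_diff[OF linmap_comp_left] corolla_def comp_mono_mono)
next
  case (ctx t t' g as bs)
  have wf: "wf_tree gens gar t" "wf_tree gens gar t'" using ctx eqv_inv[OF ctx(1)] by auto
  have "(mono t - mono t' :: (gen, 'k) free) \<in> supp (tset gens gar gdeg (leaves t) (tdeg gdeg t))"
    using wf eqv_inv[OF ctx(1)] by (intro supp_diff supp_single) (auto simp: tset_def)
  then have "node g as bs (mono t - mono t' :: (gen, 'k) free) \<in> wu_ideal"
    using ctx wf by (intro ideal_node) auto
  then show ?case by (simp add: linmap_diff[OF linmap_node])
qed

lemma nul_ideal: "nul t \<Longrightarrow> wf_tree gens gar t \<Longrightarrow> (mono t :: (gen, 'k::field) free) \<in> wu_ideal"
proof (induction rule: nul.induct)
  case (base n T ts)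
  have "(mono (corolla (GenP n T)) :: (gen, 'k) free) \<in> wu_ideal"
    using base by (intro relation_in) (auto simp: wu_relations_def)
  moreover have "(mono (corolla (GenP n T)) :: (gen, 'k) free) \<in> supp (tset gens gar gdeg (gar (GenP n T)) (gdeg (GenP n T)))"
    using base by (intro corolla_supp) auto
  ultimately have "plug gdeg 1 (mono (corolla (GenP n T)) :: (gen, 'k) free) ts \<in> wu_ideal"
    using base by (intro ideal_plug) auto
  moreover have "plug gdeg (Suc 0) (mono (corolla (GenP n T))) ts = (mono (Node (GenP n T) ts) :: (gen, 'k) free)"
    unfolding corolla_def using base by (intro plug_corolla) simp
  ultimately show ?case by simp
next
  case (ctx t g as bs)
  have "(mono t :: (gen, 'k) free) \<in> supp (tset gens gar gdeg (leaves t) (tdeg gdeg t))"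
    using ctx by (intro supp_single) (auto simp: tset_def)
  then have "node g as bs (mono t :: (gen, 'k) free) \<in> wu_ideal"
    using ctx by (intro ideal_node) auto
  then show ?case by simp
qed

text \<open>A section of the normal form, with products nested to the right. No tree stands for the
  empty word, so \<open>tr 0\<close> is a junk value.\<close>

fun trl :: "letter \<Rightarrow> gen tree" and tr :: "wrd \<Rightarrow> gen tree" where
  "trl LX = Leaf"
| "trl (LP as) = Node (GenP (length as) {i. 1 \<le> i \<and> i \<le> length as \<and> as ! (i - 1) = 0})
    (map tr (filter (\<lambda>a. a \<noteq> 0) as))"
| "tr (End b) = Node GenJ []"
| "tr (Gap b l w) =
    (let x = (if w = 0 then trl l else Node GenM [trl l, tr w])
     in if b then Node GenM [Node GenJ [], x] else x)"

lemma mask_of_list: "mask (length as) {i. 1 \<le> i \<and> i \<le> length as \<and> as ! (i - 1) = 0} = map (\<lambda>a. a = 0) as"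
  by (rule nth_equalityI) (auto simp: mask_def)

lemma fil_filter: "fil (map (\<lambda>a. a = 0) as) (filter (\<lambda>a. a \<noteq> 0) as) = as"
  by (induction as) auto

lemma slots_of_list: "slots (map (\<lambda>a. a = 0) as) = length (filter (\<lambda>a. a \<noteq> 0) as)"
  by (induction as) auto

lemma tr_props:
  "lval l \<Longrightarrow> wf_tree gens gar (trl l) \<and> nf (trl l) = (W (lw l) :: 'k::field wmod)"
  "wval w \<Longrightarrow> w \<noteq> 0 \<Longrightarrow> wf_tree gens gar (tr w) \<and> nf (tr w) = (W w :: 'k wmod)"
proof (induction l and w rule: trl_tr.induct)
  case (2 as)
  let ?T = "{i. 1 \<le> i \<and> i \<le> length as \<and> as ! (i - 1) = 0}" and ?ws = "filter (\<lambda>a. a \<noteq> 0) as"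
  have T: "?T \<subseteq> {1..length as}" by auto
  have n: "1 \<le> length as" using 2 mixed_length[of as] by simp
  have IH: "\<forall>a\<in>set ?ws. wf_tree gens gar (tr a) \<and> nf (tr a) = (W a :: 'k wmod)"
    using 2 by auto
  have m: "map nf (map tr ?ws) = map (W :: _ \<Rightarrow> 'k wmod) ?ws" using IH by simp
  have "nf (trl (LP as)) = (Br (fl (map (\<lambda>a. a = 0) as) (map W ?ws)) :: 'k wmod)"
    unfolding trl.simps nf.simps nfop.simps mask_of_list m ..
  also have "\<dots> = W (lw (LP as))"
    unfolding fl_W[OF slots_of_list] using 2 by (simp add: fil_filter br_mixed)
  finally have "nf (trl (LP as)) = (W (lw (LP as)) :: 'k wmod)" .
  moreover have "length ?ws = gar (GenP (length as) ?T)"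
    unfolding gar_GenP[OF T] mask_of_list slots_of_list ..
  ultimately show ?case
    using IH GenP_gens[OF n T] by (simp del: gar.simps nf.simps)
next
  case (4 b l w)
  have l: "wf_tree gens gar (trl l)" "nf (trl l) = (W (lw l) :: 'k wmod)" using 4 by auto
  have w: "wf_tree gens gar (tr w) \<and> nf (tr w) = (W w :: 'k wmod)" if "w \<noteq> 0"
    using 4 that by auto
  show ?case using l w by (auto simp: W_mult Let_def)
qed (auto simp: zero_wrd_def)

lemma tr_Gap_flag: "eqv (Node GenM [Node GenJ [], tr w]) (tr (J + w))"
proof (cases w)
  case (End b)
  then show ?thesis by (simp add: eqv.idem)
next
  case (Gap b l v)
  show ?thesis
  proof (cases b)
    case False
    then show ?thesis using Gap by (simp add: Let_def eqv.refl)
  next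
    case True
    let ?x = "if v = 0 then trl l else Node GenM [trl l, tr v]"
    have "eqv (Node GenM [Node GenJ [], Node GenM [Node GenJ [], ?x]])
        (Node GenM [Node GenM [Node GenJ [], Node GenJ []], ?x])"
      by (intro eqv.sym[OF eqv.assoc])
    also have "eqv (Node GenM [Node GenM [Node GenJ [], Node GenJ []], ?x]) (Node GenM [Node GenJ [], ?x])"
      using eqv.ctx[OF eqv.idem, of GenM "[]" "[?x]"] by simp
    finally (eqv.trans) show ?thesis using Gap True by (simp add: Let_def)
  qed
qed

lemma tr_plus: "v \<noteq> 0 \<Longrightarrow> w \<noteq> 0 \<Longrightarrow> eqv (Node GenM [tr v, tr w]) (tr (v + w))"
proof (induction v w rule: plus_wrd.induct)
  case (1 a w)
  then show ?case using tr_Gap_flag[of w] by (simp add: zero_wrd_def)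
next
  case (2 a l v w)
  let ?j = "Node GenJ []"
  have core: "eqv (Node GenM [if v = 0 then trl l else Node GenM [trl l, tr v], tr w]) (Node GenM [trl l, tr (v + w)])"
  proof (cases "v = 0")
    case True
    then show ?thesis by (simp add: eqv.refl)
  next
    case False
    have "eqv (Node GenM [Node GenM [trl l, tr v], tr w]) (Node GenM [trl l, Node GenM [tr v, tr w]])"
      by (rule eqv.assoc)
    also have "eqv (Node GenM [trl l, Node GenM [tr v, tr w]]) (Node GenM [trl l, tr (v + w)])"
      using eqv.ctx[OF 2(1)[OF False 2(3)], of GenM "[trl l]" "[]"] by simp
    finally (eqv.trans) show ?thesis using False by simp
  qed
  have vw: "v + w \<noteq> 0" using 2 by simp
  show ?case
  proof (cases a)
    case False
    then show ?thesis using core 2(3) by (simp add: Let_def)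
  next
    case True
    let ?x = "if v = 0 then trl l else Node GenM [trl l, tr v]"
    have "eqv (Node GenM [Node GenM [?j, ?x], tr w]) (Node GenM [?j, Node GenM [?x, tr w]])"
      by (rule eqv.assoc)
    also have "eqv (Node GenM [?j, Node GenM [?x, tr w]]) (Node GenM [?j, Node GenM [trl l, tr (v + w)]])"
      using eqv.ctx[OF core, of GenM "[?j]" "[]"] by simp
    finally (eqv.trans) show ?thesis using True 2(3) by (simp add: Let_def)
  qed
qed

lemma eqv_list: "list_all2 eqv ts us \<Longrightarrow> eqv (Node g (as @ ts)) (Node g (as @ us))"
proof (induction arbitrary: as rule: list_all2_induct)
  case Nil
  show ?case by (simp add: eqv.refl)
next
  case (Cons t ts u us)
  have "eqv (Node g (as @ t # ts)) (Node g (as @ u # ts))" by (rule eqv.ctx[OF Cons(1)])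
  moreover have "eqv (Node g ((as @ [u]) @ ts)) (Node g ((as @ [u]) @ us))" by (rule Cons.IH)
  ultimately show ?case using eqv.trans by simp
qed

lemma W_inj: "(W v :: 'k::field wmod) = W w \<longleftrightarrow> v = w"
  by (metis keys_single one_neq_zero singleton_inject)

lemma W_neq_0: "(W v :: 'k::field wmod) \<noteq> 0"
  by (metis keys_single keys_zero empty_not_insert one_neq_zero)

lemma mask_inj: "T \<subseteq> {1..n} \<Longrightarrow> T' \<subseteq> {1..n} \<Longrightarrow> mask n T = mask n T' \<Longrightarrow> T = T'"
proof -
  assume T: "T \<subseteq> {1..n}" "T' \<subseteq> {1..n}" and m: "mask n T = mask n T'"
  have "Suc i \<in> T \<longleftrightarrow> Suc i \<in> T'" if "i < n" for i
    using arg_cong[OF m, of "\<lambda>l. l ! i"] that by (simp add: mask_def)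
  then have "i \<in> T \<longleftrightarrow> i \<in> T'" if "i \<in> {1..n}" for i
    using that by (cases i) auto
  then show "T = T'" using T by blast
qed

text \<open>Words filled into the slots are nonempty, so the zeros of the result are exactly the
  masked positions: a bracket determines \<open>T\<close> and its arguments.\<close>

lemma fil_determines:
  "slots m = length ws \<Longrightarrow> 0 \<notin> set ws \<Longrightarrow> m = map (\<lambda>a. a = 0) (fil m ws) \<and> ws = filter (\<lambda>a. a \<noteq> 0) (fil m ws)"
  by (induction m ws rule: fil.induct) auto

text \<open>Completeness of the rewriting. By induction the children may be replaced by the trees
  \<open>tr\<close> of their normal forms, after which only the root has to be rewritten, according
  to its generator.\<close>

lemma tree_normal_form:
  "wf_tree gens gar t \<Longrightarrow>
    (nf t = (0 :: 'k::field wmod) \<longrightarrow> (\<exists>t'. eqv t t' \<and> nul t')) \<and>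
    (\<forall>w. nf t = (W w :: 'k wmod) \<longrightarrow> eqv t (tr w))"
proof (induction t)
  case Leaf
  have "tr (lw LX) = Leaf" by (simp add: zero_wrd_def[symmetric])
  then show ?case by (auto simp: W_inj W_neq_0 eqv.refl)
next
  case (Node g ts)
  then have wf: "g \<in> gens" "length ts = gar g" "\<forall>t\<in>set ts. wf_tree gens gar t" by auto
  have IH: "nf t = (0 :: 'k wmod) \<Longrightarrow> \<exists>t'. eqv t t' \<and> nul t'" "nf t = (W w :: 'k wmod) \<Longrightarrow> eqv t (tr w)"
    if "t \<in> set ts" for t w
    using Node.IH[OF that] wf(3) that by auto
  from nf_list_cases[of ts, where 'k = 'k] nf_cases[where 'k = 'k] wf(3)
  consider "(0 :: 'k wmod) \<in> set (map nf ts)"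
    | ws where "map nf ts = map (W :: _ \<Rightarrow> 'k wmod) ws" "\<forall>w\<in>set ws. wval w \<and> w \<noteq> 0"
    by blast
  then show ?case
  proof cases
    case 1
    then obtain t where t: "t \<in> set ts" "nf t = (0 :: 'k wmod)" by auto
    obtain as bs where ts: "ts = as @ t # bs" using t(1) by (auto dest: split_list)
    obtain t' where "eqv t t'" "nul t'" using IH(1)[OF t] by blast
    then have "eqv (Node g ts) (Node g (as @ t' # bs)) \<and> nul (Node g (as @ t' # bs))"
      unfolding ts by (intro conjI eqv.ctx nul.ctx)
    moreover have "nf (Node g ts) = (0 :: 'k wmod)" using nfop_zero[OF 1 _ wf(1)] wf(2) by simp
    ultimately show ?thesis using W_neq_0 by metis
  next
    case 2
    have lw: "length ws = length ts" using 2(1) by (metis length_map)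
    have "list_all2 eqv ts (map tr ws)"
    proof (rule list_all2_all_nthI)
      fix i assume i: "i < length ts"
      then have "nf (ts ! i) = (W (ws ! i) :: 'k wmod)"
        using arg_cong[OF 2(1), of "\<lambda>l. l ! i"] lw by simp
      then show "eqv (ts ! i) (map tr ws ! i)" using IH(2) i lw by simp
    qed (simp add: lw)
    from eqv_list[OF this, of g "[]"] have e: "eqv (Node g ts) (Node g (map tr ws))" by simp
    have nf: "nf (Node g ts) = nfop g (map (W :: _ \<Rightarrow> 'k wmod) ws)" using 2(1) by simp
    show ?thesis
    proof (cases g)
      case GenJ
      then show ?thesis using wf by (auto simp: W_inj W_neq_0 eqv.refl)
    next
      case GenM
      then obtain v w where vw: "ws = [v, w]" using wf lw by (auto simp: length_Suc_conv numeral_2_eq_2)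
      have "eqv (Node g ts) (tr (v + w))"
        using e tr_plus[of v w] 2(2) eqv.trans by (auto simp: vw GenM)
      moreover have "nf (Node g ts) = (W (v + w) :: 'k wmod)" unfolding nf by (simp add: GenM vw W_mult)
      ultimately show ?thesis by (auto simp: W_inj W_neq_0)
    next
      case (GenP n T)
      with wf have T: "T \<subseteq> {1..n}" and n: "1 \<le> n" using GenP_gensD by blast+
      have sl: "slots (mask n T) = length ws" using wf GenP lw by (simp add: gar_GenP[OF T] del: gar.simps)
      define as where "as = fil (mask n T) ws"
      have la: "length as = n" unfolding as_def by (simp add: length_fil[OF sl])
      have det: "mask n T = map (\<lambda>a. a = 0) as" "ws = filter (\<lambda>a. a \<noteq> 0) as"
        using fil_determines[OF sl] 2(2) unfolding as_def by auto
      have nf': "nf (Node g ts) = (br as :: 'k wmod)"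
        unfolding nf by (simp add: GenP fl_W sl as_def)
      show ?thesis
      proof (cases "n = 1")
        case True
        then obtain a where a: "as = [a]" using la by (auto simp: length_Suc_conv)
        show ?thesis
        proof (cases "a = 0")
          case True
          with det a \<open>n = 1\<close> have "T = {1}" "ws = []"
            using mask_inj[OF T, of "{1}"] by (auto simp: mask_def)
          then have "eqv (Node g ts) (tr J)" using e GenP \<open>n = 1\<close> eqv.one eqv.trans by auto
          then show ?thesis unfolding nf' a using True by (auto simp: W_inj W_neq_0)
        next
          case False
          with det a \<open>n = 1\<close> have "T = {}" "ws = [a]"
            using mask_inj[OF T, of "{}"] by (auto simp: mask_def)
          then have "eqv (Node g ts) (tr a)" using e GenP \<open>n = 1\<close> eqv.ident eqv.trans by auto
          then show ?thesis unfolding nf' a using False by (auto simp: W_inj W_neq_0)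
        qed
      next
        case False
        show ?thesis
        proof (cases "mixed as")
          case True
          have "{i. 1 \<le> i \<and> i \<le> length as \<and> as ! (i - 1) = 0} = T"
            by (rule mask_inj[of _ n]) (use T la det(1) mask_of_list[of as] in auto)
          then have "tr (lw (LP as)) = Node g (map tr ws)"
            using la det(2) GenP by (simp add: zero_wrd_def[symmetric])
          then show ?thesis unfolding nf' br_mixed[OF True] using e by (auto simp: W_inj W_neq_0)
        next
          case nm: False
          then consider "\<forall>a\<in>set as. a = 0" | "\<forall>a\<in>set as. a \<noteq> 0" by (auto simp: mixed_def)
          then have "T = {} \<or> T = {1..n}"
          proof cases
            case 1
            then have "mask n T = mask n {1..n}"
              unfolding det(1) by (intro nth_equalityI) (auto simp: la mask_def)
            then show ?thesis using mask_inj[OF T] by blast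
          next
            case 2
            then have "mask n T = mask n {}"
              unfolding det(1) by (intro nth_equalityI) (auto simp: la mask_def)
            then show ?thesis using mask_inj[OF T] by blast
          qed
          then have "nul (Node g ts)" unfolding GenP using False n by (intro nul.base) auto
          then show ?thesis
            unfolding nf' using br_pure[OF nm] la False W_neq_0 eqv.refl by metis
        qed
      qed
    qed
  qed
qed

section \<open>The ideal as the kernel of the normal form\<close>

lemma rels_ideal:
  assumes "x \<in> lspan rels"
  shows "x \<in> wu_ideal"
  using assms
proof (induction rule: lspan.induct)
  case (base x)
  then show ?case by (auto simp: rels_def eqv_ideal nul_ideal)
qed (auto intro: wu_ideal_zero wu_ideal_add ideal_sc)

lemma ideal_wft:
  fixes x :: "(gen, 'k::field) free"
  assumes "x \<in> wu_ideal"
  shows "x \<in> supp wft"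
  using ideal_rels[OF assms]
proof (induction rule: lspan.induct)
  case (base x)
  then show ?case by (auto simp: rels_def intro: supp_diff supp_single)
qed (auto intro: supp_add supp_sc)

lemma eqv_nf: "eqv t t' \<Longrightarrow> wf_tree gens gar t \<Longrightarrow> nf t = (nf t' :: 'k::field wmod)"
proof (induction rule: eqv.induct)
  case (sym t t')
  then show ?case using eqv_inv by metis
next
  case (trans t t' t'')
  then show ?case using eqv_inv by metis
next
  case one
  have "mask 1 {1} = [True]" by (simp add: mask_def)
  then show ?case by simp
next
  case (ident a)
  have "(nf a :: 'k wmod) \<in> supp (- {0})"
    using nf_cases[of a, where 'k = 'k] ident by (auto simp: HW'_def intro: supp_single)
  moreover have "mask 1 {} = [False]" by (simp add: mask_def)
  ultimately show ?case by (simp add: Br_io)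
qed (auto simp: mult.assoc W_mult)

lemma nul_nf: "nul t \<Longrightarrow> wf_tree gens gar t \<Longrightarrow> nf t = (0 :: 'k::field wmod)"
proof (induction rule: nul.induct)
  case (base n T ts)
  then have wf: "GenP n T \<in> gens" "length ts = gar (GenP n T)" "\<forall>t\<in>set ts. wf_tree gens gar t"
    and T: "T \<subseteq> {1..n}" by auto
  from nf_list_cases[of ts, where 'k = 'k] nf_cases[where 'k = 'k] wf(3)
  consider "(0 :: 'k wmod) \<in> set (map nf ts)"
    | ws where "map nf ts = map (W :: _ \<Rightarrow> 'k wmod) ws" "\<forall>w\<in>set ws. wval w \<and> w \<noteq> 0"
    by blast
  then show ?case
  proof cases
    case 1
    then show ?thesis using nfop_zero[OF 1 _ wf(1)] wf(2) by simp
  next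
    case 2
    then have "length ws = length ts" by (metis length_map)
    then have sl: "slots (mask n T) = length ws" using wf(2) by (simp add: gar_GenP[OF T] del: gar.simps)
    have m: "mask n T = replicate n (T \<noteq> {})"
      using base(1,2) by (intro nth_equalityI) (auto simp: mask_def)
    have d: "mask n T = map (\<lambda>a. a = 0) (fil (mask n T) ws)"
      using fil_determines[OF sl] 2(2) by auto
    have "\<forall>a\<in>set (fil (mask n T) ws). (a = 0) = (T \<noteq> {})"
    proof
      fix a assume "a \<in> set (fil (mask n T) ws)"
      then have "(a = 0) \<in> set (mask n T)" by (subst d) auto
      then show "(a = 0) = (T \<noteq> {})" unfolding m by auto
    qed
    then have "\<not> mixed (fil (mask n T) ws)" by (auto simp: mixed_def)
    then have "br (fil (mask n T) ws) = (0 :: 'k wmod)"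
      using base(1) by (intro br_pure) (auto simp: length_fil[OF sl])
    then show ?thesis using 2(1) by (simp add: fl_W sl)
  qed
next
  case (ctx t g as bs)
  then have "nfop g (map nf (as @ t # bs)) = (0 :: 'k wmod)" by (intro nfop_zero) auto
  then show ?case by simp
qed

text \<open>Soundness is \<open>eqv_nf\<close> and \<open>nul_nf\<close>. For the converse,
  \<open>tree_normal_form\<close> shows that \<open>x\<close> differs from the image of
  \<open>NF x\<close> under \<open>tr\<close> by an element of the ideal.\<close>

theorem wu_ideal_iff:
  fixes x :: "(gen, 'k::field) free"
  shows "x \<in> wu_ideal \<longleftrightarrow> x \<in> supp wft \<and> NF x = 0"
proof
  assume x: "x \<in> wu_ideal"
  from ideal_rels[OF x] have "NF x = 0"
  proof (induction rule: lspan.induct)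
    case (base x)
    then show ?case by (auto simp: rels_def linmap_diff eqv_nf nul_nf)
  qed (auto simp: linmap_zero linmap_add linmap_sc)
  then show "x \<in> supp wft \<and> NF x = 0" using ideal_wft[OF x] by simp
next
  assume x: "x \<in> supp wft \<and> NF x = 0"
  have t: "mono t - lin (\<lambda>w. mono (tr w)) (nf t) \<in> (wu_ideal :: (gen, 'k) free set)"
    if wf: "wf_tree gens gar t" for t
    using nf_cases[OF wf, where 'k = 'k]
  proof (elim disjE bexE)
    assume z: "nf t = (0 :: 'k wmod)"
    then obtain t' where "eqv t t'" "nul t'" using tree_normal_form[OF wf, where 'k = 'k] by blast
    then have "(mono t - mono t') + mono t' \<in> (wu_ideal :: (gen, 'k) free set)"
      using wf eqv_inv by (intro wu_ideal_add eqv_ideal nul_ideal) auto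
    then show ?thesis using z by simp
  next
    fix w assume w: "nf t = (W w :: 'k wmod)"
    then have "eqv t (tr w)" using tree_normal_form[OF wf, where 'k = 'k] by blast
    then show ?thesis using wf by (simp add: w eqv_ideal)
  qed
  have "x - lin (\<lambda>w. mono (tr w)) (NF x) = (\<Sum>t\<in>keys x. sc (lookup x t) (mono t - lin (\<lambda>w. mono (tr w)) (nf t)))"
    using linmap_expand[of "\<lambda>x. x - lin (\<lambda>w. mono (tr w)) (NF x)" x]
    by (simp add: linmap_sub linmap_comp[OF linmap_lin linmap_NF])
  moreover have "(\<Sum>t\<in>keys x. sc (lookup x t) (mono t - lin (\<lambda>w. mono (tr w)) (nf t))) \<in> wu_ideal"
    using x by (intro ideal_sum ideal_sc t) (auto simp: supp_def)
  ultimately show "x \<in> wu_ideal" using x by (simp add: linmap_zero)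
qed

lemma comp_ideal_left: "x \<in> wu_ideal \<Longrightarrow> y \<in> supp wft \<Longrightarrow> free_comp gdeg i x y \<in> wu_ideal"
  by (rule rels_ideal[OF comp_rels_left[OF ideal_rels]])

lemma comp_ideal_right: "x \<in> wu_ideal \<Longrightarrow> y \<in> supp wft \<Longrightarrow> free_comp gdeg i y x \<in> wu_ideal"
  by (rule rels_ideal[OF comp_rels_right[OF ideal_rels]])

lemma dif_wft: "x \<in> supp wft \<Longrightarrow> wu.D x \<in> supp wft"
  by (rule supp_linmap[OF wu.linmap_dif]) (auto intro: supp_wft[OF wu.tree_dif_supp])

text \<open>The kernel of a chain map is stable under the differential; no relation has to be
  differentiated.\<close>

lemma ideal_dif: "x \<in> wu_ideal \<Longrightarrow> wu.D x \<in> wu_ideal"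
  by (simp add: wu_ideal_iff dif_wft NF_dif linmap_zero)

text \<open>The square of the differential is a derivation, so that only the generators matter.\<close>

lemma dd_comp:
  assumes f: "f \<in> supp (tset gens gar gdeg M p)" and g: "g \<in> supp (tset gens gar gdeg N q)"
    and i: "1 \<le> i" "i \<le> M"
    and d: "wu.D (wu.D f) \<in> wu_ideal" "wu.D (wu.D g) \<in> wu_ideal"
  shows "wu.D (wu.D (free_comp gdeg i f g)) \<in> wu_ideal"
proof -
  note Df = wu.dif_supp[OF f] and Dg = wu.dif_supp[OF g]
  have "wu.D (wu.D (free_comp gdeg i f g)) =
      free_comp gdeg i (wu.D (wu.D f)) g + free_comp gdeg i f (wu.D (wu.D g))"
    by (simp add: wu.dif_comp[OF f g i] linmap_add[OF wu.linmap_dif] linmap_sc[OF wu.linmap_dif]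
        wu.dif_comp[OF Df g i] wu.dif_comp[OF f Dg i] pm_add sc_add sc_minus_left)
  then show ?thesis
    using comp_ideal_left[OF d(1) supp_wft[OF g]] comp_ideal_right[OF d(2) supp_wft[OF f]]
    by (simp add: wu_ideal_add)
qed

lemma dd_plug:
  assumes "f \<in> supp (tset gens gar gdeg N p)" "1 \<le> k" "k + length ts \<le> N + 1"
    "\<forall>t\<in>set ts. wf_tree gens gar t" "wu.D (wu.D f) \<in> wu_ideal"
    "\<forall>t\<in>set ts. wu.D (wu.D (mono t)) \<in> (wu_ideal :: (gen, 'k::field) free set)"
  shows "wu.D (wu.D (plug gdeg k f ts)) \<in> (wu_ideal :: (gen, 'k) free set)"
  using assms
proof (induction ts arbitrary: k f N p)
  case (Cons t ts)
  have t: "(mono t :: (gen, 'k) free) \<in> supp (tset gens gar gdeg (leaves t) (tdeg gdeg t))"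
    using Cons.prems by (intro supp_single) (simp add: tset_def)
  have c: "free_comp gdeg k f (mono t) \<in> supp (tset gens gar gdeg (N + leaves t - 1) (p + tdeg gdeg t))"
    using comp_supp[OF Cons.prems(1) t, of k] Cons.prems by simp
  have "wu.D (wu.D (free_comp gdeg k f (mono t))) \<in> wu_ideal"
    using Cons.prems by (intro dd_comp[OF Cons.prems(1) t]) auto
  with Cons.prems c show ?case by (auto intro!: Cons.IH)
qed simp

text \<open>The normal form of a corolla of \<open>GenP\<close> is a bracket whose entries are
  inputs and symbols \<open>1\<close>, all closed of degree 0, so that \<open>Z_dd\<close>
  applies.\<close>

lemma dd_corolla:
  assumes "g \<in> gens"
  shows "wu.D (wu.D (mono (corolla g))) \<in> (wu_ideal :: (gen, 'k::field) free set)"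
proof -
  have c: "(mono (corolla g) :: (gen, 'k) free) \<in> supp wft"
    using assms by (intro supp_wft[OF corolla_supp])
  have "DW (DW (nf (corolla g))) = (0 :: 'k wmod)"
  proof (cases g)
    case (GenP n T)
    with assms have T: "T \<subseteq> {1..n}" and n: "1 \<le> n" using GenP_gensD by blast+
    let ?ws = "replicate (gar g) (lw LX)"
    have sl: "slots (mask n T) = length ?ws" by (simp add: GenP gar_GenP[OF T] del: gar.simps)
    have "map nf (replicate (gar g) Leaf) = map (W :: _ \<Rightarrow> 'k wmod) ?ws" by simp
    then have "nf (corolla g) = (br (fil (mask n T) ?ws) :: 'k wmod)"
      using fl_W[OF sl, where 'a = 'k] by (simp add: corolla_def GenP del: gar.simps)
    moreover have "fil (mask n T) ?ws \<in> Z TYPE('k)"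
    proof -
      have "set (fil (mask n T) ?ws) \<subseteq> {0, lw LX}" using set_fil[of "mask n T" ?ws] by auto
      moreover have "length (fil (mask n T) ?ws) \<noteq> 0" using n length_fil[OF sl] by simp
      ultimately show ?thesis by (auto simp: Z_def)
    qed
    ultimately show ?thesis using Z_dd by metis
  qed (simp_all add: corolla_def numeral_2_eq_2 W_mult linmap_zero)
  then show ?thesis
    by (simp add: wu_ideal_iff dif_wft c NF_dif del: wu.dif_mono)
qed

lemma dd_ideal:
  fixes x :: "(gen, 'k::field) free"
  assumes "x \<in> supp wft"
  shows "wu.D (wu.D x) \<in> wu_ideal"
proof -
  have t: "wu.D (wu.D (mono t)) \<in> (wu_ideal :: (gen, 'k) free set)" if "wf_tree gens gar t" for t
    using that
  proof (induction t)
    case Leaf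
    then show ?case by (simp add: linmap_zero wu_ideal_zero)
  next
    case (Node g ts)
    then have g: "g \<in> gens" "length ts = gar g" by auto
    have "wu.D (wu.D (plug gdeg 1 (mono (corolla g)) ts)) \<in> (wu_ideal :: (gen, 'k) free set)"
      using Node g by (intro dd_plug[OF corolla_supp] dd_corolla) auto
    moreover have "plug gdeg 1 (mono (corolla g)) ts = (mono (Node g ts) :: (gen, 'k) free)"
      unfolding corolla_def One_nat_def by (rule plug_corolla[OF g(2)])
    ultimately show ?case by (simp only:)
  qed
  have "wu.D (wu.D x) = (\<Sum>t\<in>keys x. sc (lookup x t) (wu.D (wu.D (mono t))))"
    by (rule linmap_expand) (intro linmap_comp[OF wu.linmap_dif] wu.linmap_dif)
  then show ?thesis
    using assms by (simp only:) (intro ideal_sum ideal_sc t, auto simp: supp_def)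
qed

section \<open>The quotient operad\<close>

lemma abs_wu_eq: "abs_wu x = abs_wu y \<longleftrightarrow> x - y \<in> wu_ideal"
  by (simp add: wu.abs_eq_iff wu_rel_def)

lemma abs_rep_wu: "abs_wu (rep_wu x) = x"
  by (rule Quotient_abs_rep[OF Quotient_wu])

lemma rep_abs_wu: "rep_wu (abs_wu x) - x \<in> wu_ideal"
  by (simp add: abs_wu_eq[symmetric] abs_rep_wu)

lemma abs_wu_zero: "abs_wu 0 = 0" by (simp add: zero_wu_def)
lemma abs_wu_add: "abs_wu x + abs_wu y = abs_wu (x + y)" by (rule plus_wu.abs_eq)
lemma abs_wu_minus: "- abs_wu x = abs_wu (- x)" by (rule uminus_wu.abs_eq)
lemma abs_wu_diff: "abs_wu x - abs_wu y = abs_wu (x - y)" by (simp add: minus_wu_def abs_wu_minus abs_wu_add)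
lemma abs_wu_scl: "wu_scl c (abs_wu x) = abs_wu (sc c x)" by (simp add: wu_scl.abs_eq free_scl_eq_sc)

lemma wu_operad_simps [simp]: "scl wu_operad = wu_scl"
  "piece wu_operad N p = abs_wu ` supp (tset gens gar gdeg N p)"
  "opid wu_operad = abs_wu (mono Leaf)"
  by (simp_all add: wu_operad_def)

lemma rep_abs_wft: "x \<in> supp wft \<Longrightarrow> rep_wu (abs_wu x) \<in> supp wft"
  using supp_add[OF ideal_wft[OF rep_abs_wu[of x]], of x] by simp

text \<open>The representative chosen by \<open>rep_wu\<close> differs from \<open>x\<close> by an
  element of the ideal. It is again a combination of well-formed trees, because the ideal contains
  nothing else, and so composition with it stays inside the ideal.\<close>

lemma abs_wu_comp:
  assumes "x \<in> supp wft" "y \<in> supp wft"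
  shows "pcomp wu_operad i (abs_wu x) (abs_wu y) = abs_wu (free_comp gdeg i x y)"
proof -
  let ?x = "rep_wu (abs_wu x)" and ?y = "rep_wu (abs_wu y)"
  have "free_comp gdeg i ?x ?y - free_comp gdeg i x y = free_comp gdeg i (?x - x) ?y + free_comp gdeg i x (?y - y)"
    by (simp add: linmap_diff[OF linmap_comp_left] linmap_diff[OF linmap_comp_right])
  also have "\<dots> \<in> wu_ideal"
    by (intro wu_ideal_add comp_ideal_left comp_ideal_right rep_abs_wu rep_abs_wft assms)
  finally show ?thesis by (simp add: wu_operad_def abs_wu_eq)
qed

lemma abs_wu_dif: "dif wu_operad (abs_wu x) = abs_wu (wu.D x)"
proof -
  have "wu.D (rep_wu (abs_wu x)) - wu.D x \<in> wu_ideal"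
    using ideal_dif[OF rep_abs_wu[of x]] by (simp add: linmap_diff)
  then show ?thesis by (simp add: wu_operad_def abs_wu_eq)
qed

lemma vector_space_wu: "vector_space (wu_scl :: 'k::field \<Rightarrow> 'k wu \<Rightarrow> 'k wu)"
proof
  fix a b :: 'k and x y :: "'k wu"
  obtain f g where fg: "x = abs_wu f" "y = abs_wu g" using abs_rep_wu by metis
  show "wu_scl a (x + y) = wu_scl a x + wu_scl a y"
    "wu_scl (a + b) x = wu_scl a x + wu_scl b x"
    "wu_scl a (wu_scl b x) = wu_scl (a * b) x" "wu_scl 1 x = x"
    by (simp_all add: fg abs_wu_scl abs_wu_add sc_add sc_add_left)
qed

theorem dg_operad_wu: "dg_operad (wu_operad :: ('k::field, 'k wu) operad_data)"
proof -
  interpret V: vector_space "wu_scl :: 'k \<Rightarrow> 'k wu \<Rightarrow> 'k wu" by (rule vector_space_wu)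
  have sub: "V.subspace (abs_wu ` supp (tset gens gar gdeg N p))" for N p
    unfolding V.subspace_def
    by (auto simp: abs_wu_zero[symmetric] abs_wu_add abs_wu_scl intro: supp_add supp_sc)
  have tw: "x \<in> supp (tset gens gar gdeg N p) \<Longrightarrow> x \<in> supp wft" for x :: "(gen, 'k) free" and N p
    by (rule supp_wft)
  note op = abs_wu_comp[OF tw tw] abs_wu_dif abs_wu_add abs_wu_scl
  show ?thesis
  proof (unfold_locales, unfold wu_operad_simps)
    fix a b c :: 'k and x y :: "'k wu"
    show "wu_scl a (x + y) = wu_scl a x + wu_scl a y"
      "wu_scl (a + b) x = wu_scl a x + wu_scl b x"
      "wu_scl a (wu_scl b x) = wu_scl (a * b) x" "wu_scl 1 x = x"
      by (rule V.scale_right_distrib V.scale_left_distrib V.scale_scale V.scale_one)+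
  next
    show "module.subspace (wu_scl :: 'k \<Rightarrow> _) (abs_wu ` supp (tset gens gar gdeg N p))" for N p
      by (rule sub)
  next
    show "abs_wu (mono Leaf) \<in> abs_wu ` supp (tset gens gar gdeg 1 0)"
      by (intro imageI supp_single) (simp add: tset_def)
  next
    fix x y :: "'k wu" and M p N q i
    assume "x \<in> abs_wu ` supp (tset gens gar gdeg M p)" "y \<in> abs_wu ` supp (tset gens gar gdeg N q)"
      and i: "1 \<le> i" "i \<le> M"
    then obtain f g where f: "x = abs_wu f" "f \<in> supp (tset gens gar gdeg M p)"
      and g: "y = abs_wu g" "g \<in> supp (tset gens gar gdeg N q)" by auto
    show "pcomp wu_operad i x y \<in> abs_wu ` supp (tset gens gar gdeg (M + N - 1) (p + q))"
      using comp_supp[OF f(2) g(2) i] by (simp add: f g op(1)[OF f(2) g(2)])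
    show "pcomp wu_operad i (wu_scl u x) y = wu_scl u (pcomp wu_operad i x y)" for u
      by (simp add: f g op op(1)[OF f(2) g(2)] op(1)[OF supp_sc[OF f(2)] g(2)] comp_sc_left)
    show "pcomp wu_operad i x (wu_scl u y) = wu_scl u (pcomp wu_operad i x y)" for u
      by (simp add: f g op op(1)[OF f(2) g(2)] op(1)[OF f(2) supp_sc[OF g(2)]] comp_sc_right)
    show "dif wu_operad (pcomp wu_operad i x y) = pcomp wu_operad i (dif wu_operad x) y
        + wu_scl ((-1) powi p) (pcomp wu_operad i x (dif wu_operad y))"
      by (simp add: f g op op(1)[OF f(2) g(2)] op(1)[OF wu.dif_supp[OF f(2)] g(2)]
          op(1)[OF f(2) wu.dif_supp[OF g(2)]] wu.dif_comp[OF f(2) g(2) i] powi_eq_pm)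
  next
    fix x x' y :: "'k wu" and M p N q i
    assume "x \<in> abs_wu ` supp (tset gens gar gdeg M p)" "x' \<in> abs_wu ` supp (tset gens gar gdeg M p)"
      "y \<in> abs_wu ` supp (tset gens gar gdeg N q)"
    then obtain f f' g where f: "x = abs_wu f" "f \<in> supp (tset gens gar gdeg M p)"
      and f': "x' = abs_wu f'" "f' \<in> supp (tset gens gar gdeg M p)"
      and g: "y = abs_wu g" "g \<in> supp (tset gens gar gdeg N q)" by auto
    show "pcomp wu_operad i (x + x') y = pcomp wu_operad i x y + pcomp wu_operad i x' y"
      by (simp add: f f' g op op(1)[OF f(2) g(2)] op(1)[OF f'(2) g(2)]
          op(1)[OF supp_add[OF f(2) f'(2)] g(2)] comp_add_left)
    show "pcomp wu_operad i y (x + x') = pcomp wu_operad i y x + pcomp wu_operad i y x'"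
      by (simp add: f f' g op op(1)[OF g(2) f(2)] op(1)[OF g(2) f'(2)]
          op(1)[OF g(2) supp_add[OF f(2) f'(2)]] comp_add_right)
    show "dif wu_operad (x + x') = dif wu_operad x + dif wu_operad x'"
      by (simp add: f f' op linmap_add)
  next
    fix x :: "'k wu" and N p i
    assume "x \<in> abs_wu ` supp (tset gens gar gdeg N p)"
    then obtain f where f: "x = abs_wu f" "f \<in> supp (tset gens gar gdeg N p)" by auto
    have l: "(mono Leaf :: (gen, 'k) free) \<in> supp (tset gens gar gdeg 1 0)"
      by (intro supp_single) (simp add: tset_def)
    show "pcomp wu_operad 1 (abs_wu (mono Leaf)) x = x"
      by (simp only: f op(1)[OF l f(2)] comp_opid_left[OF f(2)])
    show "1 \<le> i \<Longrightarrow> i \<le> N \<Longrightarrow> pcomp wu_operad i x (abs_wu (mono Leaf)) = x"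
      by (simp only: f op(1)[OF f(2) l] comp_opid_right[OF f(2)])
    show "dif wu_operad x \<in> abs_wu ` supp (tset gens gar gdeg N (p + 1))"
      using wu.dif_supp[OF f(2)] by (simp add: f op)
    show "dif wu_operad (wu_scl u x) = wu_scl u (dif wu_operad x)" for u
      by (simp add: f op linmap_sc)
    show "dif wu_operad (dif wu_operad x) = 0"
      using dd_ideal[OF tw[OF f(2)]] by (simp add: f op abs_wu_zero[symmetric] abs_wu_eq)
  next
    fix x y z :: "'k wu" and L p M q N r i j
    assume "x \<in> abs_wu ` supp (tset gens gar gdeg L p)" "y \<in> abs_wu ` supp (tset gens gar gdeg M q)"
      "z \<in> abs_wu ` supp (tset gens gar gdeg N r)" and i: "1 \<le> i" "i \<le> L" "1 \<le> j" "j \<le> M"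
    then obtain f g h where f: "x = abs_wu f" "f \<in> supp (tset gens gar gdeg L p)"
      and g: "y = abs_wu g" "g \<in> supp (tset gens gar gdeg M q)"
      and h: "z = abs_wu h" "h \<in> supp (tset gens gar gdeg N r)" by auto
    show "pcomp wu_operad (i - 1 + j) (pcomp wu_operad i x y) z = pcomp wu_operad i x (pcomp wu_operad j y z)"
      unfolding f(1) g(1) h(1) op(1)[OF f(2) g(2)] op(1)[OF g(2) h(2)]
        op(1)[OF comp_supp[OF f(2) g(2) i(1,2)] h(2)] op(1)[OF f(2) comp_supp[OF g(2) h(2) i(3,4)]]
        comp_seq[OF f(2) g(2) h(2) i] ..
  next
    fix x y z :: "'k wu" and L p M q N r i k
    assume "x \<in> abs_wu ` supp (tset gens gar gdeg L p)" "y \<in> abs_wu ` supp (tset gens gar gdeg M q)"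
      "z \<in> abs_wu ` supp (tset gens gar gdeg N r)" and i: "1 \<le> (i :: nat)" "i < k" "k \<le> L"
    then obtain f g h where f: "x = abs_wu f" "f \<in> supp (tset gens gar gdeg L p)"
      and g: "y = abs_wu g" "g \<in> supp (tset gens gar gdeg M q)"
      and h: "z = abs_wu h" "h \<in> supp (tset gens gar gdeg N r)" by auto
    have i': "i \<le> L" "1 \<le> k" using i by auto
    show "pcomp wu_operad (k + M - 1) (pcomp wu_operad i x y) z
        = wu_scl ((-1) powi (q * r)) (pcomp wu_operad i (pcomp wu_operad k x z) y)"
      unfolding f(1) g(1) h(1) op(1)[OF f(2) g(2)] op(1)[OF f(2) h(2)]
        op(1)[OF comp_supp[OF f(2) g(2) i(1) i'(1)] h(2)] op(1)[OF comp_supp[OF f(2) h(2) i'(2) i(3)] g(2)]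
        comp_par[OF f(2) g(2) h(2) i] abs_wu_scl powi_eq_pm ..
  qed
qed

section \<open>The associative operad and the augmentation of words\<close>

lemma assoc_operad_simps [simp]: "scl assoc_operad = (*)"
  "piece assoc_operad N p = (if p = 0 then UNIV else {0})" "pcomp assoc_operad i a b = a * b"
  "opid assoc_operad = 1" "dif assoc_operad a = 0"
  by (simp_all add: assoc_operad_def)

lemma dg_operad_assoc: "dg_operad (assoc_operad :: ('k::field, 'k) operad_data)"
proof -
  interpret V: vector_space "(*) :: 'k \<Rightarrow> 'k \<Rightarrow> 'k"
    by standard (simp_all add: algebra_simps)
  have sub: "module.subspace (scl (assoc_operad :: ('k, 'k) operad_data)) (piece (assoc_operad :: ('k, 'k) operad_data) N p)" for N p
    by (auto simp: V.subspace_def)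
  \<comment> \<open>The Koszul sign could differ from 1 only in nonzero degrees, where the pieces
    vanish.\<close>
  have par: "a * (b * c) = (-1) powi (q * r) * (a * (c * b))"
    if "b \<in> (if q = 0 then UNIV else {0})" "c \<in> (if r = 0 then UNIV else {0})" for a b c :: 'k and q r :: int
  proof (cases "q = 0 \<and> r = 0")
    case True
    then have "(-1 :: 'k) powi (q * r) = 1" by simp
    then show ?thesis by (simp only: mult_1_left mult_ac)
  next
    case False
    then have "b = 0 \<or> c = 0" using that by (cases "q = 0") simp_all
    then show ?thesis by (elim disjE) simp_all
  qed
  have mem: "a * b \<in> (if p + q = 0 then UNIV else {0})"
    if "a \<in> (if p = 0 then UNIV else {0})" "b \<in> (if q = 0 then UNIV else {0})" for a b :: 'k and p q :: int
    using that by (cases "p = 0"; cases "q = 0") simp_all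
  show ?thesis
    by (unfold_locales, unfold assoc_operad_simps, simp_all only: distrib_left distrib_right mult.assoc;
        ((rule mult_1_left mult_1_right mult.left_commute sub[unfolded assoc_operad_simps])
          | (rule mem; assumption) | (rule par; assumption) | simp))
qed

fun free_of_P :: "wrd \<Rightarrow> bool" where
  "free_of_P (End b) = True"
| "free_of_P (Gap b l w) = (l = LX \<and> free_of_P w)"

text \<open>Routed through the free module on one generator, so that the lemmas on linear maps
  between free modules apply to a scalar-valued map.\<close>

definition aug :: "'k::field wmod \<Rightarrow> 'k" where
  "aug r = lookup (lin (\<lambda>w. single () (if free_of_P w then 1 else 0)) r) ()"

lemma aug_linear [simp]: "aug (x + y) = aug x + aug y" "aug (sc c x) = c * aug x" "aug 0 = 0"
  "aug (x - y) = aug x - aug y" "aug (- x) = - aug x"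
  by (simp_all add: aug_def linmap_add linmap_sc linmap_diff linmap_minus lookup_add lookup_minus)

lemma aug_single [simp]: "aug (single w c) = (if free_of_P w then c else 0)"
  by (simp add: aug_def)

lemma free_of_P_plus [simp]: "free_of_P (v + w) \<longleftrightarrow> free_of_P v \<and> free_of_P w"
proof -
  have f: "free_of_P (flag a w) = free_of_P w" for a w by (cases w) auto
  show ?thesis by (induction v w rule: plus_wrd.induct) (auto simp: f)
qed

lemma aug_sum [simp]: "aug (sum f I) = (\<Sum>i\<in>I. aug (f i))"
  by (induction I rule: infinite_finite_induct) auto

lemma aug_expand: "aug x = (\<Sum>w\<in>keys x. if free_of_P w then lookup x w else 0)"
  by (subst poly_mapping_expand) (simp cong: if_cong)

lemma aug_mult [simp]: "aug (x * y) = aug x * aug y"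
proof -
  let ?A = "lin (\<lambda>w. single () (if free_of_P w then 1 else 0))"
  have "?A (x * y) = sc (aug y) (?A x)"
  proof (rule linmap_eqI[of "\<lambda>x. ?A (x * y)"])
    fix v
    have "?A (W v * y) = sc (if free_of_P v then 1 else 0) (?A y)"
      by (rule linmap_eqI[of "\<lambda>y. ?A (W v * y)"])
        (auto simp: W_mult intro!: linmap_comp[OF linmap_lin] linmap_mult_right linmap_sc_left)
    moreover have "?A y = single () (aug y)"
      by (rule poly_mapping_eqI) (simp add: aug_def)
    ultimately show "?A (W v * y) = sc (aug y) (?A (W v))" by simp
  qed (intro linmap_comp[OF linmap_lin] linmap_mult_left linmap_sc_left linmap_lin)+
  then have "lookup (?A (x * y)) () = lookup (sc (aug y) (?A x)) ()" by simp
  then show ?thesis by (simp add: aug_def mult.commute)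
qed

text \<open>A bracket has \<open>n \<ge> 2\<close> entries and contributes \<open>1 - n < 0\<close>
  besides their degrees. The upper bound 0 is also what terminates the filtration
  \<open>GS\<close>.\<close>

lemma lval_ldeg: "lval l \<Longrightarrow> ldeg l \<le> 0 \<and> (ldeg l = 0 \<longrightarrow> l = LX)"
  "wval w \<Longrightarrow> wdeg w \<le> 0 \<and> (wdeg w = 0 \<longrightarrow> free_of_P w)"
proof (induction l and w rule: lval_wval.induct)
  case (2 as)
  then have "\<forall>a\<in>set as. wdeg a \<le> 0" by auto
  then have "wdegs as \<le> 0" by (induction as) auto
  moreover have "length as \<ge> 2" using 2 mixed_length[of as] by simp
  ultimately show ?case by simp
qed auto

lemma free_of_P_wdeg: "free_of_P w \<Longrightarrow> wdeg w = 0"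
  by (induction w rule: free_of_P.induct) auto

section \<open>Acyclicity\<close>

definition uu :: "'k::field wmod" where "uu = 1 - W J"

definition lb :: "'k::field wmod \<Rightarrow> 'k wmod" where "lb x = Br (Ls [0] * io x)"
definition rb :: "'k::field wmod \<Rightarrow> 'k wmod" where "rb x = Br (io x * Ls [0])"

lemma linmap_lb [simp]: "linmap lb" and linmap_rb [simp]: "linmap rb"
  unfolding lb_def rb_def
  by (intro linmap_comp[OF linmap_Br] linmap_mult_left' linmap_mult_right' linmap_io)+

lemma JJ: "W J * W J = (W J :: 'k::field wmod)" "W J * (W J * x) = W J * (x :: 'k wmod)"
  by (simp_all add: W_mult mult.assoc[symmetric])

lemma uu_simps [simp]: "uu * W J = 0" "W J * uu = 0" "uu * uu = uu"
  "uu * (W J * x) = 0" "W J * (uu * x) = 0" "uu * (uu * x) = uu * (x :: 'k::field wmod)"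
  by (simp_all add: uu_def algebra_simps JJ)

lemma DW_W_mult: "DW (W v * y) = dw v * y + sc (pm (wdeg v)) (W v * DW y)"
  by (rule linmap_eqI[of "\<lambda>y. DW (W v * y)"])
    (auto simp: W_mult dw_plus intro!: linmap_comp[OF linmap_ops(1)] linmap_mult_right linmap_plus
      linmap_sc_left linmap_mult_right' linmap_ops)

lemma DW_mult_J: "DW (x * W J) = DW x * W J"
  by (rule linmap_eqI[of "\<lambda>x. DW (x * W J)"])
    (auto simp: W_mult dw_plus intro!: linmap_comp[OF linmap_ops(1)] linmap_mult_left linmap_mult_left' linmap_ops)

lemma DW_J_mult: "DW (W J * x) = W J * DW x"
  by (simp add: DW_W_mult)

lemma DW_uu_mult: "DW (uu * x) = uu * DW x"
  by (simp add: uu_def left_diff_distrib linmap_diff DW_J_mult)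

text \<open>This is \<open>d p_2(1, x) = x - j x - p_2(1, d x)\<close>. It fails for the empty word,
  since \<open>p_2(1, 1) = 0\<close> while \<open>u\<close> is not 0; hence the condition on
  \<open>x\<close>.\<close>

lemma DW_lb: "x \<in> supp (- {0}) \<Longrightarrow> DW (lb x) = uu * x - lb (DW x)"
proof (erule linmap_eq_supp)
  fix w :: wrd assume w: "w \<in> - {0}"
  have "sp [0, w] = - (W J * W w :: 'a wmod)" using w by (simp add: sp_def sc_minus_left)
  then show "DW (lb (W w)) = uu * W w - lb (DW (W w :: 'a wmod))"
    using w DW_br[of "[0, w]", where 'k = 'a]
    by (simp add: lb_def Ls_mult linmap_zero linmap_minus[OF linmap_Br] sc_minus_left uu_def left_diff_distrib Ls_Nil)
qed (intro linmap_comp[OF linmap_ops(1)] linmap_comp[OF linmap_lb] linmap_sub linmap_mult_right linmap_ops linmap_lb)+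

lemma DW_rb: "x \<in> supp (- {0}) \<Longrightarrow> DW (rb x) = x * uu - rb (DW x)"
proof (erule linmap_eq_supp)
  fix w :: wrd assume w: "w \<in> - {0}"
  have "sp [w, 0] = - (W w * W J :: 'a wmod)" using w by (simp add: sp_def sc_minus_left)
  then show "DW (rb (W w)) = W w * uu - rb (DW (W w :: 'a wmod))"
    using w DW_br[of "[w, 0]", where 'k = 'a]
    by (simp add: rb_def Ls_mult linmap_zero linmap_minus[OF linmap_Br] sc_minus_left uu_def right_diff_distrib Ls_Nil)
qed (intro linmap_comp[OF linmap_ops(1)] linmap_comp[OF linmap_rb] linmap_sub linmap_mult_left linmap_ops linmap_rb)+

lemma lb_HW': "x \<in> supp (HW N p) \<Longrightarrow> lb x \<in> supp (HW' N (p - 1))"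
proof -
  assume x: "x \<in> supp (HW N p)"
  have "Ls [0] * io x \<in> supp (HL (1 + 1) (0 + N) (0 + p))"
    by (intro HL_mult io_HL x supp_single) (simp add: HL_def)
  from Br_HW'[OF this] show ?thesis by (simp add: lb_def)
qed

lemma rb_HW': "x \<in> supp (HW N p) \<Longrightarrow> rb x \<in> supp (HW' N (p - 1))"
proof -
  assume x: "x \<in> supp (HW N p)"
  have "io x * Ls [0] \<in> supp (HL (1 + 1) (N + 0) (p + 0))"
    by (intro HL_mult io_HL x supp_single) (simp add: HL_def)
  from Br_HW'[OF this] show ?thesis by (simp add: rb_def)
qed

lemma HW'_no_unit: "x \<in> supp (HW' N p) \<Longrightarrow> x \<in> supp (- {0})"
  by (erule supp_mono) (auto simp: HW'_def)

lemma HW_J: "(W J :: 'k::field wmod) \<in> supp (HW 0 0)" and HW_uu: "(uu :: 'k wmod) \<in> supp (HW 0 0)"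
proof -
  show J: "(W J :: 'k wmod) \<in> supp (HW 0 0)" by (rule supp_single) (simp add: HW_def)
  have "(W 0 :: 'k wmod) \<in> supp (HW 0 0)" by (rule supp_single) (simp add: HW_def)
  then show "(uu :: 'k wmod) \<in> supp (HW 0 0)" unfolding uu_def W_zero[symmetric] by (intro supp_diff J)
qed

text \<open>Multiplication by \<open>j\<close> on either side is homotopic to the identity.\<close>

lemma cocycle_corner:
  assumes x: "x \<in> supp (HW' N p)" and d: "DW x = 0"
  shows "\<exists>y\<in>supp (HW' N (p - 1)). DW y = x - W J * x * W J"
proof
  note xJ = HW'_mult_left[OF x HW_J]
  \<comment> \<open>The two homotopies are combined by
    \<open>x - j x j = x u + u (x j)\<close>.\<close>
  have "DW (rb x) = x * uu"
    using DW_rb[OF HW'_no_unit[OF x]] by (simp add: d linmap_zero)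
  moreover have "DW (lb (x * W J)) = uu * (x * W J)"
    using DW_lb[OF HW'_no_unit[OF xJ]] by (simp add: d linmap_zero DW_mult_J)
  ultimately show "DW (rb x + lb (x * W J)) = x - W J * x * W J"
    by (simp add: linmap_add uu_def algebra_simps)
  show "rb x + lb (x * W J) \<in> supp (HW' N (p - 1))"
    using rb_HW'[OF HW'_HW[OF x]] lb_HW'[OF HW'_HW[OF xJ]] by (simp add: supp_add)
qed

section \<open>Lifting words to trees, and the square of the differential on words\<close>

lemma tr_tset:
  assumes "w \<in> HW' N p"
  shows "mono (tr w) \<in> supp (tset gens gar gdeg N p)" "NF (mono (tr w)) = (W w :: 'k::field wmod)"
proof -
  have w: "wval w" "w \<noteq> 0" "wxc w = N" "wdeg w = p" using assms by (auto simp: HW'_def HW_def)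
  from tr_props(2)[OF w(1,2), where 'k = 'k]
  have t: "wf_tree gens gar (tr w)" "nf (tr w) = (W w :: 'k wmod)" by auto
  then show "NF (mono (tr w)) = (W w :: 'k wmod)" by simp
  from nf_cases[OF t(1), where 'k = 'k] t(2) have "w \<in> HW' (leaves (tr w)) (tdeg gdeg (tr w))"
    using W_inj[where 'k = 'k] W_neq_0[where 'k = 'k] by auto
  then show "mono (tr w) \<in> supp (tset gens gar gdeg N p)"
    using t w by (intro supp_single) (auto simp: tset_def HW'_def HW_def)
qed

lemma NF_lift:
  fixes r :: "'k::field wmod"
  assumes "r \<in> supp (HW' N p)"
  shows "\<exists>f\<in>supp (tset gens gar gdeg N p). NF f = r"
proof
  show "lin (\<lambda>w. mono (tr w)) r \<in> supp (tset gens gar gdeg N p)"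
    by (rule supp_linmap[OF linmap_lin assms]) (use tr_tset(1) in simp)
  show "NF (lin (\<lambda>w. mono (tr w)) r) = r"
    by (rule linmap_eq_supp[OF assms, of "\<lambda>r. NF (lin (\<lambda>w. mono (tr w)) r)"])
      (use tr_tset(2)[where 'k = 'k] in \<open>auto intro!: linmap_comp[OF linmap_NF]\<close>)
qed

text \<open>\<open>Z_dd\<close> covers special entries only. For arbitrary words the identity is
  pulled back from trees, where the derivation argument has already proved it modulo the
  ideal.\<close>

lemma DW_DW: "r \<in> supp (HW' N p) \<Longrightarrow> DW (DW r) = 0"
proof -
  assume "r \<in> supp (HW' N p)"
  then obtain f where f: "f \<in> supp (tset gens gar gdeg N p)" "NF f = r" using NF_lift by blast
  have "NF (wu.D (wu.D f)) = 0" using dd_ideal[OF supp_wft[OF f(1)]] by (simp add: wu_ideal_iff)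
  then show ?thesis using supp_wft[OF f(1)] by (simp add: NF_dif dif_wft f(2))
qed

text \<open>The kernel of the linear extension \<open>FU\<close> is the ideal generated by \<open>1 - j\<close>.\<close>

fun full :: "wrd \<Rightarrow> wrd" where
  "full (End b) = J"
| "full (Gap b l w) = Gap True l (full w)"

definition FU :: "'k::field wmod \<Rightarrow> 'k wmod" where "FU = lin (\<lambda>w. W (full w))"

lemma linmap_FU [simp]: "linmap FU" by (simp add: FU_def)
lemma FU_single [simp]: "FU (single w c) = single (full w) c" by (simp add: FU_def)

lemma flag_full [simp]: "flag b (full w) = full w" "full (flag b w) = full w"
  by (cases w; simp)+

lemma full_plus [simp]: "full (v + w) = full v + full w"
  by (induction v w rule: plus_wrd.induct) auto

lemma full_inv [simp]: "wdeg (full w) = wdeg w" "wxc (full w) = wxc w" "wval (full w) = wval w"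
  "full (full w) = full w" "full w \<noteq> 0" "free_of_P (full w) = free_of_P w"
  by (induction w rule: full.induct) auto

lemma FU_mult: "FU (x * y) = FU x * FU y"
proof (rule linmap_eqI[of "\<lambda>x. FU (x * y)"])
  fix v
  show "FU (W v * y) = FU (W v) * FU y"
    by (rule linmap_eqI[of "\<lambda>y. FU (W v * y)"])
      (auto simp: W_mult intro!: linmap_comp[OF linmap_FU] linmap_mult_right linmap_mult_right')
qed (intro linmap_comp[OF linmap_FU] linmap_mult_left linmap_mult_left' linmap_FU)+

lemma J_FU: "W J * FU x = FU x"
  by (rule linmap_eqI[of "\<lambda>x. W J * FU x"]) (auto simp: W_mult intro!: linmap_mult_right')

lemma FU_J: "FU (W J * x) = FU x" "FU (x * W J) = FU x"
proof -
  show "FU (W J * x) = FU x" by (simp add: FU_mult J_FU)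
  have f: "full w + J = full w" for w by (induction w rule: full.induct) auto
  show "FU (x * W J) = FU x"
    by (rule linmap_eqI[of "\<lambda>x. FU (x * W J)"])
      (auto simp: W_mult f intro!: linmap_comp[OF linmap_FU] linmap_mult_left)
qed

lemma FU_End: "FU (W (End b) * x) = FU x"
proof (cases b)
  case False
  then show ?thesis using W_zero[where 'a = 'a] by (simp add: zero_wrd_def)
qed (simp add: FU_J)

lemma FU_FU [simp]: "FU (FU x) = FU x"
  by (rule linmap_eqI[of "\<lambda>x. FU (FU x)"]) (auto intro!: linmap_comp[OF linmap_FU])

text \<open>The ideal of \<open>u\<close> is stable under the differential because \<open>u\<close>
  is closed, so the differential descends to the quotient, modelled by words all of whose outer gaps
  contain \<open>j\<close>. Entries inside brackets are not changed by \<open>full\<close>.\<close>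

lemma FU_DW: "FU (DW (FU x)) = FU (DW x)"
proof (rule linmap_eqI[of "\<lambda>x. FU (DW (FU x))"])
  fix w
  have "FU (dw (full w)) = (FU (dw w) :: 'a wmod)"
  proof (induction w rule: full.induct)
    case (2 b l w)
    have lt: "full (Gap True l 0) = Gap True l J" "full (lw l) = Gap True l J" by (simp_all add: zero_wrd_def)
    show ?case
      by (simp add: FU_J FU_End) (simp add: linmap_add linmap_sc FU_mult 2)
  qed (simp_all add: linmap_zero)
  then show "FU (DW (FU (W w))) = (FU (DW (W w)) :: 'a wmod)" by simp
qed (intro linmap_comp[OF linmap_FU] linmap_comp[OF linmap_ops(1)] linmap_FU linmap_ops)+

lemma FU_HW': "x \<in> supp (HW N p) \<Longrightarrow> FU x \<in> supp (HW' N p)"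
  by (rule supp_linmap[OF linmap_FU]) (auto simp: HW_def HW'_def intro: supp_single)

lemma aug_FU [simp]: "aug (FU x) = aug x"
proof -
  have "lin (\<lambda>w. single () (if free_of_P w then 1 else 0)) (FU x) = lin (\<lambda>w. single () (if free_of_P w then 1 else 0)) x"
    by (rule linmap_eqI[of "\<lambda>x. lin _ (FU x)"]) (auto intro!: linmap_comp[OF linmap_lin])
  then show ?thesis by (simp add: aug_def)
qed

section \<open>The number of symbols 1 and the filtration by it\<close>

fun lon :: "letter \<Rightarrow> nat" and won :: "wrd \<Rightarrow> nat" where
  "lon LX = 0"
| "lon (LP as) = sum_list (map (\<lambda>a. if a = 0 then 1 else won a) as)"
| "won (End b) = 0"
| "won (Gap b l w) = lon l + won w"

abbreviation "wons as \<equiv> sum_list (map (\<lambda>a. if a = 0 then 1 else won a) as)"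

lemma won_plus [simp]: "won (v + w) = won v + won w"
proof -
  have "won (flag a w) = won w" for a w by (cases w) auto
  then show ?thesis by (induction v w rule: plus_wrd.induct) auto
qed

lemma won_full [simp]: "won (full w) = won w"
  by (induction w rule: full.induct) auto

lemma won_zero [simp]: "won 0 = 0" by (simp add: zero_wrd_def)

text \<open>A bracket with \<open>n \<ge> 2\<close> entries contributes degree \<open>1 - n\<close>
  and at most \<open>n \<le> 2 * (n - 1)\<close> symbols \<open>1\<close>, whence the factor 2. Any
  bound in terms of the degree would serve.\<close>

lemma ones_bound:
  "lval l \<Longrightarrow> int (lon l) \<le> - 2 * ldeg l"
  "wval w \<Longrightarrow> int (won w) \<le> - 2 * wdeg w"
proof (induction l and w rule: lval_wval.induct)
  case (2 as)
  have "\<forall>a\<in>set as. wval a \<and> (int (won a) \<le> - 2 * wdeg a)" using 2 by auto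
  then have "int (wons as) \<le> - 2 * wdegs as + int (length as)"
    by (induction as) auto
  moreover have "length as \<ge> 2" using 2 mixed_length[of as] by simp
  ultimately show ?case by simp
qed auto

text \<open>A valid bracket is mixed and so contributes at least one symbol
  \<open>1\<close>.\<close>

lemma won_pos: "wval w \<Longrightarrow> won w = 0 \<Longrightarrow> free_of_P w"
proof (induction w rule: full.induct)
  case (2 b l w)
  have "l = LX"
  proof (cases l)
    case (LP as)
    with 2 have "0 \<in> set as" "wons as = 0" by (auto simp: mixed_def)
    then show ?thesis by (auto simp: sum_list_eq_0_iff)
  qed simp
  with 2 show ?case by simp
qed auto

definition FR :: "nat \<Rightarrow> 'k::field wmod set" where "FR r = supp {w. r \<le> won w}"

lemma FR_mult: "x \<in> FR r \<Longrightarrow> y \<in> FR s \<Longrightarrow> x * y \<in> FR (r + s)"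
  unfolding FR_def by (erule (1) supp_mult) auto

lemma FR_W: "r \<le> won w \<Longrightarrow> W w \<in> FR r"
  unfolding FR_def by (rule supp_single) simp

lemma FR_FU: "x \<in> FR r \<Longrightarrow> FU x \<in> FR r"
  unfolding FR_def by (erule supp_linmap[OF linmap_FU]) (auto intro: supp_single)

lemmas FR_intros = supp_zero[of "{w. _ \<le> won w}", folded FR_def] supp_add[of _ "{w. _ \<le> won w}", folded FR_def]
  supp_sc[of _ "{w. _ \<le> won w}", folded FR_def] supp_sum[of _ _ "{w. _ \<le> won w}", folded FR_def]
  supp_minus[of _ "{w. _ \<le> won w}", folded FR_def] supp_diff[of _ "{w. _ \<le> won w}", folded FR_def]

text \<open>
  The part of the differential of a bracket that removes a symbol \<open>1\<close> acts on the first nonempty block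
  of consecutive symbols \<open>1\<close> as the differential of an acyclic complex, with contraction \<open>tt\<close>.
\<close>

fun lead :: "wrd list \<Rightarrow> nat" where
  "lead [] = 0"
| "lead (a # as) = (if a = 0 then Suc (lead as) else 0)"

fun tt :: "wrd list \<Rightarrow> 'k::field lmod" where
  "tt [] = 0"
| "tt (a # as) = (if a = 0 then (if even (lead as) then - Ls (0 # 0 # as) else 0) else - (Ls [a] * tt as))"

text \<open>Only merges of two adjacent symbols \<open>1\<close> are counted, with the opposite of
  their sign in \<open>mg\<close>. A block of \<open>m\<close> symbols also merges with its two
  neighbours, and the alternating sum of all \<open>m + 1\<close> terms is minus that of the inner
  \<open>m - 1\<close>. At the ends of the list a cut replaces the missing neighbour, modulo
  \<open>u\<close>, see \<open>FU_rho\<close>.\<close>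

fun d1 :: "wrd list \<Rightarrow> 'k::field lmod" where
  "d1 [] = 0"
| "d1 (a # as) = - (Ls [a] * d1 as) - (if a = 0 \<and> as \<noteq> [] \<and> hd as = 0 then Ls as else 0)"

definition TT :: "'k::field lmod \<Rightarrow> 'k lmod" where "TT = lin tt"
definition D1 :: "'k::field lmod \<Rightarrow> 'k lmod" where "D1 = lin d1"

lemma linmap_TT [simp]: "linmap TT" "linmap D1" by (simp_all add: TT_def D1_def)
lemma TT_single [simp]: "TT (single as c) = sc c (tt as)" "D1 (single as c) = sc c (d1 as)"
  by (simp_all add: TT_def D1_def)

lemma TT_D1_mult:
  "a \<noteq> 0 \<Longrightarrow> TT (Ls [a] * x) = - (Ls [a] * TT x)"
  "a \<noteq> 0 \<Longrightarrow> D1 (Ls [a] * x) = - (Ls [a] * D1 x)"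
  by (rule linmap_eqI[of "\<lambda>x. TT (Ls [a] * x)"] linmap_eqI[of "\<lambda>x. D1 (Ls [a] * x)"],
      auto simp: Ls_mult intro!: linmap_comp[OF linmap_TT(1)] linmap_comp[OF linmap_TT(2)] linmap_mult_right
        linmap_minus_left linmap_mult_right')+

lemma Ls_mult_supp: "x \<in> supp S \<Longrightarrow> (\<And>bs. bs \<in> S \<Longrightarrow> a # bs \<in> S') \<Longrightarrow> Ls [a] * x \<in> supp S'"
  by (rule supp_mult[of _ "{[a]}"]) (auto simp: plus_list_def intro: supp_single)

text \<open>On a leading block of length \<open>m\<close>, \<open>d1\<close> is an alternating sum
  of \<open>m - 1\<close> equal lists: minus the list with one symbol fewer if \<open>m\<close> is
  even and positive, and 0 otherwise. The remaining terms act behind the block and keep its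
  length.\<close>

lemma d1_lead:
  "d1 as + (if even (lead as) \<and> 0 < lead as then Ls (tl as) else 0)
    \<in> (supp {bs. even (lead bs) \<longleftrightarrow> even (lead as)} :: 'k::field lmod set)"
proof (induction as)
  case (Cons a as)
  let ?E = "d1 as + (if even (lead as) \<and> 0 < lead as then Ls (tl as) else 0) :: 'k lmod"
  show ?case
  proof (cases "a = 0")
    case False
    have "Ls [a] * d1 as \<in> (supp {bs. even (lead bs)} :: 'k lmod set)"
      by (rule Ls_mult_supp[of _ UNIV]) (use False in \<open>auto simp: supp_def\<close>)
    then show ?thesis using False by (simp add: supp_minus)
  next
    case True
    have "Ls [0] * ?E \<in> supp {bs. even (lead bs) \<longleftrightarrow> even (Suc (lead as))}"
      by (rule Ls_mult_supp[OF Cons.IH]) auto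
    moreover have "d1 (a # as) + (if even (lead (a # as)) \<and> 0 < lead (a # as) then Ls (tl (a # as)) else 0)
        = - (Ls [0] * ?E)"
      using True by (cases as) (auto simp: Ls_mult distrib_left)
    ultimately show ?thesis using True by (auto simp: supp_minus)
  qed
qed simp

lemma TT_odd: "x \<in> supp {bs. odd (lead bs)} \<Longrightarrow> TT x = - (Ls [0] * x)"
proof (erule linmap_eq_supp)
  fix bs assume "bs \<in> {bs. odd (lead bs)}"
  then show "TT (Ls bs) = - (Ls [0] * Ls bs)" by (cases bs) (auto simp: Ls_mult split: if_splits)
qed (intro linmap_TT linmap_minus_left linmap_mult_right)+

lemma TT_zero_odd: "x \<in> supp {bs. odd (lead bs)} \<Longrightarrow> TT (Ls [0] * x) = 0"
  by (erule linmap_eq_supp) (auto simp: Ls_mult intro!: linmap_comp[OF linmap_TT(1)] linmap_mult_right)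

text \<open>By \<open>d1_lead\<close>, blocks of even length are mapped isomorphically to blocks of
  odd length; \<open>tt\<close> goes back from odd to even length. Nonzero entries before the block
  only contribute signs, which \<open>tt\<close> and \<open>d1\<close> share.\<close>

lemma tt_contraction: "0 \<in> set as \<Longrightarrow> D1 (tt as) + TT (d1 as) = (Ls as :: 'k::field lmod)"
proof (induction as)
  case (Cons a as)
  show ?case
  proof (cases "a = 0")
    case False
    with Cons have IH: "D1 (tt as) + TT (d1 as) = (Ls as :: 'k lmod)" by auto
    have "D1 (tt (a # as)) + TT (d1 (a # as)) = (Ls [a] * (D1 (tt as) + TT (d1 as)) :: 'k lmod)"
      using False by (simp add: linmap_minus TT_D1_mult distrib_left)
    then show ?thesis unfolding IH by (simp add: Ls_mult)
  next
    case a: True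
    show ?thesis
    proof (cases "even (lead as)")
      case True
      have "d1 (0 # as) \<in> (supp {bs. odd (lead bs)} :: 'k lmod set)"
        using d1_lead[of "0 # as", where 'k = 'k] True by simp
      from TT_odd[OF this] show ?thesis
        using a True by (simp add: linmap_minus Ls_mult del: d1.simps(2)) (simp add: Ls_mult)
    next
      case False
      then have "d1 as \<in> (supp {bs. odd (lead bs)} :: 'k lmod set)"
        using d1_lead[of as, where 'k = 'k] by simp
      then have 1: "TT (Ls [0] * d1 as) = (0 :: 'k lmod)" by (rule TT_zero_odd)
      have 2: "TT (Ls as) = - (Ls [0] * Ls as :: 'k lmod)"
        by (rule TT_odd) (use False in \<open>auto intro: supp_single\<close>)
      have 3: "as \<noteq> []" "hd as = 0" using False by (cases as; auto split: if_splits)+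
      show ?thesis
        using a False 1 2 3 by (simp add: linmap_diff linmap_minus linmap_zero Ls_mult)
    qed
  qed
qed simp

definition SL :: "wrd list \<Rightarrow> nat \<Rightarrow> wrd list set" where
  "SL as n = {bs. filter (\<lambda>a. a \<noteq> 0) bs = filter (\<lambda>a. a \<noteq> 0) as \<and> length bs = n}"

lemma tt_SL: "tt as \<in> (supp (SL as (Suc (length as))) :: 'k::field lmod set)"
proof (induction as)
  case (Cons a as)
  show ?case
  proof (cases "a = 0")
    case False
    have "Ls [a] * tt as \<in> (supp (SL (a # as) (Suc (length (a # as)))) :: 'k lmod set)"
      by (rule Ls_mult_supp[OF Cons]) (use False in \<open>auto simp: SL_def\<close>)
    then show ?thesis using False by (simp add: supp_minus)
  qed (auto simp: SL_def intro!: supp_minus supp_single)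
qed simp

lemma d1_SL: "d1 as \<in> (supp (SL as (length as - 1)) :: 'k::field lmod set)"
proof (induction as)
  case (Cons a as)
  have "Ls [a] * d1 as \<in> (supp (SL (a # as) (length (a # as) - 1)) :: 'k lmod set)"
  proof (cases "as = []")
    case False
    show ?thesis by (rule Ls_mult_supp[OF Cons]) (use False in \<open>auto simp: SL_def\<close>)
  qed simp
  moreover have "(if a = 0 \<and> as \<noteq> [] \<and> hd as = 0 then Ls as else 0) \<in> (supp (SL (a # as) (length (a # as) - 1)) :: 'k lmod set)"
    by (auto simp: SL_def intro!: supp_single)
  ultimately show ?case by (simp only: d1.simps) (intro supp_diff supp_minus)
qed simp

lemma d1_zero_in: "0 \<in> set as \<Longrightarrow> d1 as \<in> (supp {bs. 0 \<in> set bs} :: 'k::field lmod set)"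
proof (induction as)
  case (Cons a as)
  have "Ls [a] * d1 as \<in> (supp {bs. 0 \<in> set bs} :: 'k lmod set)"
  proof (cases "a = 0")
    case True
    show ?thesis by (rule Ls_mult_supp[of _ UNIV]) (use True in \<open>auto simp: supp_def\<close>)
  next
    case False
    then show ?thesis using Cons by (intro Ls_mult_supp[of _ "{bs. 0 \<in> set bs}"]) auto
  qed
  moreover have "(if a = 0 \<and> as \<noteq> [] \<and> hd as = 0 then Ls as else 0) \<in> (supp {bs. 0 \<in> set bs} :: 'k lmod set)"
    by (cases as) (auto intro!: supp_single)
  ultimately show ?case by (simp only: d1.simps) (intro supp_diff supp_minus)
qed simp

lemma SL_sums:
  assumes "bs \<in> SL as n"
  shows "wdegs bs = wdegs as" "wxcs bs = wxcs as" "(\<forall>b\<in>set bs. wval b) \<longleftrightarrow> (\<forall>a\<in>set as. wval a)"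
    "int (wons bs) = int (wons as) + int n - int (length as)"
    "(\<exists>b\<in>set bs. b \<noteq> 0) \<longleftrightarrow> (\<exists>a\<in>set as. a \<noteq> 0)"
proof -
  have e: "filter (\<lambda>a. a \<noteq> 0) bs = filter (\<lambda>a. a \<noteq> 0) as" and l: "length bs = n"
    using assms by (auto simp: SL_def)
  have 1: "wdegs cs = wdegs (filter (\<lambda>a. a \<noteq> 0) cs)" "wxcs cs = wxcs (filter (\<lambda>a. a \<noteq> 0) cs)"
    "int (wons cs) = int (sum_list (map won (filter (\<lambda>a. a \<noteq> 0) cs))) + int (length cs)
       - int (length (filter (\<lambda>a. a \<noteq> 0) cs))" for cs
    by (induction cs) auto
  have 2: "(\<forall>b\<in>set cs. wval b) \<longleftrightarrow> (\<forall>b\<in>set (filter (\<lambda>a. a \<noteq> 0) cs). wval b)" for cs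
    by auto
  have 3: "(\<exists>b\<in>set cs. b \<noteq> 0) \<longleftrightarrow> set (filter (\<lambda>a. a \<noteq> 0) cs) \<noteq> {}" for cs
    by auto
  show "wdegs bs = wdegs as" "wxcs bs = wxcs as" "int (wons bs) = int (wons as) + int n - int (length as)"
    unfolding 1[of bs] 1[of as] e l by auto
  show "(\<forall>b\<in>set bs. wval b) \<longleftrightarrow> (\<forall>a\<in>set as. wval a)" unfolding 2[of bs] 2[of as] e ..
  show "(\<exists>b\<in>set bs. b \<noteq> 0) \<longleftrightarrow> (\<exists>a\<in>set as. a \<noteq> 0)" unfolding 3[of bs] 3[of as] e ..
qed

lemma da_zeros: "da as \<in> (supp {bs. map (\<lambda>a. a = 0) bs = map (\<lambda>a. a = 0) as} :: 'k::field lmod set)"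
proof (induction as)
  case (Cons a as)
  have "io (dw a) * Ls as \<in> (supp {bs. map (\<lambda>a. a = 0) bs = map (\<lambda>a. a = 0) (a # as)} :: 'k lmod set)"
  proof (cases "a = 0")
    case True
    then show ?thesis by (simp add: linmap_zero)
  next
    case False
    have "io (dw a) \<in> (supp {[b] | b. b \<noteq> 0} :: 'k lmod set)"
      by (rule supp_linmap[OF linmap_io dw_no_unit]) (auto intro: supp_single)
    then show ?thesis
      by (rule supp_mult[of _ _ _ "{as}"]) (use False in \<open>auto simp: plus_list_def intro: supp_single\<close>)
  qed
  moreover have "Ls [a] * da as \<in> (supp {bs. map (\<lambda>a. a = 0) bs = map (\<lambda>a. a = 0) (a # as)} :: 'k lmod set)"
    by (rule Ls_mult_supp[OF Cons]) auto
  ultimately show ?case by (auto intro!: supp_add supp_sc)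
qed simp

lemma lead_map: "map (\<lambda>a. a = 0) bs = map (\<lambda>a. a = 0) as \<Longrightarrow> lead bs = lead as"
proof -
  have "lead cs = length (takeWhile (\<lambda>b. b) (map (\<lambda>a. a = 0) cs))" for cs by (induction cs) auto
  then show "map (\<lambda>a. a = 0) bs = map (\<lambda>a. a = 0) as \<Longrightarrow> lead bs = lead as" by simp
qed

lemma DA_Ls_mult: "DA (Ls [a] * x) = io (dw a) * x + sc (pm (wdeg a)) (Ls [a] * DA x)"
  by (rule linmap_eqI[of "\<lambda>x. DA (Ls [a] * x)"])
    (auto simp: Ls_mult intro!: linmap_comp[OF linmap_ops(2)] linmap_mult_right linmap_plus linmap_sc_left
      linmap_mult_right' linmap_ops)

lemma TT_io: "x \<in> supp (- {0}) \<Longrightarrow> TT (io x * y) = - (io x * TT y)"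
  by (erule linmap_eq_supp)
    (auto simp: TT_D1_mult intro!: linmap_comp[OF linmap_TT(1)] linmap_mult_left' linmap_minus_left linmap_io)

text \<open>\<open>da\<close> keeps the pattern of symbols \<open>1\<close> and with it the parity
  tests in \<open>tt\<close>, while \<open>tt\<close> touches nothing but symbols \<open>1\<close>,
  which are closed of degree 0.\<close>

lemma DA_tt: "DA (tt as) = (TT (da as) :: 'k::field lmod)"
proof (induction as)
  case (Cons a as)
  show ?case
  proof (cases "a = 0")
    case False
    then show ?thesis
      using Cons by (simp add: linmap_minus linmap_add linmap_sc DA_Ls_mult TT_io[OF dw_no_unit] TT_D1_mult sc_minus)
  next
    case a: True
    have L: "Ls (0 # 0 # as) = (Ls [0] * (Ls [0] * Ls as) :: 'k lmod)" by (simp add: Ls_mult)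
    show ?thesis
    proof (cases "even (lead as)")
      case True
      have "Ls [0] * da as \<in> (supp {bs. odd (lead bs)} :: 'k lmod set)"
        by (rule Ls_mult_supp[OF da_zeros[of as]]) (use True in \<open>auto dest: lead_map\<close>)
      from TT_odd[OF this] show ?thesis
        using a True by (simp add: linmap_minus linmap_zero L DA_Ls_mult)
    next
      case False
      have "da as \<in> (supp {bs. odd (lead bs)} :: 'k lmod set)"
        by (rule supp_mono[OF da_zeros]) (use False in \<open>auto dest: lead_map\<close>)
      from TT_zero_odd[OF this] show ?thesis using a False by (simp add: linmap_zero)
    qed
  qed
qed (simp add: linmap_zero)

text \<open>What is left of the differential of a bracket besides the differential of its entries
  and the block differential \<open>d1\<close>. Modulo \<open>u\<close> it loses no symbol
  \<open>1\<close>, which makes it a term of higher filtration in the homotopy formula.\<close>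

definition rho :: "wrd list \<Rightarrow> 'k::field wmod" where
  "rho as = Br (mg as) + sp as - Br (d1 as)"

text \<open>Merging at the two ends of a list means dropping a symbol \<open>1\<close>; all other terms preserve the number
  of symbols \<open>1\<close>.\<close>

lemma mg_d1:
  "as \<noteq> [] \<Longrightarrow> mg as - d1 as - (if hd as = 0 then Ls (tl as) else 0)
      + sc (pm (int (length as) - 1)) (if last as = 0 then Ls (butlast as) else 0)
    \<in> (supp {bs. wons bs = wons as \<and> (\<exists>b\<in>set bs. b \<noteq> 0)} :: 'k::field lmod set)"
proof (induction as rule: mg.induct)
  case (1 a b cs)
  let ?X = "\<lambda>as. mg as - d1 as - (if hd as = 0 then Ls (tl as) else 0)
      + sc (pm (int (length as) - 1)) (if last as = 0 then Ls (butlast as) else 0) :: 'k lmod"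
  have IH: "?X (b # cs) \<in> supp {bs. wons bs = wons (b # cs) \<and> (\<exists>b\<in>set bs. b \<noteq> 0)}" using 1 by simp
  have bl: "butlast (a # b # cs) = a # butlast (b # cs)" "last (a # b # cs) = last (b # cs)" by simp_all
  have p: "pm (int (length (a # b # cs)) - 1) = - (pm (int (length (b # cs)) - 1) :: 'k)"
    by (simp add: pm_add)
  let ?c = "if a \<noteq> 0 \<and> b \<noteq> 0 then Ls ((a + b) # cs) else 0 :: 'k lmod"
  have "?X (a # b # cs) = ?c - Ls [a] * ?X (b # cs)"
    unfolding bl p
    by (cases "a = 0"; cases "b = 0"; cases "last (b # cs) = 0")
      (simp_all add: mult_single plus_list_def right_diff_distrib distrib_left single_uminus
        del: butlast.simps last.simps)
  moreover have "?c \<in> supp {bs. wons bs = wons (a # b # cs) \<and> (\<exists>b\<in>set bs. b \<noteq> 0)}"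
    by (auto intro!: supp_single)
  moreover have "Ls [a] * ?X (b # cs) \<in> supp {bs. wons bs = wons (a # b # cs) \<and> (\<exists>b\<in>set bs. b \<noteq> 0)}"
    by (rule Ls_mult_supp[OF IH]) auto
  ultimately show ?case by (simp only: supp_diff)
next
  case (2 a)
  then show ?case by simp
qed simp

lemma br_FR2:
  assumes "length bs \<noteq> 1"
  shows "(br bs :: 'k::field wmod) \<in> FR (wons bs)"
proof (cases "mixed bs")
  case True
  show ?thesis unfolding br_mixed[OF True] by (rule FR_W) simp
next
  case False
  show ?thesis unfolding br_pure[OF False assms] by (rule FR_intros(1))
qed

text \<open>The list \<open>[0]\<close> is the only exception, because \<open>p_1(1) = j\<close>
  loses its symbol.\<close>

lemma br_FR3: "bs \<noteq> [0] \<Longrightarrow> (br bs :: 'k::field wmod) \<in> FR (wons bs)"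
proof (cases "length bs = 1")
  case True
  assume "bs \<noteq> [0]"
  with True obtain b where b: "bs = [b]" "b \<noteq> 0" by (cases bs) auto
  show ?thesis unfolding b(1) br_one using b(2) by (intro FR_W) simp
qed (rule br_FR2)

lemma br_FR: "\<exists>b\<in>set bs. b \<noteq> 0 \<Longrightarrow> (br bs :: 'k::field wmod) \<in> FR (wons bs)"
  by (rule br_FR3) auto

lemma Br_FR:
  "x \<in> supp {bs. wons bs = n \<and> (\<exists>b\<in>set bs. b \<noteq> 0)} \<Longrightarrow> (Br x :: 'k::field wmod) \<in> FR n"
  unfolding FR_def by (erule supp_linmap[OF linmap_Br]) (use br_FR in \<open>auto simp: FR_def\<close>)

text \<open>A symbol \<open>1\<close> is lost only at the two ends of the list. There the end merge
  yields the shorter bracket \<open>b\<close>, and the cut yields \<open>j b\<close> or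
  \<open>b j\<close> with the opposite sign. Their sum is \<open>u b\<close> or \<open>b u\<close>
  up to sign, which \<open>FU\<close> annihilates.\<close>

lemma FU_rho:
  assumes m: "mixed as"
  shows "FU (rho as) \<in> (FR (wons as) :: 'k::field wmod set)"
proof -
  define n where "n = length as"
  have n: "n \<ge> 2" using mixed_length[OF m] by (simp add: n_def)
  then have ne: "as \<noteq> []" by (auto simp: n_def)
  let ?X = "mg as - d1 as - (if hd as = 0 then Ls (tl as) else 0)
      + sc (pm (int (length as) - 1)) (if last as = 0 then Ls (butlast as) else 0) :: 'k lmod"
  define tm where "tm = (\<lambda>l. sc (pm (int l) * pm ((int n - int l - 1) * wdegs (take l as)))
       (br (take l as) * br (drop l as)) :: 'k wmod)"
  \<comment> \<open>The end merges are attached to the cuts they cancel with: \<open>l = 1\<close>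
    for the first entry, \<open>l = n - 1\<close> for the last. For \<open>n = 2\<close> these are
    the same cut.\<close>
  define s where "s = (\<lambda>l. tm l + (if l = 1 then (if hd as = 0 then br (tl as) else 0) else 0)
    - (if l = n - 1 then sc (pm (int n - 1)) (if last as = 0 then br (butlast as) else 0) else 0))"
  have "rho as = Br ?X + (sp as + (if hd as = 0 then br (tl as) else 0)
      - sc (pm (int n - 1)) (if last as = 0 then br (butlast as) else 0))"
    by (auto simp: rho_def n_def linmap_add[OF linmap_Br] linmap_diff[OF linmap_Br] linmap_sc[OF linmap_Br] linmap_zero)
  also have "sp as + (if hd as = 0 then br (tl as) else 0)
      - sc (pm (int n - 1)) (if last as = 0 then br (butlast as) else 0) = (\<Sum>l\<in>{1..<n}. s l)"
  proof -
    have "sp as = sum tm {1..<n}" by (simp add: sp_def tm_def n_def)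
    moreover have "Suc 0 < n" "Suc 0 \<le> n - Suc 0" "n - Suc 0 < n" using n by auto
    ultimately show ?thesis using n by (auto simp add: s_def sum.distrib sum_subtractf simp del: sum.op_ivl_Suc)
  qed
  finally have rho: "rho as = Br ?X + (\<Sum>l\<in>{1..<n}. s l)" .
  have "FU (Br ?X) \<in> FR (wons as)" using ne by (intro FR_FU Br_FR mg_d1)
  moreover have "FU (s l) \<in> FR (wons as)" if l: "l \<in> {1..<n}" for l
  proof -
    have w: "wons (take l as) + wons (drop l as) = wons as"
      using arg_cong[OF append_take_drop_id[of l as], of "\<lambda>as. wons as"]
      by (simp only: map_append sum_list_append)
    have one: "xs = [0] \<longleftrightarrow> length xs = 1 \<and> hd xs = 0" "xs = [0] \<longleftrightarrow> length xs = 1 \<and> last xs = 0" for xs :: "wrd list"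
      by (cases xs, auto)+
    have t1: "take l as = [0] \<longleftrightarrow> l = 1 \<and> hd as = 0"
      unfolding one(1) using l by (auto simp: n_def hd_take)
    have t2: "drop l as = [0] \<longleftrightarrow> l = n - 1 \<and> last as = 0"
    proof -
      have "length (drop l as) = 1 \<longleftrightarrow> l = n - 1" using l by (auto simp: n_def)
      moreover have "last (drop l as) = last as" using l by (simp add: n_def)
      ultimately show ?thesis unfolding one(2) by simp
    qed
    consider "take l as \<noteq> [0]" "drop l as \<noteq> [0]" | "take l as = [0]" | "drop l as = [0]" by blast
    then show ?thesis
    proof cases
      case 1
      then have "tm l \<in> FR (wons as)"
        unfolding tm_def w[symmetric] by (intro FR_intros(3) FR_mult br_FR3)
      moreover have "s l = tm l" using 1 t1 t2 by (auto simp: s_def)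
      ultimately show ?thesis by (simp add: FR_FU)
    next
      case 2
      then have l1: "l = 1" "hd as = 0" using t1 by auto
      have "drop l as \<noteq> [0]"
      proof
        assume "drop l as = [0]"
        with 2 have "as = [0, 0]" by (metis append_take_drop_id append_Cons append_Nil)
        then show False using m by (auto simp: mixed_def)
      qed
      then have "s l = br (tl as) - W J * br (tl as)"
        using l1 t2 2 by (auto simp: s_def tm_def drop_Suc sc_minus_left)
      then show ?thesis by (simp add: linmap_diff FU_J FR_intros(1))
    next
      case 3
      then have l1: "l = n - 1" "last as = 0" using t2 by auto
      have nt: "\<not> (l = 1 \<and> hd as = 0)"
      proof
        assume "l = 1 \<and> hd as = 0"
        then have "take l as = [0]" using t1 by simp
        with 3 have "as = [0, 0]" by (metis append_take_drop_id append_Cons append_Nil)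
        then show False using m by (auto simp: mixed_def)
      qed
      have bl: "butlast as = take l as" using l1 by (simp add: butlast_conv_take n_def)
      have "s l = sc (pm (int n - 1)) (br (take l as) * W J - br (take l as))"
        using l1 nt 3 n unfolding s_def tm_def bl by (auto simp: of_nat_diff sc_diff)
      then show ?thesis by (simp add: linmap_diff FU_J FR_intros(1) linmap_sc linmap_zero)
    qed
  qed
  ultimately show ?thesis
    unfolding rho by (simp only: linmap_add[OF linmap_FU] linmap_sum[OF linmap_FU]) (intro FR_intros(2,4))
qed

text \<open>\<open>tt\<close> applied to the first bracket of the word; inputs before it have degree
  0 and cause no sign. The gaps up to this bracket lose their \<open>j\<close>, which is invisible
  after \<open>FU\<close>.\<close>

fun th :: "wrd \<Rightarrow> 'k::field wmod" where
  "th (End b) = 0"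
| "th (Gap b LX w) = W (lw LX) * th w"
| "th (Gap b (LP as) w) = Br (tt as) * W w"

definition TH :: "'k::field wmod \<Rightarrow> 'k wmod" where "TH = lin th"

lemma linmap_TH [simp]: "linmap TH" by (simp add: TH_def)
lemma TH_single [simp]: "TH (single w c) = sc c (th w)" by (simp add: TH_def)

lemma th_flag [simp]: "th (flag b w) = th w"
  by (cases w rule: th.cases) auto

lemma FU_TH: "FU (TH (FU x)) = FU (TH x)"
proof (rule linmap_eqI[of "\<lambda>x. FU (TH (FU x))"])
  fix w
  have "FU (th (full w)) = (FU (th w) :: 'a wmod)"
    by (induction w rule: th.induct) (simp_all add: FU_mult)
  then show "FU (TH (FU (W w))) = (FU (TH (W w)) :: 'a wmod)" by simp
qed (intro linmap_comp[OF linmap_FU] linmap_comp[OF linmap_TH] linmap_FU linmap_TH)+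

lemma br_tt_FR:
  assumes "as \<noteq> []"
  shows "(Br (tt as) :: 'k::field wmod) \<in> FR (Suc (wons as))"
  unfolding FR_def
proof (rule supp_linmap[OF linmap_Br tt_SL])
  fix bs assume bs: "bs \<in> SL as (Suc (length as))"
  then have "length bs \<noteq> 1" using assms by (auto simp: SL_def)
  moreover have "wons bs = Suc (wons as)" using SL_sums(4)[OF bs] by simp
  ultimately show "Br (Ls bs) \<in> (supp {w. Suc (wons as) \<le> won w} :: 'k wmod set)"
    using br_FR2[of bs, where 'k = 'k] by (simp add: FR_def)
qed

lemma th_FR: "(th w :: 'k::field wmod) \<in> FR (Suc (won w))"
proof (induction w rule: th.induct)
  case (2 b w)
  have "W (lw LX) * th w \<in> (FR (0 + Suc (won w)) :: 'k wmod set)"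
    by (intro FR_mult 2 FR_W) simp
  then show ?case by simp
next
  case (3 b as w)
  show ?case
  proof (cases "as = []")
    case False
    have "Br (tt as) * W w \<in> (FR (Suc (wons as) + won w) :: 'k wmod set)"
      by (intro FR_mult br_tt_FR False FR_W) simp
    then show ?thesis by simp
  qed (simp add: linmap_zero FR_intros(1))
qed (simp add: FR_intros(1))

lemma FR_mono: "x \<in> FR r \<Longrightarrow> s \<le> r \<Longrightarrow> x \<in> FR s"
  unfolding FR_def by (erule supp_mono) auto

lemma TH_FR: "x \<in> FR r \<Longrightarrow> TH x \<in> (FR (Suc r) :: 'k::field wmod set)"
  unfolding FR_def
proof (erule supp_linmap[OF linmap_TH])
  fix w assume "w \<in> {w. r \<le> won w}"
  then show "TH (W w) \<in> (supp {w. Suc r \<le> won w} :: 'k wmod set)"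
    using FR_mono[OF th_FR[of w, where 'k = 'k], of "Suc r"] by (simp add: FR_def)
qed

lemma th_HW': "wval w \<Longrightarrow> (th w :: 'k::field wmod) \<in> supp (HW' (wxc w) (wdeg w - 1))"
proof (induction w rule: th.induct)
  case (2 b w)
  have "W (lw LX) * th w \<in> (supp (HW' (1 + wxc w) (0 + (wdeg w - 1))) :: 'k wmod set)"
    using 2 by (intro HW'_mult_right supp_single) (auto simp: HW_def)
  then show ?case by simp
next
  case (3 b as w)
  have "tt as \<in> (supp (HL (Suc (length as)) (wxcs as) (wdegs as)) :: 'k lmod set)"
  proof (rule supp_mono[OF tt_SL], rule subsetI)
    fix bs assume bs: "bs \<in> SL as (Suc (length as))"
    then have "length bs = Suc (length as)" by (simp add: SL_def)
    with SL_sums[OF bs] 3 show "bs \<in> HL (Suc (length as)) (wxcs as) (wdegs as)" by (auto simp: HL_def)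
  qed
  from Br_HW'[OF this] have "Br (tt as) \<in> (supp (HW' (wxcs as) (wdegs as + 1 - int (Suc (length as)))) :: 'k wmod set)" .
  then have "Br (tt as) * W w \<in> (supp (HW' (wxcs as + wxc w) (wdegs as + 1 - int (Suc (length as)) + wdeg w)) :: 'k wmod set)"
    using 3 by (intro HW'_mult_left W_HW) auto
  then show ?case by (simp add: algebra_simps)
qed simp

lemma TH_HW': "x \<in> supp (HW N p) \<Longrightarrow> TH x \<in> supp (HW' N (p - 1))"
  by (rule supp_linmap[OF linmap_TH]) (use th_HW' in \<open>auto simp: HW_def\<close>)

lemma TH_X_mult: "TH (W (lw LX) * y) = W (lw LX) * TH y"
proof (rule linmap_eqI[of "\<lambda>y. TH (W (lw LX) * y)"])
  fix w :: wrd
  have "lw LX + w = Gap False LX w" by (simp add: zero_wrd_def)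
  then show "TH (W (lw LX) * W w) = W (lw LX) * TH (W w)" by (simp add: W_mult)
qed (intro linmap_comp[OF linmap_TH] linmap_mult_right linmap_mult_right' linmap_TH)+

lemma TH_Br_mult: "z \<in> supp {bs. mixed bs} \<Longrightarrow> TH (Br z * y) = (Br (TT z) * y :: 'k::field wmod)"
proof (erule linmap_eq_supp)
  fix bs assume "bs \<in> {bs. mixed bs}"
  then have b: "br bs = (W (lw (LP bs)) :: 'k wmod)" by (simp add: br_mixed)
  show "TH (Br (Ls bs) * y) = (Br (TT (Ls bs)) * y :: 'k wmod)"
  proof (rule linmap_eqI[of "\<lambda>y. TH (Br (Ls bs) * y)"])
    fix w :: wrd
    have "lw (LP bs) + w = Gap False (LP bs) w" by (simp add: zero_wrd_def)
    then show "TH (Br (Ls bs) * W w) = (Br (TT (Ls bs)) * W w :: 'k wmod)" by (simp add: W_mult b)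
  qed (intro linmap_comp[OF linmap_TH] linmap_mult_right)+
qed (intro linmap_comp[OF linmap_TH] linmap_mult_left' linmap_comp[OF linmap_Br] linmap_Br linmap_TT)+

lemma TH_J_mult: "TH (W (End b) * y) = TH y"
  by (rule linmap_eqI[of "\<lambda>y. TH (W (End b) * y)"])
    (auto simp: W_mult intro!: linmap_comp[OF linmap_TH] linmap_mult_right)

lemma tt_mixed: "mixed as \<Longrightarrow> (tt as :: 'k::field lmod) \<in> supp {bs. mixed bs \<and> length bs = Suc (length as) \<and> wons bs = Suc (wons as) \<and> wdegs bs = wdegs as}"
proof -
  assume m: "mixed as"
  have z: "(tt as :: 'k lmod) \<in> supp {bs. 0 \<in> set bs}" for as
  proof (induction as)
    case (Cons a as)
    then show ?case by (auto intro!: supp_minus supp_single Ls_mult_supp[of _ "{bs. 0 \<in> set bs}"])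
  qed simp
  have "keys (tt as :: 'k lmod) \<subseteq> SL as (Suc (length as)) \<inter> {bs. 0 \<in> set bs}"
    using tt_SL[of as, where 'k = 'k] z[of as] by (auto simp: supp_def)
  moreover have "mixed bs \<and> length bs = Suc (length as) \<and> wons bs = Suc (wons as) \<and> wdegs bs = wdegs as"
    if "bs \<in> SL as (Suc (length as)) \<inter> {bs. 0 \<in> set bs}" for bs
    using that m SL_sums[of bs as "Suc (length as)"] by (auto simp: mixed_def SL_def)
  ultimately show ?thesis by (auto simp: supp_def)
qed

lemma d1_mixed: "mixed as \<Longrightarrow> (d1 as :: 'k::field lmod) \<in> supp {bs. mixed bs}"
proof -
  assume m: "mixed as"
  have "keys (d1 as :: 'k lmod) \<subseteq> SL as (length as - 1) \<inter> {bs. 0 \<in> set bs}"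
    using d1_SL[of as, where 'k = 'k] d1_zero_in[of as, where 'k = 'k] m by (auto simp: supp_def mixed_def)
  moreover have "mixed bs" if "bs \<in> SL as (length as - 1) \<inter> {bs. 0 \<in> set bs}" for bs
    using that m SL_sums(5)[of bs as "length as - 1"] by (auto simp: mixed_def)
  ultimately show ?thesis by (auto simp: supp_def)
qed

lemma da_mixed: "mixed as \<Longrightarrow> (da as :: 'k::field lmod) \<in> supp {bs. mixed bs}"
proof (rule supp_mono[OF da_zeros], rule subsetI)
  fix bs :: "wrd list" assume m: "mixed as" and "bs \<in> {bs. map (\<lambda>a. a = 0) bs = map (\<lambda>a. a = 0) as}"
  then have "(\<lambda>a. a = 0) ` set bs = (\<lambda>a. a = 0) ` set as" by (metis (mono_tags) list.set_map mem_Collect_eq)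
  with m show "bs \<in> {bs. mixed bs}" unfolding mixed_def by (auto simp: set_eq_iff image_iff)
qed

lemma DW_Br_mixed:
  assumes "x \<in> supp {bs. mixed bs \<and> length bs = n}"
  shows "DW (Br x) = (sc (pm (int n - 1)) (Br (DA x)) + Br (D1 x) + lin rho x :: 'k::field wmod)"
proof (rule linmap_eq_supp[OF assms])
  fix bs assume "bs \<in> {bs. mixed bs \<and> length bs = n}"
  then have b: "mixed bs" "length bs = n" "bs \<noteq> []" using mixed_length by fastforce+
  show "DW (Br (Ls bs)) = (sc (pm (int n - 1)) (Br (DA (Ls bs))) + Br (D1 (Ls bs)) + lin rho (Ls bs) :: 'k wmod)"
    using DW_br[OF b(3), where 'k = 'k] b(2) by (simp add: rho_def add.assoc)
qed (intro linmap_comp[OF linmap_ops(1)] linmap_plus linmap_sc_left linmap_comp[OF linmap_Br] linmap_Br linmap_ops linmap_TT linmap_lin)+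

text \<open>Modulo \<open>u\<close>, \<open>th\<close> contracts the part of the differential that
  drops one symbol \<open>1\<close>. The hypothesis \<open>1 \<le> won w\<close> provides a bracket
  to act on; inputs in front of it are passed by induction.\<close>

theorem th_homotopy:
  "wval w \<Longrightarrow> 1 \<le> won w \<Longrightarrow>
    FU (DW (th w) + TH (dw w)) - FU (W w) \<in> (FR (Suc (won w)) :: 'k::field wmod set)"
proof (induction w rule: th.induct)
  case (2 b w)
  let ?X = "W (lw LX) :: 'k wmod"
  have IH: "FU (DW (th w) + TH (dw w)) - FU (W w) \<in> (FR (Suc (won w)) :: 'k wmod set)" using 2 by simp
  have "W (Gap b LX w) = (W (End b) * (?X * W w) :: 'k wmod)" by (simp add: W_mult)
  then have "FU (DW (th (Gap b LX w)) + TH (dw (Gap b LX w))) - FU (W (Gap b LX w))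
      = FU ?X * (FU (DW (th w) + TH (dw w)) - FU (W w))"
    by (simp only: th.simps dw.simps dl.simps TH_J_mult FU_End FU_mult)
      (simp add: DW_W_mult TH_X_mult linmap_add FU_mult algebra_simps W_mult)
  also have "\<dots> \<in> FR (0 + Suc (won w))"
    by (intro FR_mult IH FR_FU FR_W) simp
  finally show ?case by simp
next
  case (3 b as w)
  let ?n = "int (length as)" and ?L = "W (lw (LP as)) :: 'k wmod"
  have m: "mixed as" and v: "\<forall>a\<in>set as. wval a" using 3 by auto
  then have ne: "as \<noteq> []" by (auto simp: mixed_def)
  have tms: "(tt as :: 'k lmod) \<in> supp {bs. mixed bs \<and> length bs = Suc (length as)}"
    by (rule supp_mono[OF tt_mixed[OF m]]) auto
  have bt: "DW (Br (tt as)) = sc (pm ?n) (Br (TT (da as))) + Br (D1 (tt as)) + lin rho (tt as :: 'k lmod)"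
    using DW_Br_mixed[OF tms] by (simp add: DA_tt)
  have dl: "dl (LP as) = sc (pm (?n - 1)) (Br (da as)) + Br (d1 as) + (rho as :: 'k wmod)"
    by (simp add: rho_def)
  have "DW (Br (tt as) * W w) = DW (Br (tt as)) * W w + sc (pm (ldeg (LP as) - 1)) (Br (tt as) * dw w :: 'k wmod)"
  proof -
    have "Br (tt as) \<in> (supp {v. wdeg v = ldeg (LP as) - 1} :: 'k wmod set)"
      by (rule supp_linmap[OF linmap_Br tt_mixed[OF m]]) (auto simp: br_mixed intro!: supp_single)
    then show ?thesis
      by (rule linmap_eq_supp[where A = "\<lambda>x. DW (x * W w)"])
        (auto simp: W_mult dw_plus intro!: linmap_comp[OF linmap_ops(1)] linmap_mult_left linmap_plus
          linmap_sc_left linmap_mult_left' linmap_ops)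
  qed
  moreover have "TH (dw (Gap b (LP as) w)) = TH (dl (LP as) * W w) + sc (pm (ldeg (LP as))) (Br (tt as) * dw w :: 'k wmod)"
    using TH_Br_mult[of "Ls as :: 'k lmod" "dw w"] m
    by (simp add: TH_J_mult linmap_add linmap_sc br_mixed supp_single del: dl.simps)
  moreover have "TH (dl (LP as) * W w) = sc (pm (?n - 1)) (Br (TT (da as)) * W w)
      + Br (TT (d1 as)) * W w + TH (rho as * W w :: 'k wmod)"
    unfolding dl using TH_Br_mult[OF da_mixed[OF m], where 'k = 'k] TH_Br_mult[OF d1_mixed[OF m], where 'k = 'k]
    by (simp add: distrib_right linmap_add linmap_sc sc_mult_left)
  \<comment> \<open>The terms with \<open>da\<close> cancel by \<open>DA_tt\<close>, and those with
    \<open>dw w\<close> because \<open>th\<close> shifts the degree by one. Besides the block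
    contraction only \<open>rho\<close> contributes.\<close>
  ultimately have "DW (th (Gap b (LP as) w)) + TH (dw (Gap b (LP as) w))
      = Br (D1 (tt as) + TT (d1 as)) * W w + (lin rho (tt as) * W w + TH (rho as * W w) :: 'k wmod)"
    unfolding th.simps bt
    by (simp add: distrib_right sc_mult_left pm_diff pm_add sc_minus_left linmap_add[OF linmap_Br] add_ac)
  also have "D1 (tt as) + TT (d1 as) = (Ls as :: 'k lmod)" using m by (intro tt_contraction) (auto simp: mixed_def)
  finally have E: "DW (th (Gap b (LP as) w)) + TH (dw (Gap b (LP as) w))
      = ?L * W w + (lin rho (tt as) * W w + TH (rho as * W w) :: 'k wmod)"
    by (simp add: br_mixed[OF m])
  have "W (Gap b (LP as) w) = W (End b) * (?L * W w)" by (simp add: W_mult)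
  then have "FU (W (Gap b (LP as) w)) = FU (?L * W w)" by (simp only: FU_End)
  then have "FU (DW (th (Gap b (LP as) w)) + TH (dw (Gap b (LP as) w))) - FU (W (Gap b (LP as) w))
      = FU (lin rho (tt as :: 'k lmod)) * FU (W w) + FU (TH (FU (rho as) * FU (W w)))"
    unfolding E linmap_add[OF linmap_FU] FU_TH[of "rho as * W w", symmetric] FU_mult[of "rho as", symmetric]
    by (simp add: FU_mult)
  also have "\<dots> \<in> FR (Suc (wons as) + won w)"
  proof (intro FR_intros(2) FR_mult)
    show "FU (lin rho (tt as)) \<in> (FR (Suc (wons as)) :: 'k wmod set)"
      unfolding FR_def
    proof (rule supp_linmap[OF linmap_comp[OF linmap_FU linmap_lin] tt_mixed[OF m]])
      fix bs assume "bs \<in> {bs. mixed bs \<and> length bs = Suc (length as) \<and> wons bs = Suc (wons as) \<and> wdegs bs = wdegs as}"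
      then show "FU (lin rho (Ls bs)) \<in> (supp {w. Suc (wons as) \<le> won w} :: 'k wmod set)"
        using FU_rho[of bs, where 'k = 'k] by (simp add: FR_def)
    qed
    show "FU (W w) \<in> (FR (won w) :: 'k wmod set)" by (intro FR_FU FR_W) simp
    then have "TH (FU (rho as) * FU (W w)) \<in> (FR (Suc (wons as + won w)) :: 'k wmod set)"
      by (intro TH_FR FR_mult FU_rho m)
    then show "FU (TH (FU (rho as) * FU (W w))) \<in> (FR (Suc (wons as) + won w) :: 'k wmod set)"
      by (simp add: FR_FU)
  qed
  finally show ?case by simp
qed simp

text \<open>Subtracting the boundary of \<open>TH (FU x)\<close> clears the lowest filtration level.
  The other half of the homotopy, \<open>TH (DW (FU x))\<close>, vanishes modulo \<open>u\<close>
  because \<open>x\<close> is a cocycle there.\<close>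

lemma contraction_step:
  fixes x :: "'k::field wmod"
  assumes x: "x \<in> supp (HW' N p)" and d: "FU (DW x) = 0" and r: "FU x \<in> FR r" "1 \<le> r"
  shows "\<exists>y\<in>supp (HW' N (p - 1)). FU (x - DW y) \<in> FR (Suc r)"
proof
  note F = FU_HW'[OF HW'_HW[OF x]]
  show "TH (FU x) \<in> supp (HW' N (p - 1))" by (intro TH_HW' HW'_HW F)
  have "FU (DW (TH (FU x)) + TH (DW (FU x))) - FU (FU x) \<in> supp {w. Suc r \<le> won w}"
  proof (rule supp_linmap[where A = "\<lambda>z. FU (DW (TH z) + TH (DW z)) - FU z" and S = "{w. wval w \<and> r \<le> won w}"])
    show "linmap (\<lambda>z :: 'k wmod. FU (DW (TH z) + TH (DW z)) - FU z)"
      by (intro linmap_sub linmap_comp[OF linmap_FU] linmap_plus linmap_comp[OF linmap_ops(1)]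
          linmap_comp[OF linmap_TH] linmap_FU linmap_TH linmap_ops)
    show "FU x \<in> supp {w. wval w \<and> r \<le> won w}"
      using F r(1) by (auto simp: supp_def FR_def HW'_def HW_def)
    fix w assume w: "w \<in> {w. wval w \<and> r \<le> won w}"
    then have "FU (DW (th w) + TH (dw w)) - FU (W w) \<in> (FR (Suc r) :: 'k wmod set)"
      using r(2) by (intro FR_mono[OF th_homotopy]) auto
    then show "FU (DW (TH (W w)) + TH (DW (W w))) - FU (W w) \<in> (supp {w. Suc r \<le> won w} :: 'k wmod set)"
      by (simp add: FR_def)
  qed
  moreover have "FU (TH (DW (FU x))) = 0"
    using FU_TH[of "DW (FU x)"] by (simp add: FU_DW d linmap_zero)
  ultimately have "- (FU (DW (TH (FU x))) - FU x) \<in> FR (Suc r)"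
    unfolding FR_def by (intro supp_minus) (simp add: linmap_add)
  then show "FU (x - DW (TH (FU x))) \<in> FR (Suc r)" by (simp add: linmap_diff)
qed

text \<open>In a given arity there is just one full word without brackets, and its coefficient in
  \<open>FU x\<close> is \<open>aug x\<close>.\<close>

lemma aug_FR:
  fixes x :: "'k::field wmod"
  assumes x: "x \<in> supp (HW' N p)" and a: "aug x = 0"
  shows "FU x \<in> FR 1"
proof -
  have uniq: "full v = full w" if "free_of_P v" "free_of_P w" "wxc v = wxc w" for v w
    using that
  proof (induction v arbitrary: w rule: free_of_P.induct)
    case (1 b)
    then show ?case by (cases w) auto
  next
    case (2 b l v)
    then show ?case by (cases w) auto
  qed
  have k: "keys (FU x) \<subseteq> full ` {w. wval w \<and> wxc w = N}"
  proof -
    have "FU x \<in> supp (full ` {w. wval w \<and> wxc w = N})"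
      by (rule supp_linmap[OF linmap_FU x]) (auto simp: HW'_def HW_def intro!: supp_single)
    then show ?thesis by (simp add: supp_def)
  qed
  have "1 \<le> won v" if v: "v \<in> keys (FU x)" for v
  proof (rule ccontr)
    assume "\<not> 1 \<le> won v"
    obtain w where w: "v = full w" "wval w" "wxc w = N" using v k by auto
    then have f: "free_of_P v" using \<open>\<not> 1 \<le> won v\<close> by (intro won_pos) auto
    have eq: "u = v" if u: "u \<in> keys (FU x)" "free_of_P u" for u
    proof -
      obtain w' where "u = full w'" "wxc w' = N" using u(1) k by auto
      with w f u(2) show ?thesis using uniq[of w w'] by auto
    qed
    have "aug (FU x) = (\<Sum>u\<in>keys (FU x). if u = v then lookup (FU x) u else 0)"
      unfolding aug_expand
    proof (rule sum.cong)
      fix u assume "u \<in> keys (FU x)"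
      then have "free_of_P u \<longleftrightarrow> u = v" using eq f by blast
      then show "(if free_of_P u then lookup (FU x) u else 0) = (if u = v then lookup (FU x) u else 0)" by simp
    qed simp
    also have "\<dots> = lookup (FU x) v" using v by (simp add: sum.delta)
    finally show False using a v by (simp add: in_keys_iff)
  qed
  then show ?thesis by (auto simp: FR_def supp_def)
qed

lemma cocycle_to_kernel:
  fixes x :: "'k::field wmod"
  assumes x: "x \<in> supp (HW' N p)" and d: "DW x = 0" and a: "aug x = 0"
  shows "\<exists>y\<in>supp (HW' N (p - 1)). FU (x - DW y) = 0"
proof -
  have s: "\<exists>y\<in>supp (HW' N (p - 1)). FU (x - DW y) \<in> FR (Suc r)" for r
  proof (induction r)
    case 0
    show ?case using aug_FR[OF x a] by (intro bexI[of _ 0]) (simp_all add: linmap_zero)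
  next
    case (Suc r)
    then obtain y where y: "y \<in> supp (HW' N (p - 1))" "FU (x - DW y) \<in> FR (Suc r)" by blast
    have xy: "x - DW y \<in> supp (HW' N p)" using DW_supp[OF HW'_HW[OF y(1)]] x by (simp add: supp_diff)
    have "FU (DW (x - DW y)) = 0" using DW_DW[OF y(1)] d by (simp add: linmap_diff linmap_zero)
    from contraction_step[OF xy this y(2)] obtain z where
      z: "z \<in> supp (HW' N (p - 1))" "FU (x - DW y - DW z) \<in> FR (Suc (Suc r))" by auto
    then show ?case using y(1) by (intro bexI[of _ "y + z"]) (simp_all add: linmap_add diff_diff_eq supp_add)
  qed
  \<comment> \<open>By \<open>ones_bound\<close>, a valid word of degree \<open>p\<close> has at
    most \<open>- 2 * p\<close> symbols \<open>1\<close>, so one more step leaves no word at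
    all.\<close>
  from s[of "nat (- 2 * p)"] obtain y where
    y: "y \<in> supp (HW' N (p - 1))" "FU (x - DW y) \<in> FR (Suc (nat (- 2 * p)))" by blast
  have xy: "x - DW y \<in> supp (HW' N p)" using DW_supp[OF HW'_HW[OF y(1)]] x by (simp add: supp_diff)
  have "keys (FU (x - DW y)) \<subseteq> {}"
  proof
    fix w assume w: "w \<in> keys (FU (x - DW y))"
    then have "wval w" "wdeg w = p" using FU_HW'[OF HW'_HW[OF xy]] by (auto simp: supp_def HW'_def HW_def)
    moreover have "Suc (nat (- 2 * p)) \<le> won w" using y(2) w by (auto simp: FR_def supp_def)
    ultimately show "w \<in> {}" using ones_bound(2)[of w] by linarith
  qed
  then have "FU (x - DW y) = 0" by (metis keys_eq_empty subset_empty)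
  with y(1) show ?thesis by blast
qed

text \<open>\<open>pf f\<close> allows \<open>f\<close> as the part of a word before the first gap with \<open>u = 1 - j\<close>.\<close>

fun pf :: "wrd \<Rightarrow> bool" where
  "pf (End b) = False"
| "pf (Gap b l w) = (b \<and> (w = 0 \<or> pf w))"

text \<open>On \<open>f u y\<close> the contraction should be \<open>f u p_2(1, u y)\<close> up to
  the sign of \<open>f\<close>. Summing over all cuts behind a letter gives a linear map on all
  words which has this value, by \<open>GM_pf\<close>.\<close>

fun gm :: "wrd \<Rightarrow> 'k::field wmod" where
  "gm (End b) = 0"
| "gm (Gap b l w) = sc (pm (ldeg l)) (W (Gap True l 0) * (uu * lb (uu * W w) + gm w))"

definition GM :: "'k::field wmod \<Rightarrow> 'k wmod" where "GM = lin gm"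

lemma linmap_GM [simp]: "linmap GM" by (simp add: GM_def)
lemma GM_single [simp]: "GM (single w c) = sc c (gm w)" by (simp add: GM_def)

lemma gm_flag: "gm (flag b w) = gm w" by (cases w) auto

lemma GM_J_mult: "GM (W J * x) = GM x"
  by (rule linmap_eqI[of "\<lambda>x. GM (W J * x)"])
    (auto simp: W_mult gm_flag intro!: linmap_comp[OF linmap_GM] linmap_mult_right)

lemma GM_letter_mult:
  "GM (W (Gap True l 0) * z) = sc (pm (ldeg l)) (W (Gap True l 0) * (uu * lb (uu * z) + GM z))"
proof (rule linmap_eqI[of "\<lambda>z. GM (W (Gap True l 0) * z)"])
  fix w :: wrd
  show "GM (W (Gap True l 0) * W w) = sc (pm (ldeg l)) (W (Gap True l 0) * (uu * lb (uu * W w) + GM (W w)))"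
    by (simp add: W_mult)
qed (intro linmap_comp[OF linmap_GM] linmap_mult_right linmap_sc_left linmap_mult_right' linmap_plus
    linmap_comp[OF linmap_lb] linmap_GM)+

lemma pf_J: "pf f \<Longrightarrow> W f = W J * (W f :: 'k::field wmod)"
  by (cases f) (auto simp: W_mult)

text \<open>Only the cut at the displayed \<open>u\<close> survives. At a cut inside
  \<open>f\<close> the factor \<open>u\<close> meets a gap with \<open>j\<close>; the cuts inside
  \<open>y\<close> cancel because \<open>gm\<close> takes the same value on \<open>y\<close> and on
  \<open>j y\<close>.\<close>

lemma GM_pf: "pf f \<Longrightarrow> GM (W f * (uu * y)) = sc (pm (wdeg f)) (W f * (uu * lb (uu * y)))"
proof (induction f rule: pf.induct)
  case (2 b l f)
  have b: "b" using 2 by simp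
  have f: "W (Gap True l f) = (W (Gap True l 0) * W f :: 'a wmod)" by (simp add: W_mult)
  show ?case
  proof (cases "f = 0")
    case True
    have "GM (uu * y) = 0" by (simp add: uu_def left_diff_distrib linmap_diff GM_J_mult)
    then show ?thesis using b True by (simp add: GM_letter_mult)
  next
    case False
    then have p: "pf f" using 2 by simp
    have "uu * (W f * (uu * y)) = 0" by (subst pf_J[OF p]) (simp add: mult.assoc)
    then show ?thesis
      using b 2 p False unfolding f
      by (simp add: f mult.assoc GM_letter_mult linmap_zero sc_mult_right pm_add)
  qed
qed simp

lemma gm_HW': "wval w \<Longrightarrow> (gm w :: 'k::field wmod) \<in> supp (HW' (wxc w) (wdeg w - 1))"
proof (induction w rule: gm.induct)
  case (2 b l w)
  have "uu * W w \<in> (supp (HW (0 + wxc w) (0 + wdeg w)) :: 'k wmod set)"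
    using 2 by (intro HW_mult HW_uu W_HW) auto
  then have "uu * lb (uu * W w) \<in> (supp (HW' (0 + (0 + wxc w)) (0 + (0 + wdeg w - 1))) :: 'k wmod set)"
    by (intro HW'_mult_right HW_uu lb_HW')
  then have "uu * lb (uu * W w) + gm w \<in> (supp (HW' (wxc w) (wdeg w - 1)) :: 'k wmod set)"
    using 2 by (intro supp_add) auto
  then have "W (Gap True l 0) * (uu * lb (uu * W w) + gm w) \<in> (supp (HW' (lxc l + wxc w) (ldeg l + (wdeg w - 1))) :: 'k wmod set)"
    using 2 by (intro HW'_mult_right supp_single) (auto simp: HW_def)
  then show ?case by (simp add: supp_sc algebra_simps)
qed simp

lemma GM_HW': "x \<in> supp (HW N p) \<Longrightarrow> GM x \<in> supp (HW' N (p - 1))"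
  by (rule supp_linmap[OF linmap_GM]) (use gm_HW' in \<open>auto simp: HW_def\<close>)

text \<open>
  The filtration of the ideal generated by \<open>u\<close> by the degree of the part before the first \<open>u\<close>; \<open>GM\<close> is
  a contraction up to terms of lower filtration.
\<close>

definition GS :: "nat \<Rightarrow> int \<Rightarrow> nat \<Rightarrow> 'k::field wmod set" where
  "GS N p k = {W f * (uu * W y) | f y. pf f \<and> wval f \<and> wval y \<and> y \<noteq> 0 \<and> wxc f + wxc y = N \<and>
     wdeg f + wdeg y = p \<and> - wdeg f < int k}"

lemma GS_base:
  "pf f \<Longrightarrow> wval f \<Longrightarrow> wval y \<Longrightarrow> y \<noteq> 0 \<Longrightarrow> wxc f + wxc y = N \<Longrightarrow> wdeg f + wdeg y = p \<Longrightarrow>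
    - wdeg f < int k \<Longrightarrow> W f * (uu * W y) \<in> GS N p k"
  unfolding GS_def by blast

lemma GS_HW': "x \<in> lspan (GS N p k) \<Longrightarrow> (x :: 'k::field wmod) \<in> supp (HW' N p)"
proof (induction rule: lspan.induct)
  case (base x)
  then obtain f y where "x = W f * (uu * W y)" and f: "wval f" "wval y" "y \<noteq> 0" "wxc f + wxc y = N" "wdeg f + wdeg y = p"
    by (auto simp: GS_def)
  moreover have "W y \<in> (supp (HW' (wxc y) (wdeg y)) :: 'k wmod set)"
    using f by (intro supp_single) (auto simp: HW'_def HW_def)
  ultimately show ?case
    using HW'_mult_right[OF W_HW[OF f(1)] HW'_mult_right[OF HW_uu], of "W y" "wxc y" "wdeg y"] by simp
qed (auto intro: supp_add supp_sc)

lemma GS_I: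
  assumes "r \<in> supp (HW' M q)" "pf f" "wval f" "wxc f + M = N" "wdeg f + q = p" "- wdeg f < int k"
  shows "W f * (uu * r) \<in> lspan (GS N p k :: 'k::field wmod set)"
proof (rule lspan_linmap[where A = "\<lambda>r. W f * (uu * r)"])
  fix y assume "y \<in> keys r"
  then have "y \<in> HW' M q" using assms(1) by (auto simp: supp_def)
  then show "W f * (uu * W y) \<in> lspan (GS N p k :: 'k wmod set)"
    using assms(2-) by (intro lspan.base) (auto simp: GS_def HW'_def HW_def)
qed (intro linmap_mult_right' linmap_mult_right)

lemma letter_GS:
  assumes "x \<in> lspan (GS N p k)" "lval l"
  shows "W (Gap True l 0) * x \<in> lspan (GS (lxc l + N) (ldeg l + p) (k + nat (- ldeg l)) :: 'k::field wmod set)"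
proof (rule lspan_map[OF assms(1) linmap_mult_right])
  fix b :: "'k wmod" assume "b \<in> GS N p k"
  then obtain f y where b: "b = W f * (uu * W y)" and f: "pf f" "wval f" "wval y" "y \<noteq> 0" "wxc f + wxc y = N"
      "wdeg f + wdeg y = p" "- wdeg f < int k"
    by (auto simp: GS_def)
  have "W (Gap True l 0) * b = W (Gap True l f) * (uu * W y)"
    by (simp add: b mult.assoc[symmetric] W_mult)
  moreover have "W (Gap True l f) * (uu * W y) \<in> (GS (lxc l + N) (ldeg l + p) (k + nat (- ldeg l)) :: 'k wmod set)"
    by (rule GS_base) (use f assms(2) lval_ldeg(1)[OF assms(2)] in auto)
  ultimately show "W (Gap True l 0) * b \<in> lspan (GS (lxc l + N) (ldeg l + p) (k + nat (- ldeg l)))"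
    by (simp add: lspan.base)
qed

text \<open>Gaps are filled from left to right: a gap differs from the gap with \<open>j\<close> by
  a term that has \<open>u\<close> there. The last gap already contains \<open>j\<close>, since
  \<open>w + J = w\<close>; this also keeps the factor \<open>y\<close> behind \<open>u\<close>
  nonempty.\<close>

lemma full_GS:
  "wval w \<Longrightarrow> w + J = w \<Longrightarrow>
    W J * W w - W (full w) \<in> lspan (GS (wxc w) (wdeg w) (Suc (nat (- wdeg w))) :: 'k::field wmod set)"
proof (induction w rule: full.induct)
  case (1 b)
  then show ?case by (cases b) (simp_all add: W_mult lspan.zero)
next
  case (2 b l v)
  have v: "wval v" "v + J = v" "lval l" using 2 by auto
  then have "v \<noteq> 0" by (metis Gap_neq_0(2) plus_wrd_eq_0)
  have dv: "wdeg v \<le> 0" "ldeg l \<le> 0" using lval_ldeg v by auto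
  let ?e = "W (Gap True l 0) :: 'k wmod"
  have "W J * W (Gap b l v) - W (full (Gap b l v)) = ?e * (uu * W v) + ?e * (W J * W v - W (full v))"
    by (simp add: W_mult uu_def left_diff_distrib right_diff_distrib)
  moreover have "?e * (uu * W v) \<in> lspan (GS (wxc (Gap b l v)) (wdeg (Gap b l v)) (Suc (nat (- wdeg (Gap b l v)))))"
    by (rule GS_I[of _ "wxc v" "wdeg v"]) (use v \<open>v \<noteq> 0\<close> dv in \<open>auto simp: HW'_def HW_def intro!: supp_single\<close>)
  moreover have "?e * (W J * W v - W (full v)) \<in> lspan (GS (lxc l + wxc v) (ldeg l + wdeg v) (Suc (nat (- wdeg v)) + nat (- ldeg l)))"
    using 2 v by (intro letter_GS) auto
  moreover have "Suc (nat (- wdeg v)) + nat (- ldeg l) = Suc (nat (- wdeg (Gap b l v)))"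
    using dv by simp
  ultimately show ?case by (simp add: lspan.add)
qed

text \<open>Like \<open>GS\<close>, but without a bound on the degree of \<open>f\<close>, and with
  \<open>y\<close> possibly empty: these elements arise from the differential of the prefix and are
  then multiplied by a further nonempty factor.\<close>

definition GU :: "nat \<Rightarrow> int \<Rightarrow> 'k::field wmod set" where
  "GU N p = {W f * (uu * W y) | f y. pf f \<and> wval f \<and> wval y \<and> wxc f + wxc y = N \<and> wdeg f + wdeg y = p}"

lemma GU_base:
  "pf f \<Longrightarrow> wval f \<Longrightarrow> wval y \<Longrightarrow> wxc f + wxc y = N \<Longrightarrow> wdeg f + wdeg y = p \<Longrightarrow>
    W f * (uu * W y) \<in> GU N p"
  unfolding GU_def by blast

text \<open>Splitting \<open>v u = u v - u v j + j v u\<close> puts \<open>u\<close> into the first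
  gap of two terms and leaves the third to the recursion. Thus \<open>u\<close> at the end is traded
  for a first \<open>u\<close> further left.\<close>

lemma J_uu_GU:
  "wval z \<Longrightarrow> W J * (W z * uu) \<in> lspan (GU (wxc z) (wdeg z) :: 'k::field wmod set)"
proof (induction z rule: full.induct)
  case (1 b)
  then show ?case by (cases b) (simp_all add: lspan.zero W_mult mult.assoc[symmetric] uu_def right_diff_distrib)
next
  case (2 b l v)
  have v: "wval v" "lval l" using 2 by auto
  let ?e = "W (Gap True l 0) :: 'k wmod"
  let ?S = "lspan (GU (wxc (Gap b l v)) (wdeg (Gap b l v)) :: 'k wmod set)"
  have "W (Gap True l v) = ?e * W v" by (simp add: W_mult)
  then have "W J * (W (Gap b l v) * uu) = ?e * (W v * uu)"
    by (simp add: mult.assoc[symmetric] W_mult)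
  also have "\<dots> = ?e * (uu * W v) - ?e * (uu * W (v + J)) + ?e * (W J * (W v * uu))"
    by (simp add: W_mult[symmetric] uu_def left_diff_distrib right_diff_distrib mult.assoc)
  finally have E: "W J * (W (Gap b l v) * uu) = \<dots>" .
  have "?e * (uu * W y) \<in> ?S" if "wval y" "wxc y = wxc v" "wdeg y = wdeg v" for y
    by (rule lspan.base[OF GU_base]) (use that v in auto)
  then have "?e * (uu * W v) \<in> ?S" "?e * (uu * W (v + J)) \<in> ?S" using v by auto
  moreover have "?e * (W J * (W v * uu)) \<in> ?S"
  proof (rule lspan_map[OF _ linmap_mult_right])
    show "W J * (W v * uu) \<in> lspan (GU (wxc v) (wdeg v) :: 'k wmod set)" using 2 v by simp
    fix g :: "'k wmod" assume "g \<in> GU (wxc v) (wdeg v)"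
    then obtain f y where g: "g = W f * (uu * W y)" and f: "pf f" "wval f" "wval y" "wxc f + wxc y = wxc v"
        "wdeg f + wdeg y = wdeg v" by (auto simp: GU_def)
    have "?e * g = W (Gap True l f) * (uu * W y)" by (simp add: g mult.assoc[symmetric] W_mult)
    also have "\<dots> \<in> GU (wxc (Gap b l v)) (wdeg (Gap b l v))"
      by (rule GU_base) (use f v in auto)
    finally show "?e * g \<in> ?S" by (rule lspan.base)
  qed
  ultimately show ?case unfolding E by (intro lspan.add lspan_diff)
qed

text \<open>The terms in which the differential hits \<open>y\<close> cancel, and
  \<open>p_2(1, -)\<close> reproduces \<open>x\<close>. What remains contains
  \<open>dw f * uu\<close>; by \<open>J_uu_GU\<close> it is a combination of elements
  \<open>f' u z\<close>, on which \<open>GM_pf\<close> applies again.\<close>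

lemma GM_homotopy:
  assumes "x \<in> GS N p (Suc k)"
  shows "DW (GM x) + GM (DW x) - x \<in> lspan (GS N p k :: 'k::field wmod set)"
proof -
  obtain f y where x: "x = W f * (uu * W y)" and f: "pf f" "wval f" "wval y" "y \<noteq> 0" "wxc f + wxc y = N"
      "wdeg f + wdeg y = p" "- wdeg f < int (Suc k)"
    using assms by (auto simp: GS_def)
  let ?s = "pm (wdeg f) :: 'k" and ?t = "lb (uu * W y) :: 'k wmod"
  have ny: "uu * W y \<in> (supp (- {0}) :: 'k wmod set)"
  proof -
    have "flag True y \<noteq> 0" using f(4) by (cases y) (auto simp: zero_wrd_def)
    then show ?thesis
      unfolding uu_def left_diff_distrib using f(4) by (auto simp: W_mult intro!: supp_diff supp_single)
  qed
  have "DW ?t = uu * W y - lb (uu * dw y)"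
    using DW_lb[OF ny] by (simp add: DW_uu_mult)
  then have "DW (GM x) = sc ?s (dw f * (uu * ?t)) + x - W f * (uu * lb (uu * dw y))"
    unfolding x GM_pf[OF f(1)] by (simp add: linmap_sc DW_W_mult DW_uu_mult sc_add right_diff_distrib)
  moreover have "DW x = dw f * (uu * W y) + sc ?s (W f * (uu * dw y))"
    unfolding x by (simp add: DW_W_mult DW_uu_mult)
  then have "GM (DW x) = GM (dw f * (uu * W y)) + W f * (uu * lb (uu * dw y))"
    by (simp add: linmap_add linmap_sc GM_pf[OF f(1)])
  ultimately have E: "DW (GM x) + GM (DW x) - x = sc ?s (dw f * uu * ?t) + GM (dw f * uu * W y)"
    by (simp add: mult.assoc)
  have "dw f = W J * (dw f :: 'k wmod)" using arg_cong[OF pf_J[OF f(1), where 'k = 'k], of DW] by (simp add: DW_J_mult)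
  then have du: "dw f * uu = W J * (dw f * uu :: 'k wmod)" by (metis mult.assoc)
  have "W J * (dw f * uu) \<in> lspan (GU (wxc f) (wdeg f + 1) :: 'k wmod set)"
  proof (rule lspan_linmap[where A = "\<lambda>r. W J * (r * uu)"])
    fix z assume "z \<in> keys (dw f :: 'k wmod)"
    then have "wval z" "wxc z = wxc f" "wdeg z = wdeg f + 1"
      using d_supp(2)[OF f(2), where 'k = 'k] by (auto simp: supp_def HW'_def HW_def)
    then show "W J * (W z * uu) \<in> lspan (GU (wxc f) (wdeg f + 1) :: 'k wmod set)" using J_uu_GU[of z, where 'k = 'k] by simp
  qed (intro linmap_mult_right' linmap_mult_left)
  then have "dw f * uu \<in> lspan (GU (wxc f) (wdeg f + 1) :: 'k wmod set)" using du by simp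
  then have "(\<lambda>v. sc ?s (v * ?t) + GM (v * W y)) (dw f * uu) \<in> lspan (GS N p k :: 'k wmod set)"
  proof (rule lspan_map)
    show "linmap (\<lambda>v. sc ?s (v * ?t) + GM (v * W y))"
      by (intro linmap_plus linmap_sc_left linmap_mult_left linmap_comp[OF linmap_GM])
    fix g :: "'k wmod" assume "g \<in> GU (wxc f) (wdeg f + 1)"
    then obtain f' z where g: "g = W f' * (uu * W z)" and f': "pf f'" "wval f'" "wval z" "wxc f' + wxc z = wxc f"
        "wdeg f' + wdeg z = wdeg f + 1" by (auto simp: GU_def)
    \<comment> \<open>\<open>wdeg z \<le> 0\<close> gives \<open>wdeg f' \<ge> wdeg f + 1\<close>,
      so the filtration index drops.\<close>
    have b: "- wdeg f' < int k" using f' f(7) lval_ldeg(2)[OF f'(3)] by simp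
    have t: "?t \<in> supp (HW' (wxc y) (wdeg y - 1))"
      using lb_HW'[OF HW_mult[OF HW_uu W_HW[OF f(3)]], where 'a = 'k] by simp
    have "W f' * (uu * (W z * ?t)) \<in> lspan (GS N p k :: 'k wmod set)"
      by (rule GS_I[OF HW'_mult_right[OF W_HW[OF f'(3)] t]]) (use f' f b in auto)
    moreover have "W f' * (uu * lb (uu * (W z * W y))) \<in> lspan (GS N p k :: 'k wmod set)"
      by (rule GS_I[OF lb_HW'[OF HW_mult[OF HW_uu HW_mult[OF W_HW[OF f'(3)] W_HW[OF f(3)]]]]]) (use f' f b in auto)
    ultimately show "sc ?s (g * ?t) + GM (g * W y) \<in> lspan (GS N p k)"
      unfolding g mult.assoc GM_pf[OF f'(1)] by (intro lspan.add lspan.scale)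
  qed
  then show ?thesis unfolding E .
qed

text \<open>Induction on the filtration, subtracting the boundary of \<open>GM x\<close>. It ends
  because no prefix has positive degree, so \<open>GS N p 0\<close> is empty.\<close>

lemma GS_acyclic:
  "x \<in> lspan (GS N p k) \<Longrightarrow> DW x = 0 \<Longrightarrow> \<exists>y\<in>supp (HW' N (p - 1)). DW y = (x :: 'k::field wmod)"
proof (induction k arbitrary: x)
  case 0
  have "GS N p 0 = ({} :: 'k wmod set)" 
  proof -
    have False if "g \<in> GS N p 0" for g :: "'k wmod"
      using that by (auto simp: GS_def dest!: lval_ldeg(2))
    then show ?thesis by blast
  qed
  with 0(1) have "x \<in> lspan {}" by simp
  then have "x = 0" by (induction rule: lspan.induct) auto
  then show ?case by (intro bexI[of _ 0]) (simp_all add: linmap_zero)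
next
  case (Suc k)
  have "DW (GM x) + GM (DW x) - x \<in> lspan (GS N p k)"
    by (rule lspan_map[OF Suc.prems(1), where A = "\<lambda>x. DW (GM x) + GM (DW x) - x"])
      (intro linmap_sub linmap_plus linmap_comp[OF linmap_ops(1)] linmap_comp[OF linmap_GM] linmap_GM
        linmap_ops linmap_id GM_homotopy)+
  then have x': "x - DW (GM x) \<in> lspan (GS N p k)"
    using lspan_minus[of "DW (GM x) - x"] Suc.prems(2) by (simp add: linmap_zero)
  have G: "GM x \<in> supp (HW' N (p - 1))" by (intro GM_HW' HW'_HW GS_HW'[OF Suc.prems(1)])
  then have "DW (x - DW (GM x)) = 0" using DW_DW[OF G] Suc.prems(2) by (simp add: linmap_diff)
  from Suc.IH[OF x' this] obtain y where "y \<in> supp (HW' N (p - 1))" "DW y = x - DW (GM x)" by blast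
  then show ?case using G by (intro bexI[of _ "GM x + y"]) (simp_all add: linmap_add supp_add)
qed

text \<open>The corner condition makes every word end in \<open>j\<close>, as \<open>full_GS\<close>
  requires, and yields \<open>W J * x = x\<close>; with \<open>FU x = 0\<close> this places
  \<open>x\<close> itself in the span of \<open>GS\<close>.\<close>

lemma corner_kernel_acyclic:
  fixes x :: "'k::field wmod"
  assumes x: "x \<in> supp (HW' N p)" and j: "x = W J * x * W J" and k: "FU x = 0" and d: "DW x = 0"
  shows "\<exists>y\<in>supp (HW' N (p - 1)). DW y = x"
proof -
  let ?S = "{w. w \<in> HW' N p \<and> w + J = w}"
  have "W J * x * W J \<in> supp ((\<lambda>w. J + w + J) ` UNIV)"
    by ( rule supp_linmap[where A = "\<lambda>x. W J * x * W J" and S = UNIV])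
      (auto simp: W_mult supp_def[of UNIV] intro!: linmap_mult_left' linmap_mult_right supp_single)
  then have "keys x \<subseteq> (\<lambda>w. J + w + J) ` UNIV" using j by (simp add: supp_def)
  moreover have "J + w + J + J = J + w + J" for w by (simp add: add.assoc)
  ultimately have "w + J = w" if "w \<in> keys x" for w using that by auto
  then have S: "x \<in> supp ?S" using x unfolding supp_def by blast
  have "W J * x - FU x \<in> lspan (GS N p (Suc (nat (- p))))"
  proof (rule lspan_linmap[where A = "\<lambda>x. W J * x - FU x"])
    fix w assume "w \<in> keys x"
    then have "w \<in> ?S" using S by (auto simp: supp_def)
    then show "W J * W w - FU (W w) \<in> lspan (GS N p (Suc (nat (- p))) :: 'k wmod set)"
      using full_GS[of w, where 'k = 'k] by (auto simp: HW'_def HW_def)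
  qed (intro linmap_sub linmap_mult_right linmap_FU)
  moreover have "W J * x = x"
  proof -
    have "W J * x = W J * (W J * x * W J)" using j by simp
    also have "\<dots> = W J * x * W J" by (simp only: mult.assoc[symmetric] JJ)
    finally show ?thesis using j by simp
  qed
  ultimately show ?thesis using GS_acyclic[OF _ d] k by simp
qed

theorem words_acyclic:
  fixes x :: "'k::field wmod"
  assumes x: "x \<in> supp (HW' N p)" and d: "DW x = 0" and a: "aug x = 0"
  shows "\<exists>y\<in>supp (HW' N (p - 1)). DW y = x"
proof -
  obtain y1 where y1: "y1 \<in> supp (HW' N (p - 1))" "FU (x - DW y1) = 0"
    using cocycle_to_kernel[OF assms] by blast
  define x1 where "x1 = x - DW y1"
  have x1: "x1 \<in> supp (HW' N p)" "DW x1 = 0" "FU x1 = 0"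
    using DW_supp[OF HW'_HW[OF y1(1)]] x DW_DW[OF y1(1)] d y1(2)
    by (simp_all add: x1_def supp_diff linmap_diff)
  obtain y2 where y2: "y2 \<in> supp (HW' N (p - 1))" "DW y2 = x1 - W J * x1 * W J"
    using cocycle_corner[OF x1(1,2)] by blast
  define x2 where "x2 = W J * x1 * W J"
  have "x2 \<in> supp (HW' (0 + N + 0) (0 + p + 0))"
    unfolding x2_def by (intro HW'_mult_left[OF HW'_mult_right[OF HW_J x1(1)] HW_J])
  moreover have "x2 = W J * x2 * W J" by (simp add: x2_def mult.assoc JJ)
  moreover have "FU x2 = 0" "DW x2 = 0"
    using x1 by (simp_all add: x2_def FU_J DW_mult_J DW_J_mult)
  ultimately obtain y3 where y3: "y3 \<in> supp (HW' N (p - 1))" "DW y3 = x2"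
    using corner_kernel_acyclic[of x2 N p] by auto
  show ?thesis
  proof
    show "y1 + y2 + y3 \<in> supp (HW' N (p - 1))" using y1 y2 y3 by (intro supp_add)
    show "DW (y1 + y2 + y3) = x"
      by (simp add: linmap_add y2(2) y3(2)) (simp add: x1_def x2_def)
  qed
qed

section \<open>The augmentation of the operad\<close>

lemma linmap_aug: "linmap A \<Longrightarrow> linmap (\<lambda>x. single () (aug (A x)))"
  by (rule linmapI) (simp_all add: linmap_add linmap_sc single_add)

lemma aug_linmap_zero:
  assumes "linmap A" "x \<in> supp S" "\<And>t. t \<in> S \<Longrightarrow> aug (A (single t 1)) = 0"
  shows "aug (A x :: 'k::field wmod) = 0"
  by (subst linmap_expand[OF assms(1)]) (use assms in \<open>auto simp: supp_def intro!: sum.neutral\<close>)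

lemma free_of_P_zero [simp]: "free_of_P 0"
  by (simp add: zero_wrd_def)

lemma aug_br: "length bs \<noteq> 1 \<Longrightarrow> aug (br bs :: 'k::field wmod) = 0"
  by (simp add: br_def)

lemma aug_Br:
  "x \<in> supp {bs. length bs \<noteq> 1} \<Longrightarrow> aug (Br x :: 'k::field wmod) = 0"
  by (erule aug_linmap_zero[OF linmap_Br]) (simp add: aug_br)

text \<open>From three entries on, every term still contains a bracket. With two entries the
  differential gives \<open>a - j a\<close> or \<open>a - a j\<close> besides brackets, and
  \<open>aug\<close> does not see \<open>j\<close>.\<close>

lemma aug_dl: "lval l \<Longrightarrow> aug (dl l :: 'k::field wmod) = 0"
proof (cases l)
  case (LP as)
  assume "lval l"
  then have m: "mixed as" and v: "\<forall>a\<in>set as. wval a" using LP by auto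
  have n: "2 \<le> length as" using mixed_length[OF m] by simp
  have "(da as :: 'k lmod) \<in> supp {bs. length bs \<noteq> 1}"
    using d_supp(3)[OF v, where 'k = 'k] n by (auto simp: supp_def HL_def)
  then have d: "aug (Br (da as :: 'k lmod)) = 0" by (rule aug_Br)
  show ?thesis
  proof (cases "length as = 2")
    case True
    then obtain a b where as: "as = [a, b]" by (auto simp: numeral_2_eq_2 length_Suc_conv)
    have s: "{Suc 0..<2} = {1 :: nat}" by auto
    have "aug (sp as :: 'k wmod) = - aug (Br (mg as))"
      using m by (auto simp: as sp_def s mixed_def pm_def)
    then show ?thesis using d by (simp add: LP)
  next
    case False
    have "aug (Br (mg as :: 'k lmod)) = 0"
      unfolding mg_sum using n False by (intro aug_Br supp_sum supp_sc supp_single) (auto simp: length_mgr)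
    moreover have "aug (br (take i as) :: 'k wmod) = 0 \<or> aug (br (drop i as) :: 'k wmod) = 0" if "i < length as" for i
      using that n False aug_br[of "take i as", where 'k = 'k] aug_br[of "drop i as", where 'k = 'k]
      by (cases "i = 1") auto
    then have "aug (sp as :: 'k wmod) = 0" unfolding sp_def by (auto intro!: sum.neutral)
    ultimately show ?thesis using d by (simp add: LP)
  qed
qed simp

lemma aug_dw: "wval w \<Longrightarrow> aug (dw w :: 'k::field wmod) = 0"
  by (induction w rule: free_of_P.induct) (auto simp: aug_dl)

lemma aug_DW:
  "x \<in> supp (HW N p) \<Longrightarrow> aug (DW x :: 'k::field wmod) = 0"
  by (erule aug_linmap_zero[OF linmap_ops(1)]) (simp add: aug_dw HW_def)

lemma tdeg_nonpos: "wf_tree gens gar t \<Longrightarrow> tdeg gdeg t \<le> 0"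
proof (induction t)
  case (Node g ts)
  then have "sum_list (map (tdeg gdeg) ts) \<le> 0" by (intro sum_list_nonpos) auto
  moreover have "gdeg g \<le> 0" using Node.prems by (cases g) (auto simp: gens_def)
  ultimately show ?case by simp
qed simp

text \<open>All generators have nonpositive degree, so a tree of degree 0 contains
  \<open>p_n\<close> only with \<open>n = 1\<close>. No relation kills such a tree, and its normal
  form is a word without brackets.\<close>

lemma aug_nf:
  "wf_tree gens gar t \<Longrightarrow> aug (nf t :: 'k::field wmod) = (if tdeg gdeg t = 0 then 1 else 0)"
proof (induction t)
  case (Node g ts)
  have wf: "\<forall>t\<in>set ts. wf_tree gens gar t" "length ts = gar g" "g \<in> gens" using Node.prems by auto
  show ?case
  proof (cases "tdeg gdeg (Node g ts) = 0")
    case False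
    then show ?thesis using nf_cases[OF Node.prems, where 'k = 'k] free_of_P_wdeg
      by (auto simp: HW'_def HW_def simp del: nf.simps)
  next
    case True
    have neg: "tdeg gdeg t \<le> 0" if "t \<in> set ts" for t using wf that by (auto intro: tdeg_nonpos)
    show ?thesis
    proof (cases g)
      case GenM
      then obtain a b where ts: "ts = [a, b]" using wf(2) by (auto simp: numeral_2_eq_2 length_Suc_conv)
      then have "tdeg gdeg a = 0" "tdeg gdeg b = 0" using True GenM neg[of a] neg[of b] by auto
      then show ?thesis using Node.IH[of a] Node.IH[of b] wf True by (simp add: ts GenM)
    next
      case GenJ
      then show ?thesis using True by simp
    next
      case (GenP n T)
      have "sum_list (map (tdeg gdeg) ts) \<le> 0" using neg by (intro sum_list_nonpos) auto
      then have n: "n = 1" "sum_list (map (tdeg gdeg) ts) = 0" using True wf(3) GenP by (auto simp: gens_def)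
      then have "T = {} \<or> T = {1}" using wf(3) GenP by (auto simp: gens_def)
      then show ?thesis
      proof
        assume T: "T = {}"
        then obtain a where ts: "ts = [a]" using wf(2) GenP n by (auto simp: length_Suc_conv)
        then have a: "aug (nf a :: 'k wmod) = 1" using Node.IH[of a] wf n by simp
        then obtain w where "nf a = (W w :: 'k wmod)" "w \<noteq> 0"
          using nf_cases[of a, where 'k = 'k] wf ts by (auto simp: HW'_def)
        then show ?thesis using True a by (simp add: ts GenP n T mask_def)
      next
        assume T: "T = {1}"
        then have "ts = []" using wf(2) GenP n by simp
        then show ?thesis using True by (simp add: GenP n T mask_def)
      qed
    qed
  qed
qed simp

lemma aug_NF:
  assumes "f \<in> supp (tset gens gar gdeg N p)" "p \<noteq> 0"
  shows "aug (NF f :: 'k::field wmod) = 0"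
  using NF_supp[OF assms(1)] assms(2) unfolding aug_expand
  by (intro sum.neutral) (auto simp: supp_def HW'_def HW_def dest: free_of_P_wdeg)

text \<open>Degrees of trees are nonpositive, so a composite has degree 0 exactly when both factors
  have, and in this case no sign appears.\<close>

lemma aug_NF_comp:
  fixes f g :: "(gen, 'k::field) free"
  assumes f: "f \<in> supp (tset gens gar gdeg M p)" and g: "g \<in> supp (tset gens gar gdeg N q)"
    and i: "1 \<le> i" "i \<le> M"
  shows "aug (NF (free_comp gdeg i f g)) = aug (NF f) * aug (NF g)"
proof -
  have mono: "aug (NF (free_comp gdeg i (mono t) (mono s))) = (aug (nf t) * aug (nf s) :: 'k)"
    if t: "t \<in> tset gens gar gdeg M p" and s: "s \<in> tset gens gar gdeg N q" for t s
  proof -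
    have wf: "wf_tree gens gar t" "wf_tree gens gar s" "i \<le> leaves t" using t s i by (auto simp: tset_def)
    then show ?thesis
      using tdeg_nonpos[OF wf(1)] tdeg_nonpos[OF wf(2)] i
      by (auto simp: comp_mono_mono linmap_sc aug_nf wf_graft tdeg_graft pm_def)
  qed
  have tree: "aug (NF (free_comp gdeg i (mono t) g)) = (aug (nf t) * aug (NF g) :: 'k)"
    if t: "t \<in> tset gens gar gdeg M p" for t
  proof -
    have "single () (aug (NF (free_comp gdeg i (mono t) g))) = sc (aug (nf t)) (single () (aug (NF g)))"
      by (rule linmap_eq_supp[OF g]; (intro linmap_sc_left linmap_aug linmap_comp[OF linmap_NF] linmap_comp_right linmap_NF)?)
        (simp add: mono[OF t])
    then show ?thesis by (metis lookup_single_eq sc_single)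
  qed
  have "single () (aug (NF (free_comp gdeg i f g))) = sc (aug (NF g)) (single () (aug (NF f)))"
    by (rule linmap_eq_supp[OF f]; (intro linmap_sc_left linmap_aug linmap_comp[OF linmap_NF] linmap_comp_left linmap_NF)?)
      (simp add: tree mult.commute)
  then show ?thesis by (metis lookup_single_eq sc_single mult.commute)
qed

definition wu_aug :: "nat \<Rightarrow> int \<Rightarrow> 'k::field wu \<Rightarrow> 'k" where
  "wu_aug N p a = aug (NF (rep_wu a))"

lemma wu_aug_abs [simp]: "wu_aug N p (abs_wu f) = aug (NF f)"
  using rep_abs_wu[of f] by (simp add: wu_aug_def wu_ideal_iff linmap_diff)

lemma canonical_wu_aug: "canonical_map (wu_aug :: nat \<Rightarrow> int \<Rightarrow> 'k::field wu \<Rightarrow> 'k)"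
  unfolding canonical_map_def
proof (intro conjI allI impI)
  show "dg_operad_hom wu_operad assoc_operad (wu_aug :: nat \<Rightarrow> int \<Rightarrow> 'k wu \<Rightarrow> 'k)"
  proof (intro dg_operad_hom.intro dg_operad_wu dg_operad_assoc dg_operad_hom_axioms.intro)
    fix a :: "'k wu" and N p
    assume "a \<in> piece wu_operad N p"
    then obtain f where f: "a = abs_wu f" "f \<in> supp (tset gens gar gdeg N p)" by auto
    show "wu_aug N p a \<in> piece assoc_operad N p" using aug_NF[OF f(2)] by (simp add: f)
    show "wu_aug N p (scl wu_operad u a) = scl assoc_operad u (wu_aug N p a)" for u
      by (simp add: f abs_wu_scl linmap_sc)
    show "wu_aug N (p + 1) (dif wu_operad a) = dif assoc_operad (wu_aug N p a)"
      using aug_DW[OF HW'_HW[OF NF_supp[OF f(2)]]] by (simp add: f abs_wu_dif NF_dif supp_wft[OF f(2)])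
  next
    fix a a' :: "'k wu" and N p
    assume "a \<in> piece wu_operad N p" "a' \<in> piece wu_operad N p"
    then show "wu_aug N p (a + a') = wu_aug N p a + wu_aug N p a'"
      by (auto simp: abs_wu_add linmap_add)
  next
    show "wu_aug 1 0 (opid wu_operad) = opid (assoc_operad :: ('k, 'k) operad_data)" by simp
  next
    fix a b :: "'k wu" and M p N q i
    assume "a \<in> piece wu_operad M p" "b \<in> piece wu_operad N q" and i: "1 \<le> i" "i \<le> M"
    then obtain f g where f: "a = abs_wu f" "f \<in> supp (tset gens gar gdeg M p)"
      and g: "b = abs_wu g" "g \<in> supp (tset gens gar gdeg N q)" by auto
    show "wu_aug (M + N - 1) (p + q) (pcomp wu_operad i a b) = pcomp assoc_operad i (wu_aug M p a) (wu_aug N q b)"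
      by (simp add: f g abs_wu_comp supp_wft[OF f(2)] supp_wft[OF g(2)] aug_NF_comp[OF f(2) g(2) i])
  qed
  have val: "wu_aug N p (wu_gen g) = (if gdeg g = 0 then 1 else 0 :: 'k)" if "g \<in> gens" for g N p
    using corolla_tset[OF that] by (simp add: wu_gen_def aug_nf tset_def)
  show "wu_aug 2 0 (wu_gen GenM) = (1 :: 'k)" "wu_aug 0 0 (wu_gen GenJ) = (1 :: 'k)"
    by (simp_all add: val gens_def)
  show "wu_aug (n - card T) (1 - int n) (wu_gen (GenP n T)) = (0 :: 'k)" if "2 \<le> n \<and> T \<subseteq> {1..n}" for n T
    using that by (subst val) (auto simp: gens_def)
qed

section \<open>Cohomology\<close>

text \<open>A primitive of \<open>NF f\<close> among words lifts to some \<open>g\<close>, and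
  \<open>wu.D g - f\<close> lies in the ideal because its normal form is 0.\<close>

lemma exact_if_aug_zero:
  fixes f :: "(gen, 'k::field) free"
  assumes f: "f \<in> supp (tset gens gar gdeg N p)" and d: "dif wu_operad (abs_wu f) = 0" and a: "aug (NF f) = 0"
  shows "abs_wu f \<in> coboundaries wu_operad N p"
proof -
  have "wu.D f \<in> wu_ideal" using d by (simp add: abs_wu_dif abs_wu_zero[symmetric] abs_wu_eq)
  then have "DW (NF f) = 0" using NF_dif[OF supp_wft[OF f]] by (simp add: wu_ideal_iff)
  from words_acyclic[OF NF_supp[OF f] this a] obtain y where y: "y \<in> supp (HW' N (p - 1))" "DW y = NF f" by blast
  from NF_lift[OF y(1)] obtain g where g: "g \<in> supp (tset gens gar gdeg N (p - 1))" "NF g = y" by blast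
  have "wu.D g - f \<in> wu_ideal"
    using dif_wft[OF supp_wft[OF g(1)]] supp_wft[OF f] y(2)
    by (simp add: wu_ideal_iff supp_diff linmap_diff NF_dif[OF supp_wft[OF g(1)]] g(2))
  then have "abs_wu f = dif wu_operad (abs_wu g)" by (simp add: abs_wu_dif abs_wu_eq[symmetric])
  then show ?thesis unfolding coboundaries_def using g(1) by simp
qed

lemma dif_degree_zero:
  fixes f :: "(gen, 'k::field) free"
  assumes "f \<in> supp (tset gens gar gdeg N 0)"
  shows "dif wu_operad (abs_wu f) = 0"
proof -
  have "tset gens gar gdeg N 1 = {}" using tdeg_nonpos by (force simp: tset_def)
  then have "wu.D f = 0" using wu.dif_supp[OF assms] by (simp add: supp_def)
  then show ?thesis by (simp add: abs_wu_dif abs_wu_zero)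
qed

text \<open>One tree of degree 0 in each arity, built from \<open>m\<close>, \<open>j\<close> and
  the identity, so that the value of every canonical map on it is forced to be 1.\<close>

fun comb :: "nat \<Rightarrow> gen tree" where
  "comb 0 = corolla GenJ"
| "comb (Suc 0) = Leaf"
| "comb (Suc (Suc n)) = graft 1 (corolla GenM) (comb (Suc n))"

lemma comb_tset: "comb N \<in> tset gens gar gdeg N 0"
  by (induction N rule: comb.induct)
    (auto simp: tset_def corolla_def gens_def numeral_2_eq_2)

lemma canonical_comb:
  assumes "canonical_map \<phi>"
  shows "\<phi> N 0 (abs_wu (mono (comb N))) = (1 :: 'k::field)"
proof (induction N rule: comb.induct)
  case 1
  then show ?case using assms by (simp add: canonical_map_def wu_gen_def)
next
  case 2
  interpret dg_operad_hom wu_operad assoc_operad \<phi> using assms by (simp add: canonical_map_def)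
  show ?case using hom_opid by simp
next
  case (3 n)
  interpret dg_operad_hom wu_operad assoc_operad \<phi> using assms by (simp add: canonical_map_def)
  have m: "(mono (corolla GenM) :: (gen, 'k) free) \<in> supp (tset gens gar gdeg 2 0)"
    using corolla_tset[of GenM] by (intro supp_single) (simp add: gens_def)
  have c: "(mono (comb (Suc n)) :: (gen, 'k) free) \<in> supp (tset gens gar gdeg (Suc n) 0)"
    by (intro supp_single comb_tset)
  have "free_comp gdeg 1 (mono (corolla GenM)) (mono (comb (Suc n)) :: (gen, 'k) free) = mono (comb (Suc (Suc n)))"
    using comb_tset[of "Suc n"] by (subst comp_mono_mono) (auto simp: tset_def corolla_def numeral_2_eq_2)
  then have "abs_wu (mono (comb (Suc (Suc n)))) = pcomp wu_operad 1 (wu_gen GenM :: 'k wu) (abs_wu (mono (comb (Suc n))))"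
    unfolding wu_gen_def by (subst abs_wu_comp) (auto intro: supp_wft[OF m] supp_wft[OF c])
  then have "\<phi> (2 + Suc n - 1) (0 + 0) (abs_wu (mono (comb (Suc (Suc n)))))
      = \<phi> 2 0 (wu_gen GenM) * \<phi> (Suc n) 0 (abs_wu (mono (comb (Suc n))))"
    using hom_pcomp[of "wu_gen GenM" 2 0 "abs_wu (mono (comb (Suc n)))" "Suc n" 0 1] m c by (simp add: wu_gen_def)
  then show ?case using 3 assms by (simp add: canonical_map_def)
qed

lemma canonical_coboundary:
  assumes "canonical_map \<phi>" "a \<in> coboundaries wu_operad N p"
  shows "\<phi> N p a = (0 :: 'k::field)"
proof -
  interpret dg_operad_hom wu_operad assoc_operad \<phi> using assms by (simp add: canonical_map_def)
  show ?thesis using assms(2) hom_dif[of _ N "p - 1"] unfolding coboundaries_def by auto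
qed

text \<open>Uniqueness of the canonical map, obtained from exactness. In degree 0 everything is a
  cocycle, so \<open>f\<close> minus a suitable multiple of \<open>comb N\<close> is a coboundary,
  and a chain map into an operad with zero differential kills it. In other degrees the target is
  0.\<close>

lemma canonical_value:
  fixes f :: "(gen, 'k::field) free"
  assumes \<phi>: "canonical_map \<phi>" and f: "f \<in> supp (tset gens gar gdeg N p)"
  shows "\<phi> N p (abs_wu f) = aug (NF f)"
proof (cases "p = 0")
  case False
  interpret dg_operad_hom wu_operad assoc_operad \<phi> using \<phi> by (simp add: canonical_map_def)
  show ?thesis using hom_piece[of "abs_wu f" N p] f False aug_NF[OF f] by simp
next
  case True
  interpret dg_operad_hom wu_operad assoc_operad \<phi> using \<phi> by (simp add: canonical_map_def)
  let ?x = "mono (comb N) :: (gen, 'k) free"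
  let ?g = "f - sc (aug (NF f)) ?x"
  have x: "?x \<in> supp (tset gens gar gdeg N 0)" by (intro supp_single comb_tset)
  then have g: "?g \<in> supp (tset gens gar gdeg N 0)" using f True by (intro supp_diff supp_sc) auto
  have "aug (nf (comb N) :: 'k wmod) = 1" using comb_tset[of N] by (simp add: aug_nf tset_def)
  then have "aug (NF ?g) = 0" by (simp add: linmap_diff linmap_sc)
  then have "\<phi> N 0 (abs_wu ?g) = 0"
    by (intro canonical_coboundary[OF \<phi>] exact_if_aug_zero[OF g] dif_degree_zero[OF g])
  moreover have "\<phi> N 0 (abs_wu ?g + wu_scl (aug (NF f)) (abs_wu ?x)) = \<phi> N 0 (abs_wu ?g) + \<phi> N 0 (wu_scl (aug (NF f)) (abs_wu ?x))"
    using g supp_sc[OF x] by (intro hom_add) (auto simp: abs_wu_scl)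
  moreover have "\<phi> N 0 (wu_scl (aug (NF f)) (abs_wu ?x)) = aug (NF f)"
    using hom_scl[of "abs_wu ?x" N 0 "aug (NF f)"] x canonical_comb[OF \<phi>, of N] by simp
  ultimately show ?thesis using True by (simp add: abs_wu_scl abs_wu_add)
qed

text \<open>Under the hypotheses the classes of \<open>A\<close> are the fibres of
  \<open>\<phi>\<close> on cocycles. The target has zero differential, so its classes are
  singletons, and a fibre is sent to its value.\<close>

lemma bij_cohomology_map:
  fixes \<phi> :: "nat \<Rightarrow> int \<Rightarrow> 'a::ab_group_add \<Rightarrow> 'k::field"
  assumes eq: "\<And>a b. a \<in> cocycles A N p \<Longrightarrow> b \<in> cocycles A N p \<Longrightarrow>
      \<phi> N p a = \<phi> N p b \<longleftrightarrow> a - b \<in> coboundaries A N p"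
    and im: "\<phi> N p ` cocycles A N p = piece assoc_operad N p"
  shows "bij_betw (cohomology_map assoc_operad \<phi> N p) (cohomology A N p) (cohomology assoc_operad N p)"
proof -
  let ?H = "cocycles A N p" and ?K = "piece assoc_operad N p :: 'k set"
  have K: "cocycles assoc_operad N p = ?K" "coboundaries assoc_operad N p = ({0} :: 'k set)"
    unfolding cocycles_def coboundaries_def by (auto simp: image_iff)
  have A: "cohomology A N p = (\<lambda>a. {b \<in> ?H. \<phi> N p b = \<phi> N p a}) ` ?H"
  proof -
    have "{(a, b). a \<in> ?H \<and> b \<in> ?H \<and> a - b \<in> coboundaries A N p} `` {a} = {b \<in> ?H. \<phi> N p b = \<phi> N p a}"
      if "a \<in> ?H" for a
      using that by (auto simp: eq[symmetric])
    then show ?thesis unfolding cohomology_def quotient_def by auto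
  qed
  have B: "cohomology assoc_operad N p = (\<lambda>b. {b}) ` ?K"
    unfolding cohomology_def quotient_def K by (auto simp: image_iff Image_def)
  have M: "cohomology_map assoc_operad \<phi> N p {b \<in> ?H. \<phi> N p b = \<phi> N p a} = {\<phi> N p a}" if "a \<in> ?H" for a
    unfolding cohomology_map_def K using that im by auto
  show ?thesis
    unfolding A B im[symmetric]
    by (rule bij_betw_imageI) (auto simp: inj_on_def M image_image cong: image_cong)
qed

lemma canonical_quasi_iso:
  fixes \<phi> :: "nat \<Rightarrow> int \<Rightarrow> 'k::field wu \<Rightarrow> 'k"
  assumes \<phi>: "canonical_map \<phi>"
  shows "quasi_iso wu_operad assoc_operad \<phi>"
  unfolding quasi_iso_def
proof (intro conjI allI bij_cohomology_map)
  show "dg_operad_hom wu_operad assoc_operad \<phi>" using \<phi> by (simp add: canonical_map_def)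
next
  fix N p and a b :: "'k wu"
  assume ab: "a \<in> cocycles wu_operad N p" "b \<in> cocycles wu_operad N p"
  then obtain f g :: "(gen, 'k) free" where f: "a = abs_wu f" "f \<in> supp (tset gens gar gdeg N p)" "dif wu_operad (abs_wu f) = 0"
    and g: "b = abs_wu g" "g \<in> supp (tset gens gar gdeg N p)" "dif wu_operad (abs_wu g) = 0"
    by (auto simp: cocycles_def)
  have fg: "f - g \<in> supp (tset gens gar gdeg N p)" using f g by (intro supp_diff)
  have d: "dif wu_operad (abs_wu (f - g)) = 0"
    using f(3) g(3) by (simp add: abs_wu_dif linmap_diff) (simp add: abs_wu_diff[symmetric])
  have "aug (NF (f - g)) = 0 \<longleftrightarrow> abs_wu (f - g) \<in> coboundaries wu_operad N p"
    using exact_if_aug_zero[OF fg d] canonical_coboundary[OF \<phi>, of "abs_wu (f - g)" N p] canonical_value[OF \<phi> fg] by auto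
  then show "\<phi> N p a = \<phi> N p b \<longleftrightarrow> a - b \<in> coboundaries wu_operad N p"
    by (simp add: f(1) g(1) canonical_value[OF \<phi> f(2)] canonical_value[OF \<phi> g(2)] abs_wu_diff linmap_diff)
next
  fix N p
  interpret dg_operad_hom wu_operad assoc_operad \<phi> using \<phi> by (simp add: canonical_map_def)
  have "c \<in> \<phi> N p ` cocycles wu_operad N p" if c: "c \<in> piece assoc_operad N p" for c
  proof
    let ?f = "sc c (mono (comb N)) :: (gen, 'k) free"
    have f: "?f \<in> supp (tset gens gar gdeg N p)"
      using c supp_sc[OF supp_single[OF comb_tset[of N]], of c 1] by (cases "p = 0") auto
    have "aug (nf (comb N) :: 'k wmod) = 1" using comb_tset[of N] by (simp add: aug_nf tset_def)
    then show "c = \<phi> N p (abs_wu ?f)" by (simp only: canonical_value[OF \<phi> f] linmap_sc[OF linmap_NF]) simp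
    have "dif wu_operad (abs_wu ?f) = 0"
      by (rule dif_degree_zero[where N = N]) (intro supp_sc supp_single comb_tset)
    then show "abs_wu ?f \<in> cocycles wu_operad N p" using f unfolding cocycles_def by auto
  qed
  then show "\<phi> N p ` cocycles wu_operad N p = piece assoc_operad N p"
    using hom_piece unfolding cocycles_def by blast
qed

theorem theorem1p13:
  shows "(\<exists>\<phi> :: nat \<Rightarrow> int \<Rightarrow> 'k::field wu \<Rightarrow> 'k. canonical_map \<phi>) \<and>
         (\<forall>\<phi> :: nat \<Rightarrow> int \<Rightarrow> 'k wu \<Rightarrow> 'k.
            canonical_map \<phi> \<longrightarrow> quasi_iso wu_operad assoc_operad \<phi>) \<and>
         quasi_isomorphic (wu_operad :: ('k, 'k wu) operad_data)
                          (assoc_operad :: ('k, 'k) operad_data)"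
proof (intro conjI exI allI impI)
  show "canonical_map (wu_aug :: nat \<Rightarrow> int \<Rightarrow> 'k wu \<Rightarrow> 'k)" by (rule canonical_wu_aug)
  show "quasi_iso wu_operad assoc_operad \<phi>" if "canonical_map \<phi>" for \<phi> :: "nat \<Rightarrow> int \<Rightarrow> 'k wu \<Rightarrow> 'k"
    using that by (rule canonical_quasi_iso)
  show "quasi_isomorphic (wu_operad :: ('k, 'k wu) operad_data) (assoc_operad :: ('k, 'k) operad_data)"
    \<comment> \<open>A zigzag of length one: the intermediate operad is \<open>wu_operad\<close>
      itself.\<close>
    unfolding quasi_isomorphic_def using canonical_quasi_iso[OF canonical_wu_aug] by blast
qed

end
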